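(* Let $m\in\mathbb{N}$ be fixed, let $\mathcal{H}^S$ be an $m$-dimensional complex Hilbert space, and for each $n\in\mathbb{N}$ let $\mathcal{H}^E$ be an $n$-dimensional complex Hilbert space and $\mu_n$ the unitarily invariant probability measure on the unit vectors of $\mathcal{H}^S\otimes\mathcal{H}^E$. For a unit vector $|\Psi\rangle$ put $\rho_\Psi:=\mathrm{Tr}_E[|\Psi\rangle\langle\Psi|]$, and let $\pi:=I/m$. Let $\Omega\subseteq\mathcal{S}(\mathcal{H}^S)$ be a nonempty set such that $\mathrm{cl}(\mathrm{int}\,\Omega)=\mathrm{cl}\,\Omega$. Define $$\Omega_*:=\Big\{\rho\in\mathrm{cl}\,\Omega\;\Big|\;D(\pi\|\rho)=\min_{\rho'\in\mathrm{cl}\,\Omega}D(\pi\|\rho')\Big\},\qquad \mathcal{B}_\epsilon(\Omega_* ):=\Big\{\rho\in\mathcal{S}(\mathcal{H}^S)\;\Big|\;\inf_{\sigma\in\Omega_*}\tfrac12\|\rho-\sigma\|_1\le\epsilon\Big\}.$$ Then for any $\epsilon>0$ there exists $\delta>0$ such that $$-\limsup_{n\to\infty}\frac1n\ln\frac{\Pr\{\rho_\Psi\in\Omega\setminus\mathcal{B}_\epsilon(\Omega_* )\mid\Psi\sim\mu_n\}}{\Pr\{\rho_\Psi\in\Omega\mid\Psi\sim\mu_n\}}\;\ge\;\delta.$$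
   Context: $\mathcal{S}(\mathcal{H}^S)$ is the set of density operators (positive semidefinite, trace one) on $\mathcal{H}^S$, regarded as a metric space with the trace distance $\frac12\|\rho-\sigma\|_1$; closure $\mathrm{cl}$ and interior $\mathrm{int}$ are taken in this metric space. Subsets are understood to be such that the probabilities are defined (measurable). $D(\sigma\|\rho):=\mathrm{Tr}[\sigma\ln\sigma-\sigma\ln\rho]$ is the quantum relative entropy with natural logarithm; $D(\pi\|\rho)=+\infty$ if $\rho$ is not of full rank. Convention: $\ln 0=-\infty$. The notation $\Psi\sim\mu_n$ means that $|\Psi\rangle$ is drawn according to $\mu_n$. *)

theory Defs
  imports "HOL-Probability.Probability"
begin

section \<open>Operators on the system space\<close>

text \<open>The system space is \<^typ>\<open>complex ^ 'm\<close> with dimension \<open>m = CARD('m)\<close>; operators on it are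
  matrices.\<close>

definition adj :: "complex ^ 'm ^ 'm \<Rightarrow> complex ^ 'm ^ 'm" where
  "adj A = map_matrix cnj (transpose A)"

definition hermitian :: "complex ^ 'm ^ 'm \<Rightarrow> bool" where
  "hermitian A \<longleftrightarrow> adj A = A"

definition unitary :: "complex ^ 'm ^ 'm \<Rightarrow> bool" where
  "unitary U \<longleftrightarrow> adj U ** U = mat 1 \<and> U ** adj U = mat 1"

definition pos_semidef :: "complex ^ 'm ^ 'm \<Rightarrow> bool" where
  "pos_semidef A \<longleftrightarrow> hermitian A \<and> (\<forall>v. 0 \<le> Re (\<Sum>i\<in>UNIV. cnj (v $ i) * (A *v v) $ i))"

definition density_ops :: "(complex ^ 'm ^ 'm) set" where
  "density_ops = {\<rho>. pos_semidef \<rho> \<and> trace \<rho> = 1}"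

definition max_mixed :: "complex ^ 'm ^ 'm" where
  "max_mixed = mat (1 / of_nat CARD('m))"

definition diag_real :: "('m \<Rightarrow> real) \<Rightarrow> complex ^ 'm ^ 'm" where
  "diag_real d = (\<chi> i j. if i = j then of_real (d i) else 0)"

text \<open>Functional calculus for Hermitian matrices. The result does not depend on the chosen
  diagonalisation, see \<open>herm_fun_eqI\<close> below.\<close>

definition herm_fun :: "(real \<Rightarrow> real) \<Rightarrow> complex ^ 'm ^ 'm \<Rightarrow> complex ^ 'm ^ 'm" where
  "herm_fun f A = (THE B. \<exists>U d. unitary U \<and> A = U ** diag_real d ** adj U \<and>
                                 B = U ** diag_real (f \<circ> d) ** adj U)"

lemma diag_real_mult_left: "(diag_real d ** A) $ i $ j = of_real (d i) * A $ i $ j"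
proof -
  have "(diag_real d ** A) $ i $ j = (\<Sum>k\<in>UNIV. if i = k then of_real (d i) * A $ i $ j else 0)"
    unfolding matrix_matrix_mult_def diag_real_def
    by (simp only: vec_lambda_beta, intro sum.cong) auto
  then show ?thesis by simp
qed

lemma diag_real_mult_right: "(A ** diag_real d) $ i $ j = A $ i $ j * of_real (d j)"
proof -
  have "(A ** diag_real d) $ i $ j = (\<Sum>k\<in>UNIV. if k = j then A $ i $ j * of_real (d j) else 0)"
    unfolding matrix_matrix_mult_def diag_real_def
    by (simp only: vec_lambda_beta, intro sum.cong) auto
  then show ?thesis by simp
qed

lemma herm_fun_unique:
  assumes U: "unitary U" and V: "unitary V"
    and eq: "U ** diag_real d ** adj U = V ** diag_real e ** adj V"
  shows "U ** diag_real (f \<circ> d) ** adj U = V ** diag_real (f \<circ> e) ** adj V"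
proof -
  define W where "W = adj V ** U"
  have VV: "adj V ** V = mat 1" "V ** adj V = mat 1" and UU: "adj U ** U = mat 1" "U ** adj U = mat 1"
    using U V by (auto simp: unitary_def)
  have "W ** diag_real d = W ** diag_real d ** (adj U ** U)"
    by (simp add: UU)
  also have "\<dots> = adj V ** (U ** diag_real d ** adj U) ** U"
    by (simp add: W_def matrix_mul_assoc)
  also have "\<dots> = (adj V ** V) ** diag_real e ** W"
    unfolding eq by (simp add: W_def matrix_mul_assoc)
  finally have "W ** diag_real d = diag_real e ** W"
    by (simp add: VV)
  then have "(W ** diag_real d) $ i $ j = (diag_real e ** W) $ i $ j" for i j
    by simp
  then have 1: "W $ i $ j * of_real (d j) = of_real (e i) * W $ i $ j" for i j
    unfolding diag_real_mult_left diag_real_mult_right .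
  have "W $ i $ j * of_real (f (d j)) = of_real (f (e i)) * W $ i $ j" for i j
  proof (cases "W $ i $ j = 0")
    case False
    with 1[of i j] have "d j = e i"
      by (simp add: mult.commute)
    then show ?thesis by simp
  qed simp
  then have 2: "W ** diag_real (f \<circ> d) = diag_real (f \<circ> e) ** W"
    by (simp add: vec_eq_iff diag_real_mult_left diag_real_mult_right)
  have "U ** diag_real (f \<circ> d) ** adj U = (V ** adj V) ** U ** diag_real (f \<circ> d) ** adj U"
    by (simp add: VV)
  also have "\<dots> = V ** (W ** diag_real (f \<circ> d)) ** adj U"
    by (simp add: W_def matrix_mul_assoc)
  also have "\<dots> = V ** diag_real (f \<circ> e) ** adj V ** (U ** adj U)"
    unfolding 2 by (simp only: W_def matrix_mul_assoc)
  also have "\<dots> = V ** diag_real (f \<circ> e) ** adj V"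
    by (simp add: UU)
  finally show ?thesis .
qed

lemma herm_fun_eqI:
  assumes "unitary U"
  shows "herm_fun f (U ** diag_real d ** adj U) = U ** diag_real (f \<circ> d) ** adj U"
  unfolding herm_fun_def using assms
  by (intro the_equality) (auto intro: herm_fun_unique)

definition trace_norm :: "complex ^ 'm ^ 'm \<Rightarrow> real" where
  "trace_norm A = Re (trace (herm_fun sqrt (adj A ** A)))"

definition trace_dist :: "complex ^ 'm ^ 'm \<Rightarrow> complex ^ 'm ^ 'm \<Rightarrow> real" where
  "trace_dist \<rho> \<sigma> = trace_norm (\<rho> - \<sigma>) / 2"

abbreviation state_topology :: "(complex ^ 'm ^ 'm) topology" where
  "state_topology \<equiv> Metric_space.mtopology density_ops trace_dist"

text \<open>The relative entropy \<open>D(\<sigma>\<parallel>\<rho>)\<close>, infinite unless the support of \<open>\<sigma>\<close> lies in that of \<open>\<rho>\<close>.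
  The library value \<open>ln 0 = 0\<close> only affects kernel vectors: it gives \<open>0 ln 0 = 0\<close> in \<open>\<sigma> ln \<sigma>\<close>,
  and in \<open>\<sigma> ln \<rho>\<close> the kernel of \<open>\<rho>\<close> is annihilated by \<open>\<sigma>\<close> in the finite case.\<close>

definition rel_entropy :: "complex ^ 'm ^ 'm \<Rightarrow> complex ^ 'm ^ 'm \<Rightarrow> ereal" where
  "rel_entropy \<sigma> \<rho> =
     (if \<forall>v. \<rho> *v v = 0 \<longrightarrow> \<sigma> *v v = 0
      then ereal (Re (trace (\<sigma> ** herm_fun ln \<sigma> - \<sigma> ** herm_fun ln \<rho>)))
      else \<infinity>)"

definition entropy_minimizers :: "(complex ^ 'm ^ 'm) set \<Rightarrow> (complex ^ 'm ^ 'm) set" where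
  "entropy_minimizers \<Omega> =
     {\<rho> \<in> state_topology closure_of \<Omega>.
        rel_entropy max_mixed \<rho> = (INF \<rho>'\<in>state_topology closure_of \<Omega>. rel_entropy max_mixed \<rho>')}"

definition state_nbhd :: "real \<Rightarrow> (complex ^ 'm ^ 'm) set \<Rightarrow> (complex ^ 'm ^ 'm) set" where
  "state_nbhd \<epsilon> A = {\<rho> \<in> density_ops. (INF \<sigma>\<in>A. ereal (trace_dist \<rho> \<sigma>)) \<le> ereal \<epsilon>}"


section \<open>Random bipartite pure states\<close>

text \<open>A vector in the tensor product of \<^typ>\<open>complex ^ 'm\<close> with an \<open>n\<close>-dimensional environment is
  given by its coefficients in the product basis, indexed by \<open>bip_index n\<close>; the coefficient
  functions are extensional so that they form the space of the product \<open>\<sigma>\<close>-algebra \<open>bip_borel n\<close>.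
  Operators on the tensor product are their matrix entries on this index set.\<close>

abbreviation bip_index :: "nat \<Rightarrow> ('m \<times> nat) set" where
  "bip_index n \<equiv> UNIV \<times> {..<n}"

definition bip_borel :: "nat \<Rightarrow> ('m::finite \<times> nat \<Rightarrow> complex) measure" where
  "bip_borel n = (\<Pi>\<^sub>M k\<in>bip_index n. borel)"

definition bip_unit_vecs :: "nat \<Rightarrow> ('m::finite \<times> nat \<Rightarrow> complex) set" where
  "bip_unit_vecs n = {\<psi> \<in> extensional (bip_index n). (\<Sum>k\<in>bip_index n. (cmod (\<psi> k))\<^sup>2) = 1}"

definition bip_unitary :: "nat \<Rightarrow> ('m::finite \<times> nat \<Rightarrow> 'm \<times> nat \<Rightarrow> complex) \<Rightarrow> bool" where
  "bip_unitary n U \<longleftrightarrow>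
     (\<forall>k\<in>bip_index n. \<forall>l\<in>bip_index n.
        (\<Sum>j\<in>bip_index n. cnj (U j k) * U j l) = (if k = l then 1 else 0) \<and>
        (\<Sum>j\<in>bip_index n. U k j * cnj (U l j)) = (if k = l then 1 else 0))"

definition bip_apply ::
  "nat \<Rightarrow> ('m::finite \<times> nat \<Rightarrow> 'm \<times> nat \<Rightarrow> complex) \<Rightarrow> ('m \<times> nat \<Rightarrow> complex) \<Rightarrow> 'm \<times> nat \<Rightarrow> complex"
  where "bip_apply n U \<psi> = (\<lambda>k\<in>bip_index n. \<Sum>l\<in>bip_index n. U k l * \<psi> l)"

definition unitarily_invariant_prob :: "nat \<Rightarrow> ('m::finite \<times> nat \<Rightarrow> complex) measure \<Rightarrow> bool" where
  "unitarily_invariant_prob n \<mu> \<longleftrightarrow>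
     sets \<mu> = sets (restrict_space (bip_borel n) (bip_unit_vecs n)) \<and>
     prob_space \<mu> \<and>
     (\<forall>U. bip_unitary n U \<longrightarrow> distr \<mu> \<mu> (bip_apply n U) = \<mu>)"

definition pure_proj :: "('m \<times> nat \<Rightarrow> complex) \<Rightarrow> 'm \<times> nat \<Rightarrow> 'm \<times> nat \<Rightarrow> complex" where
  "pure_proj \<psi> k l = \<psi> k * cnj (\<psi> l)"

definition partial_trace_E :: "nat \<Rightarrow> ('m \<times> nat \<Rightarrow> 'm \<times> nat \<Rightarrow> complex) \<Rightarrow> complex ^ 'm ^ 'm" where
  "partial_trace_E n T = (\<chi> a b. \<Sum>j<n. T (a, j) (b, j))"

definition reduced_state :: "nat \<Rightarrow> ('m \<times> nat \<Rightarrow> complex) \<Rightarrow> complex ^ 'm ^ 'm" where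
  "reduced_state n \<psi> = partial_trace_E n (pure_proj \<psi>)"

definition state_event ::
  "nat \<Rightarrow> ('m \<times> nat \<Rightarrow> complex) measure \<Rightarrow> (complex ^ 'm ^ 'm) set \<Rightarrow> ('m \<times> nat \<Rightarrow> complex) set"
  where "state_event n \<mu> A = {\<psi> \<in> space \<mu>. reduced_state n \<psi> \<in> A}"

definition ereal_ln :: "real \<Rightarrow> ereal" where
  "ereal_ln x = (if x = 0 then -\<infinity> else ereal (ln x))"

end

theory Submission
  imports Defs
begin

text \<open>Since \<open>D(\<pi>\<parallel>\<rho>) = - ln m - ln (det \<rho>) / m\<close>, the entropy minimizers are the maximizers of the
  determinant, and it suffices that \<open>\<rho>\<^sub>\<Psi>\<close> lies near \<open>\<rho>\<close> with probability
  \<open>(m^m det \<rho>)^n\<close> up to subexponential factors. To avoid computing densities, the invariant measure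
  of a set of states is compared with the share that the corresponding cone has of the Lebesgue
  measure of the unit ball. This share is estimated by rescaling coordinates: by unitary invariance
  \<open>\<rho>\<close> may be taken diagonal with entries \<open>d\<^sub>a\<close>, and multiplying the \<open>a\<close>-th block of coordinates by
  \<open>sqrt (m d\<^sub>a)\<close> has determinant \<open>(m^m det \<rho>)^n\<close> and carries the cone around \<open>\<pi>\<close> to the one around
  \<open>\<rho>\<close>. The upper bound, together with \<open>det \<rho> < m^(-m)\<close> for \<open>\<rho> \<noteq> \<pi>\<close>, shows that almost all of
  the ball lies in the cone around \<open>\<pi>\<close>, and this yields the lower bound.\<close>

section \<open>Spectral theorem for Hermitian matrices\<close>

text \<open>The comparison with Lebesgue measure goes one way only: the invariant measure of a set
  is at most the share of any cone that contains a neighbourhood of fixed radius r of it. Lower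
  bounds are therefore upper bounds for complements, and all volumes are estimated inside the ball,
  where coordinates can be rescaled. The sphere itself is a null set, so the smearing by r cannot be
  avoided; it is harmless because r and every other tolerance are fixed before n.

  The largest determinant M on the closure may be attained only outside the interior. Two thresholds
  b1 < b2 < M separate the estimates: by compactness, states of the closure that are far from the
  minimizers have determinant below b1, and since the interior is dense, it contains a whole
  neighbourhood of some state with determinant above b2. The quotient of the two probabilities is
  then at most a constant times (b1 / b2)^n.\<close>

definition hinner :: "complex ^ 'm \<Rightarrow> complex ^ 'm \<Rightarrow> complex" where
  "hinner v w = (\<Sum>i\<in>UNIV. cnj (v $ i) * w $ i)"

lemma hinner_commute: "hinner w v = cnj (hinner v w)"
  by (simp add: hinner_def mult.commute)

lemma hinner_add_right: "hinner u (v + w) = hinner u v + hinner u w"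
  by (simp add: hinner_def algebra_simps sum.distrib)

lemma hinner_add_left: "hinner (v + w) u = hinner v u + hinner w u"
  by (simp add: hinner_def algebra_simps sum.distrib)

lemma hinner_diff_right: "hinner u (v - w) = hinner u v - hinner u w"
  by (simp add: hinner_def algebra_simps sum_subtractf)

lemma hinner_scaleR_right: "hinner u (c *\<^sub>R v) = of_real c * hinner u v"
  by (simp add: hinner_def sum_distrib_left scaleR_conv_of_real[where 'a=complex] algebra_simps)

lemma hinner_scaleR_left: "hinner (c *\<^sub>R v) u = of_real c * hinner v u"
  by (simp add: hinner_def sum_distrib_left scaleR_conv_of_real[where 'a=complex] algebra_simps)

lemma hinner_scale_left: "hinner (c *s v) u = cnj c * hinner v u"
  by (simp add: hinner_def sum_distrib_left algebra_simps)

lemma Re_hinner: "Re (hinner v w) = v \<bullet> w"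
  by (simp add: hinner_def inner_vec_def inner_complex_def)

lemma hinner_self: "hinner v v = of_real ((norm v)\<^sup>2)"
proof (rule complex_eqI)
  show "Im (hinner v v) = Im (of_real ((norm v)\<^sup>2))"
    by (simp add: hinner_def mult.commute[of "cnj _"] complex_mult_cnj)
qed (simp add: Re_hinner power2_norm_eq_inner)

lemma hinner_adj: "hinner v (A *v w) = hinner (adj A *v v) w"
proof -
  have "hinner v (A *v w) = (\<Sum>i\<in>UNIV. \<Sum>j\<in>UNIV. cnj (v $ i) * A $ i $ j * w $ j)"
    by (simp add: hinner_def matrix_vector_mult_def sum_distrib_left mult.assoc)
  also have "\<dots> = (\<Sum>j\<in>UNIV. \<Sum>i\<in>UNIV. cnj (v $ i) * A $ i $ j * w $ j)"
    by (rule sum.swap)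
  also have "\<dots> = hinner (adj A *v v) w"
    by (simp add: hinner_def adj_def map_matrix_def matrix_vector_mult_def transpose_def
        sum_distrib_left sum_distrib_right mult_ac)
  finally show ?thesis .
qed

lemma continuous_on_hinner [continuous_intros]:
  "continuous_on S f \<Longrightarrow> continuous_on S g \<Longrightarrow> continuous_on S (\<lambda>x. hinner (f x) (g x))"
  unfolding hinner_def by (intro continuous_intros)

lemma continuous_on_matrix_vector_mult [continuous_intros]:
  fixes A :: "complex ^ 'n ^ 'm"
  shows "continuous_on S f \<Longrightarrow> continuous_on S (\<lambda>x. A *v f x)"
  unfolding matrix_vector_mult_def
  by (intro continuous_on_vec_lambda continuous_intros)

text \<open>For small t > 0 the linear term beats the quadratic one. This is the first-order
  condition at a maximum.\<close>

lemma nonpos_if_le_quadratic: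
  fixes a b :: real
  assumes "\<And>t. 2 * t * a \<le> t\<^sup>2 * b"
  shows "a \<le> 0"
proof (rule ccontr)
  assume a: "\<not> a \<le> 0"
  define t where "t = a / (\<bar>b\<bar> + 1)"
  have t: "t > 0" using a by (simp add: t_def)
  have "2 * t * a \<le> t * (t * b)" using assms[of t] by (simp add: power2_eq_square mult_ac)
  then have "2 * a \<le> t * b" using t by simp
  also have "\<dots> \<le> t * (\<bar>b\<bar> + 1)" using t by (intro mult_left_mono) auto
  also have "\<dots> = a" by (simp add: t_def add_nonneg_eq_0_iff)
  finally show False using a by simp
qed

text \<open>One complex orthogonality condition amounts to two real ones, against v and against \<i>
  v. Fewer than m vectors thus give fewer than 2 m real conditions on a space of real dimension 2
  m.\<close>

lemma unit_orthogonal_exists: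
  fixes v :: "'m::finite \<Rightarrow> complex ^ 'm"
  assumes "k \<notin> S"
  shows "\<exists>x. norm x = 1 \<and> (\<forall>i\<in>S. hinner (v i) x = 0)"
proof -
  define T where "T = v ` S \<union> (\<lambda>i. \<i> *s v i) ` S"
  have "dim T \<le> card T" by (intro dim_le_card') (simp add: T_def)
  also have "\<dots> \<le> card S + card S"
    unfolding T_def by (intro order.trans[OF card_Un_le] add_mono card_image_le) auto
  also have "\<dots> < DIM(complex ^ 'm)"
    using psubset_card_mono[of "UNIV :: 'm set" S] assms by fastforce
  finally obtain x where x: "x \<noteq> 0" "\<And>y. y \<in> span T \<Longrightarrow> orthogonal x y"
    using orthogonal_to_subspace_exists by metis
  have "hinner (v i) x = 0" if "i \<in> S" for i
  proof (rule complex_eqI)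
    have "v i \<in> span T" "\<i> *s v i \<in> span T"
      using that by (auto simp: T_def intro: span_base)
    then have "x \<bullet> v i = 0" "x \<bullet> (\<i> *s v i) = 0" using x by (auto simp: orthogonal_def)
    moreover have "Re (hinner (\<i> *s v i) x) = Im (hinner (v i) x)"
      by (simp add: hinner_scale_left)
    ultimately show "Re (hinner (v i) x) = Re 0" "Im (hinner (v i) x) = Im 0"
      by (simp_all add: Re_hinner inner_commute)
  qed
  then show ?thesis
    using x(1) by (intro exI[of _ "x /\<^sub>R norm x"]) (auto simp: hinner_scaleR_right)
qed

text \<open>The next eigenvector maximizes the quadratic form of A over the unit vectors orthogonal
  to those already found. The index set grows by induction, so that eigenvectors are labelled by the
  matrix indices themselves.\<close>

lemma hermitian_orthonormal_eigenvectors: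
  fixes A :: "complex ^ 'm ^ 'm" and S :: "'m::finite set"
  assumes A: "hermitian A"
  shows "\<exists>v d. (\<forall>i\<in>S. A *v v i = d i *\<^sub>R v i) \<and>
           (\<forall>i\<in>S. \<forall>j\<in>S. hinner (v i) (v j) = (if i = j then 1 else 0))"
proof (induction S rule: finite_induct[OF finite])
  case (2 k S)
  then obtain v d where v: "\<And>i. i \<in> S \<Longrightarrow> A *v v i = d i *\<^sub>R v i"
    and on: "\<And>i j. i \<in> S \<Longrightarrow> j \<in> S \<Longrightarrow> hinner (v i) (v j) = (if i = j then 1 else 0)"
    by blast
  have adjA: "adj A = A" using A by (simp add: hermitian_def)
  define P where "P = {x. norm x = 1 \<and> (\<forall>i\<in>S. hinner (v i) x = 0)}"
  define f where "f = (\<lambda>x. Re (hinner x (A *v x)))"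
  have "P = sphere 0 1 \<inter> (\<Inter>i\<in>S. {x. hinner (v i) x = 0})" by (auto simp: P_def)
  moreover have "closed {x. hinner (v i) x = 0}" for i
    by (intro closed_Collect_eq continuous_intros)
  ultimately have "compact P" by (auto intro!: compact_Int_closed)
  moreover have "P \<noteq> {}" using unit_orthogonal_exists[OF 2(2), of v] by (simp add: P_def)
  moreover have "continuous_on P f" unfolding f_def by (intro continuous_intros)
  ultimately obtain x where x: "x \<in> P" and max: "\<And>y. y \<in> P \<Longrightarrow> f y \<le> f x"
    using continuous_attains_sup[of P f] by blast
  define l where "l = f x"
  \<comment> \<open>The residual of the eigenvalue equation. It is orthogonal to x and to all
    earlier eigenvectors, hence an admissible direction in which to perturb x.\<close>
  define h where "h = A *v x - l *\<^sub>R x"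
  have nx: "norm x = 1" and ox: "\<And>i. i \<in> S \<Longrightarrow> hinner (v i) x = 0"
    using x by (auto simp: P_def)
  have bound: "f y \<le> l * (norm y)\<^sup>2" if y: "\<And>i. i \<in> S \<Longrightarrow> hinner (v i) y = 0" for y
  proof (cases "y = 0")
    case False
    then have "y /\<^sub>R norm y \<in> P" using y by (auto simp: P_def hinner_scaleR_right)
    from max[OF this] have "f (y /\<^sub>R norm y) \<le> l" by (simp add: l_def)
    moreover have "A *v (y /\<^sub>R norm y) = (A *v y) /\<^sub>R norm y"
      by (simp add: vec_eq_iff matrix_vector_mult_def scaleR_sum_right)
    then have "f (y /\<^sub>R norm y) = f y / (norm y)\<^sup>2"
      by (simp add: f_def hinner_scaleR_right hinner_scaleR_left power2_eq_square field_simps)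
    ultimately have "f y / (norm y)\<^sup>2 \<le> l" by simp
    then show ?thesis using False by (simp add: pos_divide_le_eq)
  qed (simp add: f_def hinner_def)
  have oA: "hinner (v i) (A *v y) = 0" if "i \<in> S" "hinner (v i) y = 0" for i y
    using that v by (simp add: hinner_adj adjA hinner_scaleR_left)
  have oh: "hinner (v i) h = 0" if "i \<in> S" for i
    using oA[OF that ox[OF that]] ox[OF that]
    by (simp add: h_def hinner_diff_right hinner_scaleR_right)
  have real: "hinner x (A *v x) = of_real l"
  proof (rule complex_eqI)
    have "hinner x (A *v x) = cnj (hinner x (A *v x))"
      by (metis hinner_adj hinner_commute adjA)
    then show "Im (hinner x (A *v x)) = Im (of_real l)" by (metis Im_complex_of_real cnj.simps(2) neg_equal_zero)
  qed (simp add: l_def f_def)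
  have xh: "hinner x h = 0" using nx
    by (simp add: h_def hinner_diff_right hinner_scaleR_right hinner_self real)
  then have hx: "hinner h x = 0" using hinner_commute[of h x] by simp
  have Ax: "A *v x = h + l *\<^sub>R x" by (simp add: h_def)
  \<comment> \<open>Maximality of x tested at \<open>x + t *\<^sub>R h\<close>: the quadratic form
    grows by \<open>2 * t * (norm h)\<^sup>2\<close> to first order, while the squared norm changes
    only to second order.\<close>
  have "2 * t * (norm h)\<^sup>2 \<le> t\<^sup>2 * (l * (norm h)\<^sup>2 - f h)" for t
  proof -
    have "f (x + t *\<^sub>R h) \<le> l * (norm (x + t *\<^sub>R h))\<^sup>2"
      by (rule bound) (simp add: hinner_add_right hinner_scaleR_right ox oh)
    moreover have "(norm (x + t *\<^sub>R h))\<^sup>2 = 1 + t\<^sup>2 * (norm h)\<^sup>2"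
    proof -
      have "x \<bullet> h = 0" using xh Re_hinner[of x h] by simp
      then show ?thesis using nx
        by (simp add: power2_norm_eq_inner inner_add_left inner_add_right inner_commute norm_eq_1)
          (simp add: power2_eq_square)
    qed
    moreover have "f (x + t *\<^sub>R h) = l + 2 * t * (norm h)\<^sup>2 + t\<^sup>2 * f h"
    proof -
      have "A *v (x + t *\<^sub>R h) = A *v x + t *\<^sub>R (A *v h)"
        by (simp add: vec_eq_iff matrix_vector_mult_def scaleR_sum_right algebra_simps sum.distrib)
      moreover have "hinner x (A *v h) = (norm h)\<^sup>2"
        using hx by (simp add: hinner_adj adjA Ax hinner_add_left hinner_scaleR_left xh hinner_self)
      moreover have "hinner h (A *v x) = (norm h)\<^sup>2"
        by (simp add: Ax hinner_add_right hinner_scaleR_right hx hinner_self)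
      ultimately show ?thesis
        by (simp add: f_def hinner_add_left hinner_add_right hinner_scaleR_left hinner_scaleR_right
            real power2_eq_square algebra_simps)
    qed
    ultimately show ?thesis by (simp add: algebra_simps)
  qed
  from nonpos_if_le_quadratic[OF this] have "h = 0" by simp
  then have "A *v x = l *\<^sub>R x" using Ax by simp
  moreover have "hinner x x = 1" using nx by (simp add: hinner_self)
  moreover have "hinner x (v i) = 0" if "i \<in> S" for i
    using ox[OF that] hinner_commute[of x "v i"] by simp
  ultimately show ?case using v on ox 2(2)
    by (intro exI[of _ "v(k := x)"] exI[of _ "d(k := l)"]) auto
qed simp

lemma adj_mult: "adj (A ** B) = adj B ** adj A"
  by (simp add: adj_def vec_eq_iff map_matrix_def matrix_matrix_mult_def transpose_def mult.commute)

lemma adj_adj [simp]: "adj (adj A) = A"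
  by (simp add: adj_def vec_eq_iff map_matrix_def transpose_def)

lemma adj_nth: "adj A $ i $ j = cnj (A $ j $ i)"
  by (simp add: adj_def map_matrix_def transpose_def)

lemma adj_diag_real [simp]: "adj (diag_real d) = diag_real d"
  by (simp add: vec_eq_iff adj_nth diag_real_def)

lemma unitary_adj: "unitary U \<Longrightarrow> unitary (adj U)"
  by (simp add: unitary_def)

lemma unitary_mult: "unitary U \<Longrightarrow> unitary V \<Longrightarrow> unitary (U ** V)"
  unfolding unitary_def adj_mult by (metis matrix_mul_assoc matrix_mul_rid)

theorem hermitian_diagonalization:
  fixes A :: "complex ^ 'm::finite ^ 'm"
  assumes "hermitian A"
  obtains U d where "unitary U" "A = U ** diag_real d ** adj U"
proof -
  obtain v d where "\<forall>i\<in>(UNIV :: 'm set). A *v v i = d i *\<^sub>R v i"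
    and "\<forall>i\<in>(UNIV :: 'm set). \<forall>j\<in>UNIV. hinner (v i) (v j) = (if i = j then 1 else 0)"
    using hermitian_orthonormal_eigenvectors[OF assms, of UNIV] by blast
  then have v: "A *v v i = d i *\<^sub>R v i"
    and on: "hinner (v i) (v j) = (if i = j then 1 else 0)" for i j
    by simp_all
  define U :: "complex ^ 'm ^ 'm" where "U = (\<chi> a i. v i $ a)"
  have 1: "adj U ** U = mat 1"
    using on by (simp add: vec_eq_iff matrix_matrix_mult_def adj_nth U_def hinner_def mat_def)
  then have 2: "U ** adj U = mat 1" by (simp add: matrix_left_right_inverse)
  have "(A ** U) $ a $ i = (U ** diag_real d) $ a $ i" for a i
  proof -
    have "(A ** U) $ a $ i = (A *v v i) $ a"
      by (simp add: matrix_matrix_mult_def matrix_vector_mult_def U_def)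
    then show ?thesis by (simp add: v diag_real_mult_right U_def scaleR_conv_of_real[where 'a=complex] mult.commute)
  qed
  then have "A ** U = U ** diag_real d" by (simp add: vec_eq_iff)
  then have "A = U ** diag_real d ** adj U"
    by (metis 2 matrix_mul_assoc matrix_mul_rid)
  then show ?thesis using that 1 2 by (auto simp: unitary_def)
qed

section \<open>Trace norm and the topology of the state space\<close>

lemma trace_unitary_conj:
  assumes "unitary U"
  shows "trace (U ** A ** adj U) = trace A"
proof -
  have "trace (U ** A ** adj U) = trace (adj U ** (U ** A))" by (rule trace_mul_sym)
  then show ?thesis using assms by (simp add: matrix_mul_assoc unitary_def)
qed

lemma trace_diag_real: "trace (diag_real d) = of_real (\<Sum>i\<in>UNIV. d i)"
  by (simp add: trace_def diag_real_def)

lemma trace_diag_real_mult: "trace (diag_real d ** A) = (\<Sum>i\<in>UNIV. of_real (d i) * A $ i $ i)"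
  by (simp add: trace_def diag_real_mult_left)

lemma diag_real_mult: "diag_real d ** diag_real e = diag_real (\<lambda>i. d i * e i)"
  by (simp add: vec_eq_iff diag_real_mult_left) (simp add: diag_real_def)

lemma unitary_conj_mult:
  assumes "unitary U"
  shows "(U ** A ** adj U) ** (U ** B ** adj U) = U ** (A ** B) ** adj U"
proof -
  have "(U ** A ** adj U) ** (U ** B ** adj U) = U ** A ** (adj U ** U) ** B ** adj U"
    by (simp add: matrix_mul_assoc)
  also have "\<dots> = U ** (A ** B) ** adj U"
    using assms by (simp only: unitary_def matrix_mul_rid matrix_mul_assoc)
  finally show ?thesis .
qed

lemma adj_unitary_conj: "adj (U ** A ** adj U) = U ** adj A ** adj U"
  by (simp add: adj_mult matrix_mul_assoc)

lemma norm_matrix_square: "(norm A)\<^sup>2 = Re (trace (adj A ** A))" for A :: "complex ^ 'm ^ 'm"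
proof -
  have "Re (trace (adj A ** A)) = (\<Sum>i\<in>UNIV. \<Sum>k\<in>UNIV. (cmod (A $ k $ i))\<^sup>2)"
    by (simp add: trace_def matrix_matrix_mult_def adj_nth mult.commute[of "cnj _"]
        complex_mult_cnj cmod_power2)
  also have "\<dots> = (\<Sum>k\<in>UNIV. \<Sum>i\<in>UNIV. (cmod (A $ k $ i))\<^sup>2)" by (rule sum.swap)
  also have "\<dots> = (norm A)\<^sup>2"
    by (simp add: norm_vec_def L2_set_def sum_nonneg)
  finally show ?thesis by simp
qed

lemma norm_unitary_conj:
  assumes "unitary U"
  shows "norm (U ** A ** adj U) = norm A"
proof -
  have "(norm (U ** A ** adj U))\<^sup>2 = (norm A)\<^sup>2"
    using assms by (simp add: norm_matrix_square adj_unitary_conj unitary_conj_mult trace_unitary_conj)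
  then show ?thesis by simp
qed

lemma norm_diag_real: "norm (diag_real d) = L2_set d UNIV"
proof -
  have "(norm (diag_real d))\<^sup>2 = (\<Sum>i\<in>UNIV. (d i)\<^sup>2)"
    by (simp add: norm_matrix_square diag_real_mult trace_diag_real) (simp add: power2_eq_square)
  then show ?thesis unfolding L2_set_def by (intro real_sqrt_unique[symmetric]) simp_all
qed

lemma hermitian_unitary_diag: "hermitian (U ** diag_real d ** adj U)"
  by (simp add: hermitian_def adj_unitary_conj)

lemma trace_norm_unitary_diag:
  assumes "unitary U"
  shows "trace_norm (U ** diag_real d ** adj U) = (\<Sum>i\<in>UNIV. \<bar>d i\<bar>)"
proof -
  have "trace_norm (U ** diag_real d ** adj U) =
      Re (trace (herm_fun sqrt (U ** diag_real (\<lambda>i. d i * d i) ** adj U)))"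
    by (simp add: trace_norm_def adj_unitary_conj unitary_conj_mult[OF assms] diag_real_mult)
  then show ?thesis
    by (simp add: herm_fun_eqI[OF assms] trace_unitary_conj[OF assms] trace_diag_real)
qed

lemma unitary_entry_le_1:
  assumes "unitary U"
  shows "cmod (U $ i $ j) \<le> 1"
proof -
  have "(\<Sum>k\<in>UNIV. (cmod (U $ k $ j))\<^sup>2) = Re ((adj U ** U) $ j $ j)"
    by (simp add: matrix_matrix_mult_def adj_nth mult.commute[of "cnj _"] complex_mult_cnj cmod_power2)
  also have "\<dots> = 1" using assms by (simp add: unitary_def mat_def)
  finally have "(cmod (U $ i $ j))\<^sup>2 \<le> 1"
    by (metis member_le_sum[of i UNIV "\<lambda>k. (cmod (U $ k $ j))\<^sup>2"] UNIV_I finite zero_le_power2)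
  then show ?thesis by (simp add: power_le_one_iff abs_le_square_iff[of _ 1, simplified])
qed

text \<open>In an eigenbasis of A the trace only sees the diagonal entries of a unitary matrix,
  which have modulus at most 1. Together with \<open>trace_norm_attained\<close> this exhibits the
  trace norm as a maximum of functionals linear in A, and the triangle inequality follows.\<close>

lemma trace_norm_ge:
  assumes "hermitian A" "unitary X"
  shows "Re (trace (A ** X)) \<le> trace_norm A"
proof -
  obtain U d where U: "unitary U" and A: "A = U ** diag_real d ** adj U"
    using hermitian_diagonalization[OF assms(1)] .
  define Y where "Y = adj U ** X ** U"
  have Y: "unitary Y" unfolding Y_def by (intro unitary_mult unitary_adj U assms(2))
  have "trace (A ** X) = trace (U ** (diag_real d ** adj U ** X))"
    by (simp add: A matrix_mul_assoc)
  also have "\<dots> = trace ((diag_real d ** adj U ** X) ** U)" by (rule trace_mul_sym)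
  also have "\<dots> = trace (diag_real d ** Y)" by (simp add: Y_def matrix_mul_assoc)
  finally have "Re (trace (A ** X)) = (\<Sum>i\<in>UNIV. d i * Re (Y $ i $ i))"
    by (simp add: trace_diag_real_mult)
  also have "\<dots> \<le> (\<Sum>i\<in>UNIV. \<bar>d i\<bar>)"
  proof (intro sum_mono)
    fix i
    have "\<bar>Re (Y $ i $ i)\<bar> \<le> 1" using abs_Re_le_cmod unitary_entry_le_1[OF Y] order.trans by blast
    then have "\<bar>d i\<bar> * \<bar>Re (Y $ i $ i)\<bar> \<le> \<bar>d i\<bar> * 1" by (intro mult_left_mono) auto
    then show "d i * Re (Y $ i $ i) \<le> \<bar>d i\<bar>" by (simp add: abs_mult[symmetric])
  qed
  finally show ?thesis by (simp add: A trace_norm_unitary_diag[OF U])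
qed

lemma trace_norm_attained:
  assumes "hermitian A"
  obtains X where "unitary X" "trace_norm A = Re (trace (A ** X))"
proof -
  obtain U d where U: "unitary U" and A: "A = U ** diag_real d ** adj U"
    using hermitian_diagonalization[OF assms] .
  \<comment> \<open>X is the sign of A. Zero eigenvalues get the sign 1, since X has to be
    unitary.\<close>
  define s where "s i = (if d i < 0 then - 1 else 1 :: real)" for i
  define X where "X = U ** diag_real s ** adj U"
  have "diag_real (\<lambda>i. s i * s i) = mat 1"
    by (simp add: vec_eq_iff s_def diag_real_def mat_def)
  then have "unitary X" using U
    by (simp add: X_def unitary_def adj_unitary_conj unitary_conj_mult diag_real_mult)
  moreover have "trace (A ** X) = of_real (\<Sum>i\<in>UNIV. d i * s i)"
    by (simp only: A X_def unitary_conj_mult[OF U] trace_unitary_conj[OF U] diag_real_mult trace_diag_real)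
  then have "Re (trace (A ** X)) = trace_norm A"
    by (simp add: A trace_norm_unitary_diag[OF U]) (auto simp: s_def intro!: sum.cong)
  ultimately show ?thesis using that by simp
qed

lemma hermitian_add: "hermitian A \<Longrightarrow> hermitian B \<Longrightarrow> hermitian (A + B)"
  by (simp add: hermitian_def vec_eq_iff adj_nth)

lemma hermitian_diff: "hermitian A \<Longrightarrow> hermitian B \<Longrightarrow> hermitian (A - B)"
  by (simp add: hermitian_def vec_eq_iff adj_nth)

lemma trace_norm_triangle:
  assumes "hermitian A" "hermitian B"
  shows "trace_norm (A + B) \<le> trace_norm A + trace_norm B"
proof -
  obtain X where X: "unitary X" "trace_norm (A + B) = Re (trace ((A + B) ** X))"
    using trace_norm_attained[OF hermitian_add[OF assms]] .
  have "(A + B) ** X = A ** X + B ** X" by (simp add: vec_eq_iff matrix_matrix_mult_def algebra_simps sum.distrib)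
  then show ?thesis using X trace_norm_ge[OF assms(1) X(1)] trace_norm_ge[OF assms(2) X(1)]
    by (simp add: trace_add)
qed

lemma hinner_columns:
  "hinner (\<chi> a. U $ a $ i) (A *v (\<chi> a. U $ a $ j)) = (adj U ** A ** U) $ i $ j"
  by (simp add: hinner_def matrix_mul_assoc[symmetric])
     (simp add: matrix_matrix_mult_def matrix_vector_mult_def adj_nth)

lemma unitary_diag_eigenvalue:
  assumes "unitary U" "A = U ** diag_real d ** adj U"
  shows "of_real (d i) = hinner (\<chi> a. U $ a $ i) (A *v (\<chi> a. U $ a $ i))"
proof -
  have "adj U ** A ** U = (adj U ** U) ** diag_real d ** (adj U ** U)"
    by (simp add: assms(2) matrix_mul_assoc)
  then have "adj U ** A ** U = diag_real d" using assms(1) by (simp add: unitary_def)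
  then show ?thesis by (simp add: hinner_columns diag_real_def)
qed

lemma trace_norm_nonneg: "0 \<le> trace_norm A"
proof -
  have "hermitian (adj A ** A)" by (simp add: hermitian_def adj_mult)
  then obtain U d where U: "unitary U" and A: "adj A ** A = U ** diag_real d ** adj U"
    by (rule hermitian_diagonalization)
  have "0 \<le> d i" for i
  proof -
    define u where "u = (\<chi> a. U $ a $ i)"
    have "of_real (d i) = hinner u ((adj A ** A) *v u)"
      unfolding u_def by (rule unitary_diag_eigenvalue[OF U A])
    also have "\<dots> = of_real ((norm (A *v u))\<^sup>2)"
      by (simp add: matrix_vector_mul_assoc[symmetric] hinner_adj[of _ "adj A"] hinner_self)
    finally show ?thesis by (simp only: of_real_eq_iff) simp
  qed
  then show ?thesis
    by (simp add: trace_norm_def A herm_fun_eqI[OF U] trace_unitary_conj[OF U] trace_diag_real sum_nonneg)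
qed

lemma trace_norm_minus: "trace_norm (- A) = trace_norm A"
proof -
  have "adj (- A) ** (- A) = adj A ** A"
    by (simp add: vec_eq_iff matrix_matrix_mult_def adj_nth)
  then show ?thesis by (simp add: trace_norm_def)
qed

text \<open>Through the eigenvalues this is the comparison of the l2 norm with the l1 norm; the
  lemma after it gives the converse with factor m. Trace distance and Euclidean distance are thus
  equivalent on states.\<close>

lemma norm_le_trace_norm:
  assumes "hermitian A"
  shows "norm A \<le> trace_norm A"
proof -
  obtain U d where U: "unitary U" and A: "A = U ** diag_real d ** adj U"
    using hermitian_diagonalization[OF assms] .
  show ?thesis
    unfolding A norm_unitary_conj[OF U] trace_norm_unitary_diag[OF U] norm_diag_real
    by (rule L2_set_le_sum_abs)
qed

lemma trace_norm_le_norm: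
  fixes A :: "complex ^ 'm ^ 'm"
  assumes "hermitian A"
  shows "trace_norm A \<le> CARD('m) * norm A"
proof -
  obtain U d where U: "unitary U" and A: "A = U ** diag_real d ** adj U"
    using hermitian_diagonalization[OF assms] .
  have "\<bar>d i\<bar> \<le> norm A" for i
    using member_le_L2_set[of UNIV i "\<lambda>i. \<bar>d i\<bar>"]
    by (simp add: A norm_unitary_conj[OF U] norm_diag_real L2_set_def)
  then have "(\<Sum>i\<in>UNIV. \<bar>d i\<bar>) \<le> (\<Sum>i\<in>(UNIV :: 'm set). norm A)" by (intro sum_mono)
  then show ?thesis by (simp add: A trace_norm_unitary_diag[OF U])
qed

section \<open>The trace distance as a metric and its Euclidean topology\<close>

lemma density_ops_hermitian: "\<rho> \<in> density_ops \<Longrightarrow> hermitian \<rho>"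
  by (simp add: density_ops_def pos_semidef_def)

lemma Metric_space_density_ops: "Metric_space density_ops trace_dist"
proof
  fix \<rho> \<sigma> \<tau> :: "complex ^ 'm ^ 'm"
  assume \<rho>: "\<rho> \<in> density_ops" and \<sigma>: "\<sigma> \<in> density_ops"
  note h = hermitian_diff[OF density_ops_hermitian density_ops_hermitian]
  show "trace_dist \<rho> \<sigma> = 0 \<longleftrightarrow> \<rho> = \<sigma>"
  proof
    assume "trace_dist \<rho> \<sigma> = 0"
    then show "\<rho> = \<sigma>" using norm_le_trace_norm[OF h[OF \<rho> \<sigma>]] by (simp add: trace_dist_def)
  next
    assume "\<rho> = \<sigma>"
    then show "trace_dist \<rho> \<sigma> = 0"
      using trace_norm_le_norm[OF h[OF \<rho> \<sigma>]] norm_le_trace_norm[OF h[OF \<rho> \<sigma>]]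
      by (simp add: trace_dist_def)
  qed
  assume \<tau>: "\<tau> \<in> density_ops"
  show "trace_dist \<rho> \<tau> \<le> trace_dist \<rho> \<sigma> + trace_dist \<sigma> \<tau>"
    using trace_norm_triangle[OF h[OF \<rho> \<sigma>] h[OF \<sigma> \<tau>]] by (simp add: trace_dist_def)
next
  fix \<rho> \<sigma> :: "complex ^ 'm ^ 'm"
  show "trace_dist \<rho> \<sigma> = trace_dist \<sigma> \<rho>"
    using trace_norm_minus[of "\<rho> - \<sigma>"] by (simp add: trace_dist_def)
  show "0 \<le> trace_dist \<rho> \<sigma>" by (simp add: trace_dist_def trace_norm_nonneg)
qed

text \<open>By the equivalence of the two norms, closure and interior in the state space become
  notions of the Euclidean subspace topology, where compactness is available.\<close>

lemma state_topology_eq: "state_topology = top_of_set (density_ops :: (complex ^ 'm ^ 'm) set)"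
proof -
  interpret Metric_space density_ops "trace_dist :: complex ^ 'm ^ 'm \<Rightarrow> _"
    by (rule Metric_space_density_ops)
  have le: "norm (\<rho> - \<sigma>) \<le> 2 * trace_dist \<rho> \<sigma>" "2 * trace_dist \<rho> \<sigma> \<le> CARD('m) * norm (\<rho> - \<sigma>)"
    if "\<rho> \<in> density_ops" "\<sigma> \<in> density_ops" for \<rho> \<sigma> :: "complex ^ 'm ^ 'm"
    using norm_le_trace_norm[of "\<rho> - \<sigma>"] trace_norm_le_norm[of "\<rho> - \<sigma>"] that
    by (simp_all add: trace_dist_def hermitian_diff density_ops_hermitian)
  show ?thesis
  proof (rule topology_eq[THEN iffD2], intro allI)
    fix S :: "(complex ^ 'm ^ 'm) set"
    have "(\<exists>r>0. mball x r \<subseteq> S) \<longleftrightarrow> (\<exists>e>0. \<forall>x'\<in>density_ops. dist x' x < e \<longrightarrow> x' \<in> S)"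
      if x: "x \<in> density_ops" for x
    proof
      assume "\<exists>r>0. mball x r \<subseteq> S"
      then obtain r where r: "r > 0" "mball x r \<subseteq> S" by blast
      have "y \<in> S" if "y \<in> density_ops" "dist y x < r / CARD('m)" for y
      proof -
        have "CARD('m) * norm (x - y) < r" using that(2)
          by (simp add: dist_norm norm_minus_commute pos_less_divide_eq mult.commute)
        then have "2 * trace_dist x y < r" using le(2)[OF x that(1)] by simp
        then have "trace_dist x y < r" using nonneg[of x y] by linarith
        then show ?thesis using r x that by auto
      qed
      then show "\<exists>e>0. \<forall>x'\<in>density_ops. dist x' x < e \<longrightarrow> x' \<in> S"
        using r(1) by (intro exI[of _ "r / CARD('m)"]) auto
    next
      assume "\<exists>e>0. \<forall>x'\<in>density_ops. dist x' x < e \<longrightarrow> x' \<in> S"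
      then obtain e where e: "e > 0" "\<forall>x'\<in>density_ops. dist x' x < e \<longrightarrow> x' \<in> S" by blast
      have "mball x (e / 2) \<subseteq> S"
      proof
        fix y assume y: "y \<in> mball x (e / 2)"
        then have "dist y x < e" using le(1)[OF x, of y]
          by (auto simp: dist_norm norm_minus_commute)
        then show "y \<in> S" using e y by auto
      qed
      then show "\<exists>r>0. mball x r \<subseteq> S" using e(1) by (intro exI[of _ "e / 2"]) auto
    qed
    then show "openin mtopology S \<longleftrightarrow> openin (top_of_set density_ops) S"
      unfolding openin_mtopology openin_euclidean_subtopology_iff by blast
  qed
qed

section \<open>Density operators and their determinants\<close>

lemma pos_semidef_iff: "pos_semidef A \<longleftrightarrow> hermitian A \<and> (\<forall>v. 0 \<le> Re (hinner v (A *v v)))"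
  by (simp add: pos_semidef_def hinner_def)

lemma density_ops_diagonalization:
  fixes \<rho> :: "complex ^ 'm ^ 'm"
  assumes "\<rho> \<in> density_ops"
  obtains U d where "unitary U" "\<rho> = U ** diag_real d ** adj U" "\<forall>i. 0 \<le> d i" "(\<Sum>i\<in>UNIV. d i) = 1"
proof -
  obtain U d where U: "unitary U" and \<rho>: "\<rho> = U ** diag_real d ** adj U"
    using hermitian_diagonalization[OF density_ops_hermitian[OF assms]] .
  have "d i = Re (hinner (\<chi> a. U $ a $ i) (\<rho> *v (\<chi> a. U $ a $ i)))" for i
    using unitary_diag_eigenvalue[OF U \<rho>, of i] by (metis Re_complex_of_real)
  then have "0 \<le> d i" for i using assms by (simp add: density_ops_def pos_semidef_iff)
  moreover have "complex_of_real (\<Sum>i\<in>UNIV. d i) = 1"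
    using assms unfolding density_ops_def \<rho> by (simp only: trace_unitary_conj[OF U] trace_diag_real mem_Collect_eq)
  then have "(\<Sum>i\<in>UNIV. d i) = 1" using of_real_eq_1_iff by blast
  ultimately show ?thesis using that U \<rho> by blast
qed

lemma unitary_diag_in_density_ops:
  assumes U: "unitary U" and d: "\<And>i. 0 \<le> d i" "(\<Sum>i\<in>UNIV. d i) = 1"
  shows "U ** diag_real d ** adj U \<in> density_ops"
proof -
  have "0 \<le> Re (hinner v ((U ** diag_real d ** adj U) *v v))" for v
  proof -
    define w where "w = adj U *v v"
    have "(diag_real d *v w) $ i = of_real (d i) * w $ i" for i
      using diag_real_mult_left[of d "\<chi> a b. w $ a" i i]
      by (simp add: matrix_matrix_mult_def matrix_vector_mult_def)
    moreover have eq: "hinner v ((U ** diag_real d ** adj U) *v v) = hinner w (diag_real d *v w)"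
      by (simp add: w_def hinner_adj[of v U] matrix_vector_mul_assoc[symmetric])
    ultimately have "Re (hinner v ((U ** diag_real d ** adj U) *v v)) = (\<Sum>i\<in>UNIV. d i * (cmod (w $ i))\<^sup>2)"
      unfolding eq by (simp add: hinner_def cmod_power2) (simp add: algebra_simps power2_eq_square)
    then show ?thesis using d by (simp add: sum_nonneg)
  qed
  then show ?thesis using d(2)
    by (simp add: density_ops_def pos_semidef_iff hermitian_unitary_diag trace_unitary_conj[OF U] trace_diag_real)
qed

lemma norm_density_le_1:
  assumes "\<rho> \<in> density_ops"
  shows "norm \<rho> \<le> 1"
proof -
  obtain U d where U: "unitary U" and \<rho>: "\<rho> = U ** diag_real d ** adj U"
    and d: "\<forall>i. 0 \<le> d i" "(\<Sum>i\<in>UNIV. d i) = 1"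
    using density_ops_diagonalization[OF assms] .
  then have "trace_norm \<rho> = 1" by (simp add: trace_norm_unitary_diag)
  then show ?thesis using norm_le_trace_norm[OF density_ops_hermitian[OF assms]] by simp
qed

lemma compact_density_ops: "compact (density_ops :: (complex ^ 'm ^ 'm) set)"
proof -
  have "density_ops = (\<Inter>i. \<Inter>j. {\<rho> :: complex ^ 'm ^ 'm. cnj (\<rho> $ j $ i) = \<rho> $ i $ j}) \<inter>
      (\<Inter>v. {\<rho>. 0 \<le> Re (hinner v (\<rho> *v v))}) \<inter> {\<rho>. trace \<rho> = 1}"
    by (auto simp: density_ops_def pos_semidef_iff hermitian_def vec_eq_iff adj_nth)
  moreover have "closed \<dots>"
    unfolding trace_def hinner_def matrix_vector_mult_def vec_lambda_beta
    by (intro closed_Int closed_INT ballI closed_Collect_eq closed_Collect_le continuous_intros)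
  ultimately have "closed (density_ops :: (complex ^ 'm ^ 'm) set)" by simp
  moreover have "bounded (density_ops :: (complex ^ 'm ^ 'm) set)"
    using norm_density_le_1 bounded_iff by blast
  ultimately show ?thesis by (simp add: compact_eq_bounded_closed)
qed

section \<open>Determinant and relative entropy\<close>

lemma det_unitary_diag:
  assumes "unitary U"
  shows "det (U ** diag_real d ** adj U) = of_real (\<Prod>i\<in>UNIV. d i)"
proof -
  have "det U * det (adj U) = 1"
    using assms by (simp add: det_mul[symmetric] unitary_def)
  moreover have "det (diag_real d) = of_real (\<Prod>i\<in>UNIV. d i)"
    by (subst det_diagonal) (simp_all add: diag_real_def)
  ultimately show ?thesis by (simp add: det_mul)
qed

lemma continuous_on_det: "continuous_on S (\<lambda>A :: complex ^ 'm ^ 'm. Re (det A))"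
  unfolding det_def by (intro continuous_intros)

lemma Re_det_density_nonneg:
  assumes "\<rho> \<in> density_ops"
  shows "0 \<le> Re (det \<rho>)"
proof -
  obtain U d where "unitary U" "\<rho> = U ** diag_real d ** adj U" "\<forall>i. 0 \<le> d i"
    by (rule density_ops_diagonalization[OF assms])
  then show ?thesis by (simp add: det_unitary_diag prod_nonneg del: of_real_prod)
qed

text \<open>Scalar matrices commute with U. The form shown makes \<pi> diagonal in the eigenbasis of
  any other state.\<close>

lemma max_mixed_eq: "max_mixed = U ** diag_real (\<lambda>_. 1 / CARD('m)) ** adj U"
  if "unitary U" for U :: "complex ^ 'm ^ 'm"
proof -
  have "U ** diag_real (\<lambda>_. 1 / CARD('m)) = diag_real (\<lambda>_. 1 / CARD('m)) ** U"
    by (simp add: vec_eq_iff diag_real_mult_left diag_real_mult_right)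
  then have "U ** diag_real (\<lambda>_. 1 / CARD('m)) ** adj U = diag_real (\<lambda>_. 1 / CARD('m)) ** (U ** adj U)"
    by (simp add: matrix_mul_assoc)
  also have "\<dots> = diag_real (\<lambda>_. 1 / CARD('m))" using that by (simp add: unitary_def)
  also have "\<dots> = max_mixed" by (simp add: max_mixed_def diag_real_def mat_def vec_eq_iff)
  finally show ?thesis by simp
qed

text \<open>This is the inequality of arithmetic and geometric means for the eigenvalues, with its
  equality case. It comes from 1 + x \<le> exp x for x = m d - 1, as these numbers sum to 0.\<close>

lemma Re_det_density_less:
  fixes \<rho> :: "complex ^ 'm ^ 'm"
  assumes "\<rho> \<in> density_ops" "\<rho> \<noteq> max_mixed"
  shows "Re (det \<rho>) < (1 / CARD('m)) ^ CARD('m)"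
proof -
  let ?m = "real CARD('m)"
  obtain U d where U: "unitary U" and \<rho>: "\<rho> = U ** diag_real d ** adj U"
    and d: "\<forall>i. 0 \<le> d i" "(\<Sum>i\<in>UNIV. d i) = 1"
    using density_ops_diagonalization[OF assms(1)] .
  define x where "x i = ?m * d i - 1" for i
  have sx: "(\<Sum>i\<in>UNIV. x i) = 0"
    by (simp add: x_def sum_subtractf sum_distrib_left[symmetric] d(2))
  obtain k where k: "x k \<noteq> 0"
  proof -
    have "\<exists>k. d k \<noteq> 1 / ?m"
      using assms(2) max_mixed_eq[OF U] \<rho> by (metis ext)
    then show ?thesis using that by (auto simp: x_def field_simps)
  qed
  have "?m ^ CARD('m) * Re (det \<rho>) = (\<Prod>i\<in>UNIV. 1 + x i)"
    by (simp add: \<rho> det_unitary_diag[OF U] x_def prod.distrib del: of_real_prod)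
  also have "\<dots> < (\<Prod>i\<in>UNIV. exp (x i))"
  proof (cases "\<exists>i. 1 + x i = 0")
    \<comment> \<open>A vanishing factor is treated apart, because the equality case
      \<open>ln_eq_minus_one\<close> needs positive arguments.\<close>
    case True
    then have "(\<Prod>i\<in>UNIV. 1 + x i) = 0" by (meson UNIV_I finite prod_zero)
    moreover have "0 < (\<Prod>i\<in>UNIV. exp (x i))" by (intro prod_pos) simp
    ultimately show ?thesis by linarith
  next
    case False
    then have pos: "0 < 1 + x i" for i using d(1)[rule_format, of i] by (simp add: x_def less_le)
    have "1 + x k \<noteq> exp (x k)"
    proof
      assume "1 + x k = exp (x k)"
      then have "ln (1 + x k) = (1 + x k) - 1" by (simp only: ln_exp)
      then have "1 + x k = 1" using ln_eq_minus_one pos by blast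
      then show False using k by simp
    qed
    then have "1 + x k < exp (x k)" by (simp add: less_le)
    then show ?thesis
      using pos by (intro prod_mono_strict[of k]) (simp_all add: less_imp_le)
  qed
  also have "\<dots> = 1" using exp_sum[of UNIV x] sx by simp
  finally have "Re (det \<rho>) < 1 / ?m ^ CARD('m)" by (simp add: pos_less_divide_eq mult.commute)
  then show ?thesis by (simp add: power_one_over)
qed

text \<open>As \<pi> has trivial kernel, the support condition in \<open>rel_entropy\<close> says
  that \<rho> is injective, that is, has nonzero determinant. In that case both logarithms are
  diagonal in one eigenbasis.\<close>

lemma rel_entropy_max_mixed:
  fixes \<rho> :: "complex ^ 'm ^ 'm"
  assumes "\<rho> \<in> density_ops"
  shows "rel_entropy max_mixed \<rho> =
    (if Re (det \<rho>) = 0 then \<infinity> else ereal (- ln CARD('m) - ln (Re (det \<rho>)) / CARD('m)))"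
proof -
  let ?m = "real CARD('m)"
  obtain U d where U: "unitary U" and \<rho>: "\<rho> = U ** diag_real d ** adj U"
    and d: "\<forall>i. 0 \<le> d i" "(\<Sum>i\<in>UNIV. d i) = 1"
    using density_ops_diagonalization[OF assms(1)] .
  have det: "det \<rho> = of_real (\<Prod>i\<in>UNIV. d i)" by (simp add: \<rho> det_unitary_diag[OF U])
  have "(\<forall>v. \<rho> *v v = 0 \<longrightarrow> max_mixed *v v = 0) \<longleftrightarrow> (\<forall>v. \<rho> *v v = 0 \<longrightarrow> v = 0)"
  proof -
    have "max_mixed *v v = (1 / of_nat CARD('m)) *s v" for v :: "complex ^ 'm"
      by (simp add: max_mixed_def mat_def matrix_vector_mult_def vec_eq_iff if_distrib if_distribR sum.delta cong: if_cong)
    then show ?thesis by (simp add: vector_mul_eq_0)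
  qed
  also have "\<dots> \<longleftrightarrow> Re (det \<rho>) \<noteq> 0"
    unfolding invertible_left_inverse[symmetric] matrix_left_invertible_ker[symmetric] invertible_det_nz
    by (simp add: det del: of_real_prod)
  finally have cond: "(\<forall>v. \<rho> *v v = 0 \<longrightarrow> max_mixed *v v = 0) \<longleftrightarrow> Re (det \<rho>) \<noteq> 0" .
  have "Re (trace (max_mixed ** herm_fun ln max_mixed - max_mixed ** herm_fun ln \<rho>)) =
      - ln ?m - ln (Re (det \<rho>)) / ?m" if nz: "Re (det \<rho>) \<noteq> 0"
  proof -
    have "(\<Prod>i\<in>UNIV. d i) \<noteq> 0" using nz by (simp add: det del: of_real_prod)
    then have pos: "d i > 0" for i using d(1)[rule_format, of i] by (auto simp: less_le)
    have "herm_fun ln max_mixed = U ** diag_real (ln \<circ> (\<lambda>_. 1 / ?m)) ** adj U"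
      unfolding max_mixed_eq[OF U] by (rule herm_fun_eqI[OF U])
    moreover have "herm_fun ln \<rho> = U ** diag_real (ln \<circ> d) ** adj U"
      unfolding \<rho> by (rule herm_fun_eqI[OF U])
    ultimately have "trace (max_mixed ** herm_fun ln max_mixed - max_mixed ** herm_fun ln \<rho>) =
        of_real ((\<Sum>i\<in>(UNIV :: 'm set). 1 / ?m * ln (1 / ?m)) - (\<Sum>i\<in>UNIV. 1 / ?m * ln (d i)))"
      unfolding max_mixed_eq[OF U] trace_sub
      by (simp only: unitary_conj_mult[OF U] trace_unitary_conj[OF U] diag_real_mult trace_diag_real
          of_real_diff comp_def)
    moreover have "(\<Sum>i\<in>(UNIV :: 'm set). 1 / ?m * ln (1 / ?m)) = - ln ?m"
      by (simp add: ln_div)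
    moreover have "(\<Sum>i\<in>UNIV. 1 / ?m * ln (d i)) = ln (Re (det \<rho>)) / ?m"
    proof -
      have "Re (det \<rho>) = (\<Prod>i\<in>UNIV. d i)" by (simp add: det del: of_real_prod)
      moreover have "ln (\<Prod>i\<in>UNIV. d i) = (\<Sum>i\<in>UNIV. ln (d i))"
        by (intro ln_prod) (simp_all add: less_imp_neq[OF pos, symmetric])
      ultimately show ?thesis by (simp only: sum_distrib_left[symmetric]) simp
    qed
    ultimately show ?thesis by (simp only: Re_complex_of_real)
  qed
  then show ?thesis unfolding rel_entropy_def cond by simp
qed

lemma rel_entropy_max_mixed_antimono:
  fixes \<rho> \<sigma> :: "complex ^ 'm ^ 'm"
  assumes "\<rho> \<in> density_ops" "\<sigma> \<in> density_ops" "Re (det \<rho>) \<le> Re (det \<sigma>)"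
  shows "rel_entropy max_mixed \<sigma> \<le> rel_entropy max_mixed \<rho>"
proof (cases "Re (det \<rho>) = 0")
  case False
  then have "0 < Re (det \<rho>)" using Re_det_density_nonneg[OF assms(1)] by simp
  then have "ln (Re (det \<rho>)) / CARD('m) \<le> ln (Re (det \<sigma>)) / CARD('m)"
    using assms(3) by (intro divide_right_mono) (simp_all add: ln_mono)
  moreover have "Re (det \<rho>) \<noteq> 0" "Re (det \<sigma>) \<noteq> 0"
    using \<open>0 < Re (det \<rho>)\<close> assms(3) by simp_all
  ultimately show ?thesis
    by (simp add: rel_entropy_max_mixed[OF assms(1)] rel_entropy_max_mixed[OF assms(2)])
qed (simp add: rel_entropy_max_mixed[OF assms(1)])

section \<open>Lebesgue measure on a finite power of the complex plane\<close>

text \<open>For \<open>I = bip_index n\<close> this measure has the \<sigma>-algebra of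
  \<open>bip_borel n\<close>, so points of the sphere and of Lebesgue space are functions of the
  same kind and can be subtracted.\<close>

definition cleb :: "'i set \<Rightarrow> ('i \<Rightarrow> complex) measure" where
  "cleb I = (\<Pi>\<^sub>M i\<in>I. lborel)"

text \<open>Only values on I enter, so differences formed pointwise need not be extensional.\<close>

definition cnorm :: "'i set \<Rightarrow> ('i \<Rightarrow> complex) \<Rightarrow> real" where
  "cnorm I y = L2_set (\<lambda>k. cmod (y k)) I"

definition oball :: "'i set \<Rightarrow> real \<Rightarrow> ('i \<Rightarrow> complex) set" where
  "oball I t = {y \<in> space (cleb I). cnorm I y < t}"

lemma space_cleb: "space (cleb I) = extensional I"
  by (simp add: cleb_def space_PiM PiE_def)

lemma sets_cleb: "sets (cleb I) = sets (\<Pi>\<^sub>M i\<in>I. borel)"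
  unfolding cleb_def by (intro sets_PiM_cong) auto

lemma measurable_component_cleb: "k \<in> I \<Longrightarrow> (\<lambda>y. y k) \<in> borel_measurable (cleb I)"
  using measurable_component_singleton[of k I "\<lambda>_. lborel :: complex measure"] by (simp add: cleb_def)

lemma measurable_cnorm [measurable]: "cnorm I \<in> borel_measurable (cleb I)"
  unfolding cnorm_def L2_set_def cleb_def by measurable

lemma sets_oball [measurable]: "oball I t \<in> sets (cleb I)"
  unfolding oball_def by measurable

lemma cnorm_nonneg [simp]: "0 \<le> cnorm I y"
  by (simp add: cnorm_def)

lemma cnorm_power2: "(cnorm I y)\<^sup>2 = (\<Sum>k\<in>I. (cmod (y k))\<^sup>2)"
  by (simp add: cnorm_def L2_set_def sum_nonneg)

lemma cnorm_triangle: "cnorm I (\<lambda>k. x k + y k) \<le> cnorm I x + cnorm I y"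
proof -
  have "cnorm I (\<lambda>k. x k + y k) \<le> L2_set (\<lambda>k. cmod (x k) + cmod (y k)) I"
    unfolding cnorm_def by (intro L2_set_mono) (auto intro: norm_triangle_ineq)
  also have "\<dots> \<le> cnorm I x + cnorm I y" unfolding cnorm_def by (rule L2_set_triangle_ineq)
  finally show ?thesis .
qed

lemma cnorm_minus_commute: "cnorm I (\<lambda>k. x k - y k) = cnorm I (\<lambda>k. y k - x k)"
  by (simp add: cnorm_def norm_minus_commute)

lemma cnorm_diff_le: "\<bar>cnorm I x - cnorm I y\<bar> \<le> cnorm I (\<lambda>k. x k - y k)"
  using cnorm_triangle[of I "\<lambda>k. x k - y k" y] cnorm_triangle[of I "\<lambda>k. y k - x k" x]
  by (simp add: cnorm_minus_commute[of I y x])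

lemma cnorm_cong: "(\<And>k. k \<in> I \<Longrightarrow> x k = y k) \<Longrightarrow> cnorm I x = cnorm I y"
  unfolding cnorm_def by (intro L2_set_cong) auto

lemma cnorm_scaleR: "0 \<le> t \<Longrightarrow> cnorm I (\<lambda>k. t *\<^sub>R y k) = t * cnorm I y"
  by (simp add: cnorm_def L2_set_right_distrib)

text \<open>The factor is a square because the complex plane has real dimension 2. It stands next to
  the preimage, which avoids division in the extended nonnegative reals.\<close>

lemma emeasure_lborel_affine:
  fixes c :: complex
  assumes "t > 0" "B \<in> sets borel"
  shows "emeasure lborel ((\<lambda>z. c + t *\<^sub>R z) -` B) * ennreal (t\<^sup>2) = emeasure lborel B"
proof -
  have "emeasure lborel B = emeasure (density (distr lborel borel (\<lambda>z. c + t *\<^sub>R z)) (\<lambda>_. \<bar>t\<bar> ^ DIM(complex))) B"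
    using assms(1) lborel_affine[of t c] by simp
  also have "\<dots> = ennreal (t\<^sup>2) * emeasure (distr lborel borel (\<lambda>z. c + t *\<^sub>R z)) B"
    using assms by (subst emeasure_density_const) auto
  also have "\<dots> = emeasure lborel ((\<lambda>z. c + t *\<^sub>R z) -` B) * ennreal (t\<^sup>2)"
    using assms by (subst emeasure_distr) (auto simp: mult.commute)
  finally show ?thesis by simp
qed

text \<open>By uniqueness of product measures it suffices to look at boxes, where coordinates
  separate. Translations (t = 1), dilations (constant t) and the blockwise rescalings are all
  special cases.\<close>

lemma emeasure_cleb_affine:
  assumes I: "finite I" and t: "\<And>i. i \<in> I \<Longrightarrow> t i > 0" and A: "A \<in> sets (cleb I)"
  shows "emeasure (cleb I) {y \<in> space (cleb I). (\<lambda>i\<in>I. c i + t i *\<^sub>R y i) \<in> A} *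
    ennreal (\<Prod>i\<in>I. (t i)\<^sup>2) = emeasure (cleb I) A"
proof -
  interpret product_sigma_finite "\<lambda>_ :: 'a. lborel :: complex measure"
    by standard
  define f where "f y = (\<lambda>i\<in>I. c i + t i *\<^sub>R y i)" for y
  define P where "P = scale_measure (ennreal (\<Prod>i\<in>I. (t i)\<^sup>2)) (distr (cleb I) (cleb I) f)"
  have f: "f \<in> measurable (cleb I) (cleb I)"
    unfolding f_def cleb_def by (intro measurable_restrict) measurable
  have "P = (\<Pi>\<^sub>M i\<in>I. lborel)"
  proof (rule PiM_eqI[OF I])
    fix B :: "'a \<Rightarrow> complex set"
    assume B: "\<And>i. i \<in> I \<Longrightarrow> B i \<in> sets lborel"
    let ?B = "\<lambda>i. (\<lambda>z. c i + t i *\<^sub>R z) -` B i"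
    have B': "?B i \<in> sets lborel" if "i \<in> I" for i
      using measurable_sets[of "\<lambda>z. c i + t i *\<^sub>R z" lborel lborel "B i"] B[OF that] by auto
    have "emeasure P (Pi\<^sub>E I B) =
        ennreal (\<Prod>i\<in>I. (t i)\<^sup>2) * emeasure (cleb I) (f -` Pi\<^sub>E I B \<inter> space (cleb I))"
      unfolding P_def emeasure_scale_measure
      by (subst emeasure_distr[OF f]) (use B in \<open>auto simp: cleb_def intro!: sets_PiM_I_finite I\<close>)
    also have "f -` Pi\<^sub>E I B \<inter> space (cleb I) = Pi\<^sub>E I ?B"
      by (auto simp: f_def space_cleb PiE_def Pi_def)
    also have "emeasure (cleb I) \<dots> = (\<Prod>i\<in>I. emeasure lborel (?B i))"
      unfolding cleb_def by (intro emeasure_PiM I B')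
    also have "ennreal (\<Prod>i\<in>I. (t i)\<^sup>2) * \<dots> = (\<Prod>i\<in>I. emeasure lborel (?B i) * ennreal ((t i)\<^sup>2))"
      by (simp add: prod.distrib prod_ennreal mult.commute)
    also have "\<dots> = (\<Prod>i\<in>I. emeasure lborel (B i))"
      using B t by (intro prod.cong emeasure_lborel_affine refl) auto
    finally show "emeasure P (Pi\<^sub>E I B) = (\<Prod>i\<in>I. emeasure lborel (B i))" .
  qed (simp add: P_def cleb_def)
  then have "emeasure (cleb I) A = emeasure P A" by (simp add: cleb_def)
  also have "\<dots> = ennreal (\<Prod>i\<in>I. (t i)\<^sup>2) * emeasure (cleb I) (f -` A \<inter> space (cleb I))"
    unfolding P_def emeasure_scale_measure by (subst emeasure_distr[OF f A]) simp
  also have "f -` A \<inter> space (cleb I) = {y \<in> space (cleb I). f y \<in> A}" by auto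
  finally show ?thesis by (simp add: f_def mult.commute)
qed

lemma emeasure_translated_oball:
  assumes "finite I"
  shows "emeasure (cleb I) {y \<in> space (cleb I). cnorm I (\<lambda>k. x k - y k) < r} = emeasure (cleb I) (oball I r)"
proof -
  have "{y \<in> space (cleb I). (\<lambda>i\<in>I. - x i + 1 *\<^sub>R y i) \<in> oball I r} =
      {y \<in> space (cleb I). cnorm I (\<lambda>k. x k - y k) < r}"
    by (auto simp: oball_def space_cleb cnorm_minus_commute[of I x] cong: cnorm_cong)
  then show ?thesis
    using emeasure_cleb_affine[OF assms, of "\<lambda>_. 1" "oball I r" "\<lambda>i. - x i"] by simp
qed

lemma emeasure_oball_finite:
  assumes "finite I"
  shows "emeasure (cleb I) (oball I t) < \<infinity>"
proof -
  interpret product_sigma_finite "\<lambda>_ :: 'a. lborel :: complex measure"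
    by standard
  have "oball I t \<subseteq> Pi\<^sub>E I (\<lambda>_. cball 0 t)"
  proof
    fix y assume y: "y \<in> oball I t"
    have "cmod (y i) \<le> t" if "i \<in> I" for i
      using member_le_L2_set[OF assms that, of "\<lambda>k. cmod (y k)"] y
      by (simp add: oball_def cnorm_def)
    then show "y \<in> Pi\<^sub>E I (\<lambda>_. cball 0 t)"
      using y by (simp add: oball_def space_cleb PiE_def Pi_def)
  qed
  then have "emeasure (cleb I) (oball I t) \<le> emeasure (cleb I) (Pi\<^sub>E I (\<lambda>_. cball 0 t))"
    by (intro emeasure_mono) (auto simp: cleb_def intro!: sets_PiM_I_finite assms)
  also have "\<dots> = (\<Prod>i\<in>I. emeasure lborel (cball (0 :: complex) t))"
    unfolding cleb_def by (intro emeasure_PiM assms) auto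
  also have "\<dots> < \<infinity>" using emeasure_lborel_cball_finite[of "0 :: complex" t]
    by (simp add: power_less_top_ennreal)
  finally show ?thesis .
qed

lemma emeasure_oball_pos:
  assumes "finite I" "t > 0"
  shows "emeasure (cleb I) (oball I t) > 0"
proof -
  interpret product_sigma_finite "\<lambda>_ :: 'a. lborel :: complex measure"
    by standard
  \<comment> \<open>The norm is bounded by the sum of the moduli, which is at most
    \<open>card I * s\<close>. The extra 1 makes this strictly less than t and covers an empty
    I.\<close>
  define s where "s = t / (card I + 1)"
  have s: "s > 0" using assms(2) by (simp add: s_def add_pos_nonneg)
  have "Pi\<^sub>E I (\<lambda>_. ball 0 s) \<subseteq> oball I t"
  proof
    fix y assume y: "y \<in> Pi\<^sub>E I (\<lambda>_. ball (0 :: complex) s)"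
    have "cnorm I y \<le> (\<Sum>k\<in>I. cmod (y k))" unfolding cnorm_def by (intro L2_set_le_sum) auto
    also have "\<dots> \<le> (\<Sum>k\<in>I. s)" using y by (intro sum_mono) (auto simp: PiE_def Pi_def less_imp_le)
    also have "\<dots> < t" using assms(2) by (simp add: s_def field_simps)
    finally show "y \<in> oball I t" using y by (simp add: oball_def space_cleb PiE_def)
  qed
  then have le: "emeasure (cleb I) (Pi\<^sub>E I (\<lambda>_. ball 0 s)) \<le> emeasure (cleb I) (oball I t)"
    by (intro emeasure_mono sets_oball)
  have "emeasure (cleb I) (Pi\<^sub>E I (\<lambda>_. ball 0 s)) = (\<Prod>i\<in>I. emeasure lborel (ball (0 :: complex) s))"
    unfolding cleb_def by (intro emeasure_PiM assms) auto
  moreover have "emeasure lborel (ball (0 :: complex) s) \<noteq> 0"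
  proof -
    have "unit_ball_vol 2 \<noteq> 0" using unit_ball_vol_pos[of 2] by linarith
    then show ?thesis using s by (simp add: emeasure_ball)
  qed
  ultimately have "emeasure (cleb I) (Pi\<^sub>E I (\<lambda>_. ball 0 s)) \<noteq> 0" by simp
  then show ?thesis using le by (metis le_zero_eq zero_less_iff_neq_zero)
qed

section \<open>Cones and radial integrals\<close>

definition cone :: "'i set \<Rightarrow> ('i \<Rightarrow> complex) set \<Rightarrow> bool" where
  "cone I C \<longleftrightarrow> C \<in> sets (cleb I) \<and>
     (\<forall>y\<in>space (cleb I). \<forall>t>0. (\<lambda>i\<in>I. t *\<^sub>R y i) \<in> C \<longleftrightarrow> y \<in> C)"

lemma cone_UNIV: "cone I (space (cleb I))"
  unfolding cone_def by (intro conjI sets.top ballI allI impI) (simp add: space_cleb)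

lemma cone_Diff: "cone I C \<Longrightarrow> cone I (space (cleb I) - C)"
  unfolding cone_def by (intro conjI sets.compl_sets ballI allI impI) (simp_all add: space_cleb)

lemma emeasure_cone_oball:
  assumes I: "finite I" and C: "cone I C" and t: "t > 0"
  shows "emeasure (cleb I) (C \<inter> oball I t) = ennreal (t ^ (2 * card I)) * emeasure (cleb I) (C \<inter> oball I 1)"
proof -
  have "{y \<in> space (cleb I). (\<lambda>i\<in>I. 0 + t *\<^sub>R y i) \<in> C \<inter> oball I t} = C \<inter> oball I 1"
    using C t by (auto simp: cone_def oball_def space_cleb cnorm_scaleR cong: cnorm_cong)
  moreover have "(\<Prod>i\<in>I. t\<^sup>2) = t ^ (2 * card I)" by (simp add: power_mult)
  moreover have "C \<inter> oball I t \<in> sets (cleb I)" using C by (auto simp: cone_def)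
  ultimately show ?thesis
    using emeasure_cleb_affine[OF I, of "\<lambda>_. t" "C \<inter> oball I t" "\<lambda>_. 0"] t
    by (simp only: mult.commute)
qed

text \<open>By homogeneity, the volume of a cone within radius t is a fixed multiple of the volume
  of the ball of radius t. So the images under the norm of Lebesgue measure on C and of Lebesgue
  measure on the whole space agree on all half-lines after cross-multiplication, hence as
  measures.\<close>

lemma nn_integral_cone_radial:
  assumes I: "finite I" and C: "cone I C" and g: "g \<in> borel_measurable borel"
  shows "emeasure (cleb I) (oball I 1) * (\<integral>\<^sup>+y. indicator C y * g (cnorm I y) \<partial>cleb I) =
    emeasure (cleb I) (C \<inter> oball I 1) * (\<integral>\<^sup>+y. g (cnorm I y) \<partial>cleb I)"
proof -
  have [measurable]: "C \<in> sets (cleb I)" using C by (simp add: cone_def)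
  define D where "D = density (cleb I) (indicator C)"
  define M1 where "M1 = scale_measure (emeasure (cleb I) (oball I 1)) (distr D borel (cnorm I))"
  define M2 where "M2 = scale_measure (emeasure (cleb I) (C \<inter> oball I 1)) (distr (cleb I) borel (cnorm I))"
  have [measurable]: "cnorm I \<in> borel_measurable D" by (simp add: D_def)
  have e1: "emeasure M1 {..<t} = emeasure (cleb I) (oball I 1) * emeasure (cleb I) (C \<inter> oball I t)" for t
  proof -
    have "emeasure (distr D borel (cnorm I)) {..<t} = emeasure D (oball I t)"
      by (subst emeasure_distr) (auto simp: D_def oball_def intro!: arg_cong[of _ _ "emeasure _"])
    also have "\<dots> = emeasure (cleb I) (C \<inter> oball I t)"
      unfolding D_def by (subst emeasure_density) (auto simp: indicator_inter_arith[symmetric])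
    finally show ?thesis by (simp add: M1_def)
  qed
  have e2: "emeasure M2 {..<t} = emeasure (cleb I) (C \<inter> oball I 1) * emeasure (cleb I) (oball I t)" for t
  proof -
    have "cnorm I -` {..<t} \<inter> space (cleb I) = oball I t" by (auto simp: oball_def)
    then show ?thesis by (simp add: M2_def emeasure_distr)
  qed
  have "M1 = M2"
  proof (rule measure_eqI_generator_eq[where E = "range lessThan" and \<Omega> = UNIV and A = "\<lambda>i. {..<real i}"])
    show "Int_stable (range lessThan :: real set set)"
    proof -
      have "{..<a} \<inter> {..<b} = {..<min a b}" for a b :: real by auto
      then show ?thesis by (auto simp: Int_stable_def)
    qed
    show "emeasure M1 X = emeasure M2 X" if XE: "X \<in> range lessThan" for X :: "real set"
    proof -
      obtain t where X: "X = {..<t}" using XE by auto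
      show ?thesis
      proof (cases "t > 0")
        case True
        have "emeasure (cleb I) (oball I t) = ennreal (t ^ (2 * card I)) * emeasure (cleb I) (oball I 1)"
          using emeasure_cone_oball[OF I cone_UNIV True] by (simp add: oball_def Int_def cong: conj_cong)
        then show ?thesis unfolding X e1 e2 emeasure_cone_oball[OF I C True] by (simp add: mult_ac)
      next
        case False
        then have "\<not> cnorm I y < t" for y using cnorm_nonneg[of I y] by linarith
        then have "oball I t = {}" by (simp add: oball_def)
        then show ?thesis by (simp add: X e1 e2)
      qed
    qed
    show "sets M1 = sigma_sets UNIV (range lessThan)" "sets M2 = sigma_sets UNIV (range lessThan)"
      by (simp_all add: M1_def M2_def borel_Iio)
    show "(\<Union>i. {..<real i}) = UNIV" using reals_Archimedean2 by auto
    show "emeasure M1 {..<real i} \<noteq> \<infinity>" for i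
    proof -
      have "emeasure (cleb I) (C \<inter> oball I i) \<le> emeasure (cleb I) (oball I i)"
        by (intro emeasure_mono) auto
      then show ?thesis unfolding e1
        using emeasure_oball_finite[OF I, of 1] emeasure_oball_finite[OF I, of i]
        by (auto simp: ennreal_mult_eq_top_iff top_unique)
    qed
  qed auto
  then have "(\<integral>\<^sup>+t. g t \<partial>M1) = (\<integral>\<^sup>+t. g t \<partial>M2)" by simp
  then show ?thesis using g
    by (simp add: M1_def M2_def nn_integral_scale_measure nn_integral_distr)
       (simp add: D_def nn_integral_density)
qed

section \<open>Comparing an invariant measure on the sphere with Lebesgue measure\<close>

lemma bip_unitary_isometry:
  assumes "bip_unitary n U"
  shows "cnorm (bip_index n) (bip_apply n U x) = cnorm (bip_index n) x"
proof -
  let ?I = "bip_index n :: ('a \<times> nat) set"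
  have orth: "(\<Sum>k\<in>?I. cnj (U k l') * U k l) = (if l' = l then 1 else 0)" if "l \<in> ?I" "l' \<in> ?I" for l l'
    using assms that unfolding bip_unitary_def by blast
  have "complex_of_real (\<Sum>k\<in>?I. (cmod (bip_apply n U x k))\<^sup>2) =
      (\<Sum>k\<in>?I. (\<Sum>l\<in>?I. U k l * x l) * cnj (\<Sum>l\<in>?I. U k l * x l))"
    by (simp add: bip_apply_def complex_norm_square[symmetric] del: of_real_power cnj_sum complex_cnj_mult)
  also have "\<dots> = (\<Sum>k\<in>?I. \<Sum>l\<in>?I. \<Sum>l'\<in>?I. x l * cnj (x l') * (cnj (U k l') * U k l))"
    by (simp add: sum_product mult_ac)
  also have "\<dots> = (\<Sum>l\<in>?I. \<Sum>k\<in>?I. \<Sum>l'\<in>?I. x l * cnj (x l') * (cnj (U k l') * U k l))"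
    by (rule sum.swap)
  also have "\<dots> = (\<Sum>l\<in>?I. \<Sum>l'\<in>?I. \<Sum>k\<in>?I. x l * cnj (x l') * (cnj (U k l') * U k l))"
    by (rule sum.cong[OF refl], rule sum.swap)
  also have "\<dots> = (\<Sum>l\<in>?I. \<Sum>l'\<in>?I. x l * cnj (x l') * (if l' = l then 1 else 0))"
    unfolding sum_distrib_left[symmetric] by (intro sum.cong refl) (simp only: orth)
  also have "\<dots> = (\<Sum>l\<in>?I. x l * cnj (x l))"
    by (simp add: if_distrib[of "(*) _"] cong: if_cong)
  also have "\<dots> = complex_of_real (\<Sum>k\<in>?I. (cmod (x k))\<^sup>2)"
    by (simp add: complex_norm_square[symmetric])
  finally have "(cnorm ?I (bip_apply n U x))\<^sup>2 = (cnorm ?I x)\<^sup>2"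
    by (simp only: of_real_eq_iff cnorm_power2)
  then show ?thesis by simp
qed

lemma bip_apply_extensional: "bip_apply n U x \<in> extensional (bip_index n)"
  by (simp add: bip_apply_def)

lemma bip_apply_diff:
  "k \<in> bip_index n \<Longrightarrow> bip_apply n U (\<lambda>k. x k - y k) k = bip_apply n U x k - bip_apply n U y k"
  by (simp add: bip_apply_def algebra_simps sum_subtractf)

text \<open>The complex Householder map \<open>1 - v v\<^sup>* / (v\<^sup>* y)\<close> with \<open>v = y - y'\<close> moves \<open>y\<close> to \<open>y'\<close>; it is
  unitary because \<open>2 Re (v\<^sup>* y) = \<parallel>v\<parallel>\<^sup>2\<close>. For \<open>y = y'\<close> the convention \<open>1 / 0 = 0\<close> makes it the identity.\<close>

lemma bip_unitary_transitive:
  fixes y y' :: "'m::finite \<times> nat \<Rightarrow> complex"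
  assumes "cnorm (bip_index n) y = cnorm (bip_index n) y'" "y' \<in> extensional (bip_index n)"
  obtains V where "bip_unitary n V" "bip_apply n V y = y'"
proof -
  let ?I = "bip_index n :: ('m \<times> nat) set"
  define v where "v k = y k - y' k" for k
  define c where "c = (\<Sum>k\<in>?I. cnj (v k) * y k)"
  define s where "s = (\<Sum>k\<in>?I. (cmod (v k))\<^sup>2)"
  define b where "b = 1 / c"
  define V where "V k l = (if k = l then 1 else 0) - b * v k * cnj (v l)" for k l
  have "(\<Sum>k\<in>?I. (cmod (y k))\<^sup>2) = (\<Sum>k\<in>?I. (cmod (y' k))\<^sup>2)"
    using assms(1) unfolding cnorm_power2[symmetric] by simp
  moreover have "(cmod (v k))\<^sup>2 = 2 * Re (cnj (v k) * y k) - (cmod (y k))\<^sup>2 + (cmod (y' k))\<^sup>2" for k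
    unfolding v_def cmod_power2 by (simp add: power2_eq_square algebra_simps)
  \<comment> \<open>Equality of the norms of y and y' enters here.\<close>
  ultimately have Re_c: "s = 2 * Re c"
    by (simp add: s_def c_def sum.distrib sum_subtractf sum_distrib_left)
  \<comment> \<open>Exactly the condition under which 1 - b v v* is unitary.\<close>
  have b: "b + cnj b = b * cnj b * of_real s"
  proof (cases "c = 0")
    case False
    have "of_real s = c + cnj c" by (simp add: Re_c complex_add_cnj)
    then show ?thesis using False by (simp add: b_def field_simps)
  qed (simp add: b_def)
  have vv: "(\<Sum>j\<in>?I. v j * cnj (v j)) = of_real s"
    by (simp add: s_def complex_norm_square[symmetric])
  have key: "- b * w - cnj b * w + b * cnj b * of_real s * w = 0" for w
  proof -
    have "- b * w - cnj b * w + b * cnj b * of_real s * w = (b * cnj b * of_real s - (b + cnj b)) * w"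
      by (simp add: algebra_simps)
    then show ?thesis by (simp add: b)
  qed
  have "bip_unitary n V"
    unfolding bip_unitary_def
  proof (intro ballI conjI)
    fix k l assume k: "k \<in> ?I" and l: "l \<in> ?I"
    have "(\<Sum>j\<in>?I. cnj (V j k) * V j l) =
        (\<Sum>j\<in>?I. (if j = k then (if k = l then 1 else 0) - b * v k * cnj (v l) else 0) -
          (if j = l then cnj b * cnj (v l) * v k else 0) +
          b * cnj b * v k * cnj (v l) * (v j * cnj (v j)))"
      by (intro sum.cong refl) (auto simp: V_def algebra_simps)
    also have "\<dots> = (if k = l then 1 else 0) - b * v k * cnj (v l) - cnj b * cnj (v l) * v k +
        b * cnj b * v k * cnj (v l) * of_real s"
      using k l by (simp only: sum.distrib sum_subtractf sum_distrib_left[symmetric] vv) simp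
    also have "\<dots> = (if k = l then 1 else 0)"
      using key[of "v k * cnj (v l)"] by (simp add: algebra_simps)
    finally show "(\<Sum>j\<in>?I. cnj (V j k) * V j l) = (if k = l then 1 else 0)" .
    have "(\<Sum>j\<in>?I. V k j * cnj (V l j)) =
        (\<Sum>j\<in>?I. (if j = k then (if k = l then 1 else 0) - cnj b * cnj (v l) * v k else 0) -
          (if j = l then b * cnj (v l) * v k else 0) +
          b * cnj b * v k * cnj (v l) * (v j * cnj (v j)))"
      by (intro sum.cong refl) (auto simp: V_def algebra_simps)
    also have "\<dots> = (if k = l then 1 else 0) - cnj b * cnj (v l) * v k - b * cnj (v l) * v k +
        b * cnj b * v k * cnj (v l) * of_real s"
      using k l by (simp only: sum.distrib sum_subtractf sum_distrib_left[symmetric] vv) simp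
    also have "\<dots> = (if k = l then 1 else 0)"
      using key[of "v k * cnj (v l)"] by (simp add: algebra_simps)
    finally show "(\<Sum>j\<in>?I. V k j * cnj (V l j)) = (if k = l then 1 else 0)" .
  qed
  moreover have "bip_apply n V y = y'"
  proof (rule extensionalityI[OF bip_apply_extensional assms(2)])
    fix k assume k: "k \<in> ?I"
    have "bip_apply n V y k = (\<Sum>l\<in>?I. (if l = k then y k else 0) - b * v k * (cnj (v l) * y l))"
      using k unfolding bip_apply_def restrict_apply' [OF k]
      by (intro sum.cong refl) (auto simp: V_def algebra_simps)
    also have "\<dots> = y k - b * v k * c"
      using k by (simp only: sum_subtractf sum_distrib_left[symmetric] c_def[symmetric]) simp
    also have "\<dots> = y k - v k"
    proof (cases "c = 0")
      \<comment> \<open>Then v has norm 0, so y and y' already agree on the index set.\<close>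
      case True
      then have "s = 0" using Re_c by simp
      then have "v k = 0" using k unfolding s_def by (subst (asm) sum_nonneg_eq_0_iff) auto
      then show ?thesis by simp
    qed (simp add: b_def)
    finally show "bip_apply n V y k = y' k" by (simp add: v_def)
  qed
  ultimately show ?thesis using that by blast
qed

context
  fixes n :: nat and \<mu> :: "('m::finite \<times> nat \<Rightarrow> complex) measure"
  assumes inv: "unitarily_invariant_prob n \<mu>"
begin

private abbreviation (input) I where "I \<equiv> bip_index n :: ('m \<times> nat) set"

lemma sets_bip_borel: "sets (bip_borel n) = sets (cleb I)"
  by (simp add: bip_borel_def sets_cleb)

lemma space_invariant: "space \<mu> = {\<psi> \<in> space (cleb I). cnorm I \<psi> = 1}"
proof -
  have "space \<mu> = bip_unit_vecs n \<inter> space (bip_borel n)"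
    using inv sets_eq_imp_space_eq[of \<mu> "restrict_space (bip_borel n) (bip_unit_vecs n)"]
    by (simp add: unitarily_invariant_prob_def space_restrict_space)
  also have "space (bip_borel n) = space (cleb I)"
    using sets_eq_imp_space_eq[OF sets_bip_borel] .
  also have "bip_unit_vecs n = {\<psi> \<in> space (cleb I). cnorm I \<psi> = 1}"
  proof -
    have "cnorm I \<psi> \<noteq> - 1" for \<psi> using cnorm_nonneg[of I \<psi>] by linarith
    then show ?thesis
      unfolding bip_unit_vecs_def space_cleb cnorm_power2[symmetric] by (simp add: power2_eq_1_iff)
  qed
  finally show ?thesis by blast
qed

lemma measurable_invariant_ident [measurable]: "(\<lambda>x. x) \<in> measurable \<mu> (cleb I)"
proof -
  have "(\<lambda>x. x) \<in> measurable (restrict_space (bip_borel n) (bip_unit_vecs n)) (bip_borel n)"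
    by (intro measurable_restrict_space1) simp
  then show ?thesis
    using inv measurable_cong_sets[of \<mu> "restrict_space (bip_borel n) (bip_unit_vecs n)" "cleb I" "bip_borel n"]
    by (simp add: unitarily_invariant_prob_def sets_bip_borel)
qed

lemma measurable_component_invariant: "k \<in> I \<Longrightarrow> (\<lambda>x. x k) \<in> borel_measurable \<mu>"
  by (rule measurable_compose[OF measurable_invariant_ident measurable_component_cleb])

lemma measurable_bip_apply:
  assumes "bip_unitary n U"
  shows "bip_apply n U \<in> measurable \<mu> \<mu>"
proof -
  have "bip_apply n U \<in> measurable \<mu> (bip_borel n)"
    unfolding bip_borel_def bip_apply_def
    by (intro measurable_restrict borel_measurable_sum borel_measurable_times
        borel_measurable_const measurable_component_invariant)
  moreover have "bip_apply n U \<in> space \<mu> \<rightarrow> bip_unit_vecs n"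
  proof
    fix x assume "x \<in> space \<mu>"
    then have "cnorm I (bip_apply n U x) = 1"
      using bip_unitary_isometry[OF assms, of x] by (simp add: space_invariant)
    then show "bip_apply n U x \<in> bip_unit_vecs n"
      by (simp add: bip_unit_vecs_def bip_apply_extensional cnorm_power2[symmetric])
  qed
  ultimately have "bip_apply n U \<in> measurable \<mu> (restrict_space (bip_borel n) (bip_unit_vecs n))"
    by (intro measurable_restrict_space2)
  then show ?thesis
    using inv measurable_cong_sets[of \<mu> \<mu> \<mu> "restrict_space (bip_borel n) (bip_unit_vecs n)"]
    by (simp add: unitarily_invariant_prob_def)
qed

lemma emeasure_bip_apply:
  assumes "bip_unitary n U" "E \<in> sets \<mu>"
  shows "emeasure \<mu> {x \<in> space \<mu>. bip_apply n U x \<in> E} = emeasure \<mu> E"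
proof -
  have "distr \<mu> \<mu> (bip_apply n U) = \<mu>"
    using inv assms(1) by (simp add: unitarily_invariant_prob_def)
  then have "emeasure \<mu> E = emeasure \<mu> (bip_apply n U -` E \<inter> space \<mu>)"
    using emeasure_distr[OF measurable_bip_apply[OF assms(1)] assms(2)] by simp
  then show ?thesis by (simp add: vimage_def Int_def conj_commute)
qed

lemma measurable_cnorm_diff:
  "(\<lambda>p. cnorm I (\<lambda>k. fst p k - snd p k)) \<in> borel_measurable (\<mu> \<Otimes>\<^sub>M cleb I)"
proof -
  have "(\<lambda>p. fst p k) \<in> borel_measurable (\<mu> \<Otimes>\<^sub>M cleb I)" if "k \<in> I" for k
    using measurable_compose[OF measurable_fst measurable_component_invariant[OF that]] .
  moreover have "(\<lambda>p. snd p k) \<in> borel_measurable (\<mu> \<Otimes>\<^sub>M cleb I)" if "k \<in> I" for k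
    using measurable_compose[OF measurable_snd measurable_component_cleb[OF that]] .
  ultimately show ?thesis
    unfolding cnorm_def L2_set_def
    by (intro borel_measurable_sqrt[THEN measurable_compose_rev] borel_measurable_sum
        borel_measurable_power borel_measurable_norm[THEN measurable_compose_rev] borel_measurable_diff)
qed

lemma sets_invariant_ball:
  assumes "y \<in> space (cleb I)"
  shows "{x \<in> space \<mu>. cnorm I (\<lambda>k. x k - y k) < r} \<in> sets \<mu>"
proof -
  have "(\<lambda>x. cnorm I (\<lambda>k. x k - y k)) \<in> borel_measurable \<mu>"
    using measurable_compose[OF measurable_Pair2'[OF assms] measurable_cnorm_diff] by simp
  then show ?thesis by measurable
qed

text \<open>A unitary that moves y to y' preserves distances, so it matches the two balls, and \<mu>
  does not notice it.\<close>

lemma emeasure_invariant_ball_cong: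
  assumes "y \<in> space (cleb I)" "y' \<in> space (cleb I)" "cnorm I y = cnorm I y'"
  shows "emeasure \<mu> {x \<in> space \<mu>. cnorm I (\<lambda>k. x k - y k) < r} =
    emeasure \<mu> {x \<in> space \<mu>. cnorm I (\<lambda>k. x k - y' k) < r}"
proof -
  obtain V where V: "bip_unitary n V" "bip_apply n V y = y'"
    using bip_unitary_transitive[OF assms(3)] assms(2) by (auto simp: space_cleb)
  have "cnorm I (\<lambda>k. bip_apply n V x k - y' k) = cnorm I (\<lambda>k. x k - y k)" for x
  proof -
    have "cnorm I (\<lambda>k. bip_apply n V x k - y' k) = cnorm I (bip_apply n V (\<lambda>k. x k - y k))"
      by (intro cnorm_cong) (simp add: bip_apply_diff V(2))
    then show ?thesis by (simp add: bip_unitary_isometry[OF V(1)])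
  qed
  then show ?thesis
    using emeasure_bip_apply[OF V(1) sets_invariant_ball[OF assms(2), of r]]
      measurable_space[OF measurable_bip_apply[OF V(1)]] by (simp cong: conj_cong)
qed

text \<open>Integrate \<open>1[\<parallel>x - y\<parallel> < r]\<close> against \<open>\<mu> \<otimes> Lebesgue\<close>. The \<open>y\<close>-integral does not depend on \<open>x\<close> by
  translation invariance, the \<open>x\<close>-integral depends only on \<open>\<parallel>y\<parallel>\<close> by unitary invariance, and cones
  have the same share of every radial measure.\<close>

theorem invariant_measure_le_cone:
  assumes n: "n \<ge> 1" and r: "r > 0" and A: "A \<in> sets \<mu>" and C: "cone I C"
    and near: "\<And>x y. x \<in> A \<Longrightarrow> y \<in> space (cleb I) \<Longrightarrow> cnorm I (\<lambda>k. x k - y k) < r \<Longrightarrow> y \<in> C"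
  shows "emeasure \<mu> A * emeasure (cleb I) (oball I 1) \<le> emeasure (cleb I) (C \<inter> oball I 1)"
proof -
  interpret \<mu>: prob_space \<mu> using inv by (simp add: unitarily_invariant_prob_def)
  interpret L: finite_product_sigma_finite "\<lambda>_ :: 'm \<times> nat. lborel :: complex measure" I
    by standard simp
  interpret L: sigma_finite_measure "cleb I" unfolding cleb_def by (rule L.sigma_finite_measure_axioms)
  interpret P: pair_sigma_finite \<mu> "cleb I" by standard
  have finI: "finite I" by simp
  define S where "S = {p \<in> space (\<mu> \<Otimes>\<^sub>M cleb I). cnorm I (\<lambda>k. fst p k - snd p k) < r}"
  define K where "K x y = (indicator S (x, y) :: ennreal)" for x y
  define \<beta> where "\<beta> = emeasure (cleb I) (oball I r)"
  define g where "g y = (\<integral>\<^sup>+x. K x y \<partial>\<mu>)" for y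
  have S: "S \<in> sets (\<mu> \<Otimes>\<^sub>M cleb I)"
    unfolding S_def using measurable_cnorm_diff by measurable
  have K: "(\<lambda>(x, y). K x y) \<in> borel_measurable (\<mu> \<Otimes>\<^sub>M cleb I)"
    using borel_measurable_indicator[OF S] by (simp add: K_def)
  have K_eq: "K x y = (if cnorm I (\<lambda>k. x k - y k) < r then 1 else 0)"
    if "x \<in> space \<mu>" "y \<in> space (cleb I)" for x y
    using that by (simp add: K_def S_def space_pair_measure)
  have C_sets: "C \<in> sets (cleb I)" using C by (simp add: cone_def)
  have int_y: "(\<integral>\<^sup>+y. K x y \<partial>cleb I) = \<beta>" if "x \<in> space \<mu>" for x
  proof -
    have "(\<integral>\<^sup>+y. K x y \<partial>cleb I) = (\<integral>\<^sup>+y. indicator {y \<in> space (cleb I). cnorm I (\<lambda>k. x k - y k) < r} y \<partial>cleb I)"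
      by (intro nn_integral_cong) (auto simp: K_eq that indicator_def)
    also have "\<dots> = emeasure (cleb I) {y \<in> space (cleb I). cnorm I (\<lambda>k. x k - y k) < r}"
    proof -
      have "(\<lambda>y. cnorm I (\<lambda>k. x k - y k)) \<in> borel_measurable (cleb I)"
        using measurable_compose[OF measurable_Pair1'[OF that] measurable_cnorm_diff] by simp
      then have "{y \<in> space (cleb I). cnorm I (\<lambda>k. x k - y k) < r} \<in> sets (cleb I)"
        by measurable
      then show ?thesis by simp
    qed
    also have "\<dots> = \<beta>" unfolding \<beta>_def by (rule emeasure_translated_oball[OF finI])
    finally show ?thesis .
  qed
  have g_eq: "g y = emeasure \<mu> {x \<in> space \<mu>. cnorm I (\<lambda>k. x k - y k) < r}" if "y \<in> space (cleb I)" for y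
  proof -
    have "g y = (\<integral>\<^sup>+x. indicator {x \<in> space \<mu>. cnorm I (\<lambda>k. x k - y k) < r} x \<partial>\<mu>)"
      unfolding g_def by (intro nn_integral_cong) (auto simp: K_eq that indicator_def)
    then show ?thesis using sets_invariant_ball[OF that] by simp
  qed
  have g_meas: "g \<in> borel_measurable (cleb I)"
    unfolding g_def using measurable_pair_swap[OF K] by (intro \<mu>.borel_measurable_nn_integral) simp
  have ineq: "emeasure \<mu> A' * \<beta> = (\<integral>\<^sup>+y. \<integral>\<^sup>+x. indicator A' x * K x y \<partial>\<mu> \<partial>cleb I)"
    if [measurable]: "A' \<in> sets \<mu>" for A'
  proof -
    note K[measurable]
    have "(\<integral>\<^sup>+y. \<integral>\<^sup>+x. indicator A' x * K x y \<partial>\<mu> \<partial>cleb I) =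
        (\<integral>\<^sup>+x. \<integral>\<^sup>+y. indicator A' x * K x y \<partial>cleb I \<partial>\<mu>)"
      by (rule P.Fubini') measurable
    also have "\<dots> = (\<integral>\<^sup>+x. indicator A' x * \<beta> \<partial>\<mu>)"
    proof (intro nn_integral_cong)
      fix x assume x: "x \<in> space \<mu>"
      have "K x \<in> borel_measurable (cleb I)"
        using measurable_compose[OF measurable_Pair1'[OF x] K] by simp
      then show "(\<integral>\<^sup>+y. indicator A' x * K x y \<partial>cleb I) = indicator A' x * \<beta>"
        by (simp add: nn_integral_cmult int_y[OF x])
    qed
    also have "\<dots> = emeasure \<mu> A' * \<beta>" by (simp add: nn_integral_multc)
    finally show ?thesis by simp
  qed
  \<comment> \<open>For x in A the kernel vanishes unless y lies in C, so the indicator of A may be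
    exchanged for that of C.\<close>
  have le: "emeasure \<mu> A * \<beta> \<le> (\<integral>\<^sup>+y. indicator C y * g y \<partial>cleb I)"
    unfolding ineq[OF A]
  proof (intro nn_integral_mono)
    fix y assume y: "y \<in> space (cleb I)"
    have "(\<integral>\<^sup>+x. indicator A x * K x y \<partial>\<mu>) \<le> (\<integral>\<^sup>+x. indicator C y * K x y \<partial>\<mu>)"
      using near[OF _ y] by (intro nn_integral_mono) (auto simp: K_eq y indicator_def)
    also have "\<dots> = indicator C y * g y"
      by (auto simp: g_def indicator_def)
    finally show "(\<integral>\<^sup>+x. indicator A x * K x y \<partial>\<mu>) \<le> indicator C y * g y" .
  qed
  \<comment> \<open>The whole sphere in place of A: the total mass of g is \<beta>.\<close>
  have int_g: "\<beta> = (\<integral>\<^sup>+y. g y \<partial>cleb I)"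
  proof -
    have "\<beta> = (\<integral>\<^sup>+y. \<integral>\<^sup>+x. indicator (space \<mu>) x * K x y \<partial>\<mu> \<partial>cleb I)"
      using ineq[OF sets.top] by (simp add: \<mu>.emeasure_space_1)
    also have "\<dots> = (\<integral>\<^sup>+y. g y \<partial>cleb I)"
      unfolding g_def by (intro nn_integral_cong) simp
    finally show ?thesis .
  qed
  have radial: "emeasure (cleb I) (oball I 1) * (\<integral>\<^sup>+y. indicator C y * g y \<partial>cleb I) =
      emeasure (cleb I) (C \<inter> oball I 1) * (\<integral>\<^sup>+y. g y \<partial>cleb I)"
  proof -
    \<comment> \<open>\<open>e t\<close> is a reference vector of norm t, along one coordinate that
      exists because n \<ge> 1. Comparing y with it writes g as a function of the norm.\<close>
    obtain k0 where k0: "k0 \<in> I" using n by fastforce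
    define e where "e t = (\<lambda>k\<in>I. if k = k0 then complex_of_real t else 0)" for t
    have e_meas: "e \<in> measurable borel (cleb I)"
      unfolding e_def cleb_def by (intro measurable_restrict) measurable
    have g0_meas: "(\<lambda>t. g (e t)) \<in> borel_measurable borel"
      using measurable_compose[OF e_meas g_meas] .
    have sq: "(cnorm I (e t))\<^sup>2 = t\<^sup>2" for t
    proof -
      have "(cnorm I (e t))\<^sup>2 = (\<Sum>k\<in>I. if k = k0 then t\<^sup>2 else 0)"
        unfolding cnorm_power2 by (intro sum.cong) (auto simp: e_def)
      then show ?thesis using k0 by simp
    qed
    have "cnorm I (e t) = t" if "t \<ge> 0" for t using sq[of t] that by (simp add: power2_eq_iff_nonneg)
    then have "g y = g (e (cnorm I y))" if "y \<in> space (cleb I)" for y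
      using emeasure_invariant_ball_cong[OF that, of "e (cnorm I y)" r] g_eq[OF that] g_eq[of "e (cnorm I y)"]
      by (simp add: space_cleb e_def)
    then show ?thesis
      using nn_integral_cone_radial[OF finI C g0_meas] by (simp cong: nn_integral_cong_simp)
  qed
  have "\<beta> * (emeasure \<mu> A * emeasure (cleb I) (oball I 1)) = emeasure (cleb I) (oball I 1) * (emeasure \<mu> A * \<beta>)"
    by (simp add: mult_ac)
  also have "\<dots> \<le> emeasure (cleb I) (oball I 1) * (\<integral>\<^sup>+y. indicator C y * g y \<partial>cleb I)"
    by (intro mult_left_mono le) simp
  also have "\<dots> = \<beta> * emeasure (cleb I) (C \<inter> oball I 1)"
    unfolding radial int_g[symmetric] by (rule mult.commute)
  finally have "\<beta> * (emeasure \<mu> A * emeasure (cleb I) (oball I 1)) \<le> \<beta> * emeasure (cleb I) (C \<inter> oball I 1)" .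
  moreover have "\<beta> \<noteq> 0" "\<beta> \<noteq> \<top>"
    unfolding \<beta>_def using emeasure_oball_pos[OF finI r] emeasure_oball_finite[OF finI, of r] by auto
  ultimately show ?thesis by (simp add: ennreal_mult_le_mult_iff)
qed

corollary invariant_measure_le_cone_real:
  assumes "n \<ge> 1" "r > 0" "A \<in> sets \<mu>" "cone I C"
    and "\<And>x y. x \<in> A \<Longrightarrow> y \<in> space (cleb I) \<Longrightarrow> cnorm I (\<lambda>k. x k - y k) < r \<Longrightarrow> y \<in> C"
  shows "measure \<mu> A * measure (cleb I) (oball I 1) \<le> measure (cleb I) (C \<inter> oball I 1)"
proof -
  have "emeasure (cleb I) (C \<inter> oball I 1) \<le> emeasure (cleb I) (oball I 1)"
    by (intro emeasure_mono) auto
  also have "\<dots> < \<infinity>" by (rule emeasure_oball_finite) simp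
  finally show ?thesis
    using enn2real_mono[OF invariant_measure_le_cone[OF assms]]
    by (simp add: measure_def enn2real_mult)
qed

end

section \<open>Reduced states\<close>

lemma reduced_state_nth: "reduced_state n y $ a $ b = (\<Sum>j<n. y (a, j) * cnj (y (b, j)))"
  by (simp add: reduced_state_def partial_trace_E_def pure_proj_def)

lemma sum_bip_index: "(\<Sum>k\<in>bip_index n. f k) = (\<Sum>a\<in>UNIV. \<Sum>j<n. f (a, j))"
  by (simp add: sum.cartesian_product)

lemma Re_reduced_state_diag: "Re (reduced_state n y $ a $ a) = (\<Sum>j<n. (cmod (y (a, j)))\<^sup>2)"
  by (simp add: reduced_state_nth complex_norm_square[symmetric] del: of_real_power)

lemma cnorm_reduced_state:
  "(cnorm (bip_index n) y)\<^sup>2 = (\<Sum>a\<in>UNIV. Re (reduced_state n y $ a $ a))"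
  by (simp only: cnorm_power2 sum_bip_index Re_reduced_state_diag)

text \<open>Rescaling the blocks of coordinates acts on the reduced matrix as congruence with the
  real diagonal matrix of t.\<close>

lemma reduced_state_scale:
  "reduced_state n (\<lambda>k\<in>bip_index n. t (fst k) *\<^sub>R y k) $ a $ b = of_real (t a * t b) * reduced_state n y $ a $ b"
  by (simp add: reduced_state_nth sum_distrib_left scaleR_conv_of_real[where 'a = complex] mult_ac)

lemma reduced_state_density_ops:
  assumes "cnorm (bip_index n) y = 1"
  shows "reduced_state n y \<in> density_ops"
proof -
  have "hermitian (reduced_state n y)"
    by (simp add: hermitian_def vec_eq_iff adj_nth reduced_state_nth mult.commute)
  moreover have "0 \<le> Re (hinner v (reduced_state n y *v v))" for v
  proof -
    have "hinner v (reduced_state n y *v v) =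
        (\<Sum>a\<in>UNIV. \<Sum>b\<in>UNIV. \<Sum>j<n. (cnj (v $ a) * y (a, j)) * cnj (cnj (v $ b) * y (b, j)))"
      by (simp add: hinner_def matrix_vector_mult_def reduced_state_nth sum_distrib_left
          sum_distrib_right mult_ac)
    also have "\<dots> = (\<Sum>a\<in>UNIV. \<Sum>j<n. \<Sum>b\<in>UNIV. (cnj (v $ a) * y (a, j)) * cnj (cnj (v $ b) * y (b, j)))"
      by (rule sum.cong[OF refl], rule sum.swap)
    also have "\<dots> = (\<Sum>j<n. \<Sum>a\<in>UNIV. \<Sum>b\<in>UNIV. (cnj (v $ a) * y (a, j)) * cnj (cnj (v $ b) * y (b, j)))"
      by (rule sum.swap)
    also have "\<dots> = (\<Sum>j<n. (\<Sum>a\<in>UNIV. cnj (v $ a) * y (a, j)) * cnj (\<Sum>a\<in>UNIV. cnj (v $ a) * y (a, j)))"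
      by (simp only: sum_product cnj_sum)
    also have "\<dots> = of_real (\<Sum>j<n. (cmod (\<Sum>a\<in>UNIV. cnj (v $ a) * y (a, j)))\<^sup>2)"
      by (simp only: complex_norm_square[symmetric] of_real_sum)
    finally show ?thesis by (simp add: sum_nonneg del: of_real_sum of_real_power)
  qed
  moreover have "trace (reduced_state n y) = 1"
  proof -
    have "reduced_state n y $ a $ a = of_real (\<Sum>j<n. (cmod (y (a, j)))\<^sup>2)" for a
      by (simp only: reduced_state_nth complex_norm_square[symmetric] of_real_sum)
    then have "trace (reduced_state n y) = of_real ((cnorm (bip_index n) y)\<^sup>2)"
      by (simp only: trace_def cnorm_power2 sum_bip_index of_real_sum)
    then show ?thesis using assms by simp
  qed
  ultimately show ?thesis by (simp add: density_ops_def pos_semidef_iff)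
qed

lemma reduced_state_row_le:
  fixes y :: "'m::finite \<times> nat \<Rightarrow> complex"
  shows "L2_set (\<lambda>j. cmod (y (a, j))) {..<n} \<le> cnorm (bip_index n) y"
proof -
  have "(\<Sum>j<n. (cmod (y (a, j)))\<^sup>2) \<le> (\<Sum>a\<in>(UNIV :: 'm set). \<Sum>j<n. (cmod (y (a, j)))\<^sup>2)"
    by (intro member_le_sum) (auto intro: sum_nonneg)
  then show ?thesis by (simp only: L2_set_def cnorm_def sum_bip_index real_sqrt_le_iff)
qed

lemma reduced_state_cauchy_schwarz:
  fixes x y :: "'m::finite \<times> nat \<Rightarrow> complex"
  shows "cmod (\<Sum>j<n. x (a, j) * cnj (y (b, j))) \<le> cnorm (bip_index n) x * cnorm (bip_index n) y"
proof -
  have "cmod (\<Sum>j<n. x (a, j) * cnj (y (b, j))) \<le> (\<Sum>j<n. \<bar>cmod (x (a, j))\<bar> * \<bar>cmod (y (b, j))\<bar>)"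
    by (intro sum_norm_le) (simp add: norm_mult)
  also have "\<dots> \<le> L2_set (\<lambda>j. cmod (x (a, j))) {..<n} * L2_set (\<lambda>j. cmod (y (b, j))) {..<n}"
    by (rule L2_set_mult_ineq)
  also have "\<dots> \<le> cnorm (bip_index n) x * cnorm (bip_index n) y"
    by (intro mult_mono reduced_state_row_le) auto
  finally show ?thesis .
qed

lemma reduced_state_lipschitz:
  fixes x y :: "'m::finite \<times> nat \<Rightarrow> complex"
  shows "cmod (reduced_state n x $ a $ b - reduced_state n y $ a $ b) \<le>
    (cnorm (bip_index n) x + cnorm (bip_index n) y) * cnorm (bip_index n) (\<lambda>k. x k - y k)"
proof -
  let ?z = "\<lambda>k. x k - y k"
  have "reduced_state n x $ a $ b - reduced_state n y $ a $ b =
      (\<Sum>j<n. x (a, j) * cnj (?z (b, j))) + (\<Sum>j<n. ?z (a, j) * cnj (y (b, j)))"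
    by (simp add: reduced_state_nth sum.distrib[symmetric] sum_subtractf[symmetric] algebra_simps)
  then have "cmod (reduced_state n x $ a $ b - reduced_state n y $ a $ b) \<le>
      cmod (\<Sum>j<n. x (a, j) * cnj (?z (b, j))) + cmod (\<Sum>j<n. ?z (a, j) * cnj (y (b, j)))"
    by (simp only: norm_triangle_ineq)
  also have "\<dots> \<le> cnorm (bip_index n) x * cnorm (bip_index n) ?z + cnorm (bip_index n) ?z * cnorm (bip_index n) y"
    by (intro add_mono reduced_state_cauchy_schwarz)
  finally show ?thesis by (simp add: algebra_simps)
qed

text \<open>The norm of y is at most 1 + r \<le> 2, so the sum of the norms of x and y is at most 3.
  This explains the constant in both bounds.\<close>

lemma reduced_state_near_sphere:
  fixes x y :: "'m::finite \<times> nat \<Rightarrow> complex"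
  assumes x: "cnorm (bip_index n) x = 1" and xy: "cnorm (bip_index n) (\<lambda>k. x k - y k) < r" and r: "r \<le> 1"
  shows "cmod (reduced_state n x $ a $ b - reduced_state n y $ a $ b) \<le> 3 * r"
    and "\<bar>(cnorm (bip_index n) y)\<^sup>2 - 1\<bar> \<le> 3 * r"
proof -
  let ?c = "cnorm (bip_index n) y" and ?z = "cnorm (bip_index n) (\<lambda>k. x k - y k)"
  have c: "\<bar>?c - 1\<bar> \<le> r" using cnorm_diff_le[of "bip_index n" x y] x xy by simp
  have "cmod (reduced_state n x $ a $ b - reduced_state n y $ a $ b) \<le> (1 + ?c) * ?z"
    using reduced_state_lipschitz[of n x a b y] x by simp
  also have "\<dots> \<le> 3 * r" using c r xy by (intro mult_mono) auto
  finally show "cmod (reduced_state n x $ a $ b - reduced_state n y $ a $ b) \<le> 3 * r" .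
  have "?c\<^sup>2 - 1 = (?c + 1) * (?c - 1)" by (simp add: power2_eq_square algebra_simps)
  then have "\<bar>?c\<^sup>2 - 1\<bar> = \<bar>?c + 1\<bar> * \<bar>?c - 1\<bar>" by (simp only: abs_mult)
  also have "\<dots> \<le> 3 * r" using c r by (intro mult_mono) auto
  finally show "\<bar>?c\<^sup>2 - 1\<bar> \<le> 3 * r" .
qed

lemma measurable_reduced_state_nth:
  "(\<lambda>y. reduced_state n y $ a $ b) \<in> borel_measurable (cleb (bip_index n))"
proof -
  have "cnj \<in> borel_measurable borel"
    by (intro borel_measurable_continuous_onI continuous_intros)
  then have "(\<lambda>y. cnj (y k)) \<in> borel_measurable (cleb (bip_index n))" if "k \<in> bip_index n" for k
    using measurable_compose[OF measurable_component_cleb[OF that]] by blast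
  then show ?thesis
    unfolding reduced_state_nth
    by (intro borel_measurable_sum borel_measurable_times measurable_component_cleb) auto
qed

lemma measurable_reduced_state [measurable]:
  fixes n :: nat
  shows "reduced_state n \<in> measurable (cleb (bip_index n)) (borel :: (complex ^ 'm ^ 'm) measure)"
proof (subst borel_measurable_euclidean_space, intro ballI)
  fix e :: "complex ^ 'm ^ 'm" assume "e \<in> Basis"
  then obtain a b u where e: "e = axis a (axis b u)" by (auto simp: Basis_vec_def)
  have "(\<lambda>y. reduced_state n y $ a $ b \<bullet> u) \<in> borel_measurable (cleb (bip_index n))"
    by (intro borel_measurable_inner measurable_reduced_state_nth borel_measurable_const)
  then show "(\<lambda>y. reduced_state n y \<bullet> e) \<in> borel_measurable (cleb (bip_index n))"
    by (simp add: e inner_axis)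
qed

lemma sets_state_event:
  assumes "unitarily_invariant_prob n \<mu>" "A \<in> sets borel"
  shows "state_event n \<mu> A \<in> sets \<mu>"
proof -
  have "reduced_state n \<in> borel_measurable \<mu>"
    using measurable_compose[OF measurable_invariant_ident[OF assms(1)] measurable_reduced_state] .
  from measurable_sets[OF this assms(2)] show ?thesis
    by (simp add: state_event_def vimage_def Int_def conj_commute)
qed

text \<open>V is the tensor product of X with the identity of the environment, written in the
  product basis.\<close>

lemma reduced_state_local_unitary:
  fixes X :: "complex ^ 'm ^ 'm"
  assumes "unitary X"
  obtains V where "bip_unitary n V"
    "\<And>y. reduced_state n (bip_apply n V y) = X ** reduced_state n y ** adj X"
proof -
  define V where "V k l = (if snd k = snd l then X $ fst k $ fst l else 0)" for k l :: "'m \<times> nat"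
  have 1: "(\<Sum>c\<in>UNIV. cnj (X $ c $ a) * X $ c $ b) = (if a = b then 1 else 0)" for a b
    using assms unfolding unitary_def
    by (simp add: vec_eq_iff matrix_matrix_mult_def adj_nth mat_def)
  have 2: "(\<Sum>c\<in>UNIV. X $ a $ c * cnj (X $ b $ c)) = (if a = b then 1 else 0)" for a b
    using assms unfolding unitary_def
    by (simp add: vec_eq_iff matrix_matrix_mult_def adj_nth mat_def)
  have "bip_unitary n V"
    unfolding bip_unitary_def
  proof (intro ballI conjI)
    fix k l :: "'m \<times> nat" assume k: "k \<in> bip_index n" and l: "l \<in> bip_index n"
    have kl: "k = l \<longleftrightarrow> snd k = snd l \<and> fst k = fst l" by (auto simp: prod_eq_iff)
    have "(\<Sum>j\<in>bip_index n. cnj (V j k) * V j l) =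
        (\<Sum>a\<in>UNIV. \<Sum>j<n. if j = snd k then if snd k = snd l then cnj (X $ a $ fst k) * X $ a $ fst l else 0 else 0)"
      unfolding sum_bip_index by (intro sum.cong refl) (auto simp: V_def)
    also have "\<dots> = (if k = l then 1 else 0)" using k l 1[of "fst k" "fst l"]
      by (cases "snd k = snd l") (auto simp: kl simp del: split_pairs)
    finally show "(\<Sum>j\<in>bip_index n. cnj (V j k) * V j l) = (if k = l then 1 else 0)" .
    have "(\<Sum>j\<in>bip_index n. V k j * cnj (V l j)) =
        (\<Sum>a\<in>UNIV. \<Sum>j<n. if j = snd k then if snd k = snd l then X $ fst k $ a * cnj (X $ fst l $ a) else 0 else 0)"
      unfolding sum_bip_index by (intro sum.cong refl) (auto simp: V_def)
    also have "\<dots> = (if k = l then 1 else 0)" using k l 2[of "fst k" "fst l"]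
      by (cases "snd k = snd l") (auto simp: kl simp del: split_pairs)
    finally show "(\<Sum>j\<in>bip_index n. V k j * cnj (V l j)) = (if k = l then 1 else 0)" .
  qed
  moreover have "reduced_state n (bip_apply n V y) = X ** reduced_state n y ** adj X" for y
  proof -
    have app: "bip_apply n V y (a, j) = (\<Sum>c\<in>UNIV. X $ a $ c * y (c, j))" if "j < n" for a j
    proof -
      have "bip_apply n V y (a, j) = (\<Sum>c\<in>UNIV. \<Sum>i<n. if i = j then X $ a $ c * y (c, j) else 0)"
        using that unfolding bip_apply_def sum_bip_index
        by (simp add: V_def if_distrib[of "\<lambda>x. x * _"] cong: if_cong)
      then show ?thesis using that by simp
    qed
    have "reduced_state n (bip_apply n V y) $ a $ b = (X ** reduced_state n y ** adj X) $ a $ b" for a b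
    proof -
      have "reduced_state n (bip_apply n V y) $ a $ b =
          (\<Sum>j<n. \<Sum>c\<in>UNIV. \<Sum>d\<in>UNIV. X $ a $ c * cnj (X $ b $ d) * (y (c, j) * cnj (y (d, j))))"
        unfolding reduced_state_nth by (intro sum.cong refl) (simp add: app sum_product mult_ac)
      also have "\<dots> = (\<Sum>c\<in>UNIV. \<Sum>j<n. \<Sum>d\<in>UNIV. X $ a $ c * cnj (X $ b $ d) * (y (c, j) * cnj (y (d, j))))"
        by (rule sum.swap)
      also have "\<dots> = (\<Sum>c\<in>UNIV. \<Sum>d\<in>UNIV. \<Sum>j<n. X $ a $ c * cnj (X $ b $ d) * (y (c, j) * cnj (y (d, j))))"
        by (rule sum.cong[OF refl], rule sum.swap)
      also have "\<dots> = (\<Sum>c\<in>UNIV. \<Sum>d\<in>UNIV. X $ a $ c * cnj (X $ b $ d) * reduced_state n y $ c $ d)"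
        by (simp add: reduced_state_nth sum_distrib_left)
      also have "\<dots> = (\<Sum>d\<in>UNIV. \<Sum>c\<in>UNIV. X $ a $ c * cnj (X $ b $ d) * reduced_state n y $ c $ d)"
        by (rule sum.swap)
      also have "\<dots> = (X ** reduced_state n y ** adj X) $ a $ b"
        by (simp add: matrix_matrix_mult_def adj_nth sum_distrib_left sum_distrib_right mult_ac)
      finally show ?thesis .
    qed
    then show ?thesis by (simp add: vec_eq_iff)
  qed
  ultimately show ?thesis using that by blast
qed

section \<open>Exponential bounds for the distribution of the reduced state\<close>

lemma fmeasurable_oball: "finite I \<Longrightarrow> oball I t \<in> fmeasurable (cleb I)"
  using emeasure_oball_finite[of I t] by (intro fmeasurableI) auto

lemma measure_oball_pos: "finite I \<Longrightarrow> t > 0 \<Longrightarrow> 0 < measure (cleb I) (oball I t)"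
  using emeasure_oball_pos[of I t] emeasure_oball_finite[of I t]
  by (simp add: measure_def enn2real_positive_iff)

lemma ennreal_less_top_if_mult:
  assumes "x * ennreal p < \<infinity>" "0 < p"
  shows "x < \<infinity>"
proof (rule ccontr)
  assume "\<not> x < \<infinity>"
  then have "x = \<top>" by (simp add: not_less top_unique)
  then show False using assms by (simp add: ennreal_top_mult)
qed

lemma cnorm_scale_restrict: "0 \<le> t \<Longrightarrow> cnorm I (\<lambda>k\<in>I. t *\<^sub>R y k) = t * cnorm I y"
  using cnorm_scaleR[of t I y] cnorm_cong[of I "\<lambda>k\<in>I. t *\<^sub>R y k" "\<lambda>k. t *\<^sub>R y k"] by simp

lemma measure_cleb_bip_scale:
  fixes t :: "'m::finite \<Rightarrow> real"
  assumes t: "\<And>a. t a > 0" and A: "A \<in> sets (cleb (bip_index n))"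
  shows "measure (cleb (bip_index n)) {y \<in> space (cleb (bip_index n)). (\<lambda>k\<in>bip_index n. t (fst k) *\<^sub>R y k) \<in> A} *
    (\<Prod>a\<in>UNIV. (t a)\<^sup>2) ^ n = measure (cleb (bip_index n)) A"
proof -
  let ?I = "bip_index n :: ('m \<times> nat) set"
  have "emeasure (cleb ?I) {y \<in> space (cleb ?I). (\<lambda>k\<in>?I. 0 + t (fst k) *\<^sub>R y k) \<in> A} *
      ennreal (\<Prod>k\<in>?I. (t (fst k))\<^sup>2) = emeasure (cleb ?I) A"
    using t by (intro emeasure_cleb_affine A) auto
  moreover have "(\<Prod>k\<in>?I. (t (fst k))\<^sup>2) = (\<Prod>a\<in>UNIV. \<Prod>j<n. (t a)\<^sup>2)"
    unfolding prod.cartesian_product by (intro prod.cong refl) auto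
  moreover have "\<dots> = (\<Prod>a\<in>UNIV. (t a)\<^sup>2) ^ n" by (simp add: prod_power_distrib)
  ultimately have "emeasure (cleb ?I) {y \<in> space (cleb ?I). (\<lambda>k\<in>?I. t (fst k) *\<^sub>R y k) \<in> A} *
      ennreal ((\<Prod>a\<in>UNIV. (t a)\<^sup>2) ^ n) = emeasure (cleb ?I) A"
    by simp
  from arg_cong[OF this, of enn2real] show ?thesis
    by (simp only: measure_def enn2real_mult enn2real_ennreal zero_le_power prod_nonneg zero_le_power2)
qed

lemma fmeasurable_bip_scale:
  fixes t :: "'m::finite \<Rightarrow> real"
  assumes t: "\<And>a. t a > 0" and A: "A \<in> fmeasurable (cleb (bip_index n))"
  shows "{y \<in> space (cleb (bip_index n)). (\<lambda>k\<in>bip_index n. t (fst k) *\<^sub>R y k) \<in> A} \<in> fmeasurable (cleb (bip_index n))"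
proof (rule fmeasurableI)
  let ?I = "bip_index n :: ('m \<times> nat) set"
  let ?T = "{y \<in> space (cleb ?I). (\<lambda>k\<in>?I. t (fst k) *\<^sub>R y k) \<in> A}"
  have eq: "emeasure (cleb ?I) ?T * ennreal (\<Prod>k\<in>?I. (t (fst k))\<^sup>2) = emeasure (cleb ?I) A"
    using emeasure_cleb_affine[of ?I "\<lambda>k. t (fst k)" A "\<lambda>_. 0"] t A by (simp add: fmeasurableD)
  show "emeasure (cleb ?I) ?T < \<infinity>"
  proof (rule ennreal_less_top_if_mult)
    show "emeasure (cleb ?I) ?T * ennreal (\<Prod>k\<in>?I. (t (fst k))\<^sup>2) < \<infinity>"
      unfolding eq using A by (simp add: fmeasurable_def)
    show "0 < (\<Prod>k\<in>?I. (t (fst k))\<^sup>2)" by (intro prod_pos ballI zero_less_power t)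
  qed
  have "(\<lambda>y. \<lambda>k\<in>?I. t (fst k) *\<^sub>R y k) \<in> measurable (cleb ?I) (cleb ?I)"
    unfolding cleb_def by (intro measurable_restrict) measurable
  from measurable_sets[OF this fmeasurableD[OF A]] show "?T \<in> sets (cleb ?I)"
    by (simp add: vimage_def Int_def conj_commute)
qed

text \<open>The maximum is attained below M, which leaves room for b. Positivity of b is included
  because b becomes the base of a geometric rate, and K may be empty.\<close>

lemma compact_strict_bound:
  fixes f :: "'a::topological_space \<Rightarrow> real"
  assumes "compact K" "continuous_on K f" "\<And>x. x \<in> K \<Longrightarrow> f x < M" "0 < M"
  shows "\<exists>b. 0 < b \<and> b < M \<and> (\<forall>x\<in>K. f x < b)"
proof (cases "K = {}")
  case True
  then show ?thesis using assms(4) by (intro exI[of _ "M / 2"]) simp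
next
  case False
  then obtain x where x: "x \<in> K" "\<And>y. y \<in> K \<Longrightarrow> f y \<le> f x"
    using continuous_attains_sup[OF assms(1) _ assms(2)] by blast
  define b where "b = (max 0 (f x) + M) / 2"
  have "0 < b" "b < M" "f x < b" using assms(3)[OF x(1)] assms(4) by (auto simp: b_def max_def)
  then show ?thesis using x(2) by (intro exI[of _ b]) (auto intro: order.strict_trans1)
qed

section \<open>Upper bounds for the probability of neighbourhoods and compact sets of states\<close>

lemma state_event_diag_upper:
  fixes d :: "'m::finite \<Rightarrow> real" and \<mu> :: "('m \<times> nat \<Rightarrow> complex) measure"
  assumes inv: "unitarily_invariant_prob n \<mu>" and n: "n \<ge> 1" and k: "0 < \<kappa>" "\<kappa> \<le> 1"
    and d: "\<And>a. 0 \<le> d a" "\<And>a. d a \<le> 1"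
  shows "measure \<mu> (state_event n \<mu> {\<rho>. \<forall>a. Re (\<rho> $ a $ a) < d a + \<kappa> / 8}) \<le>
    (\<Prod>a\<in>UNIV. CARD('m) * (d a + \<kappa>)) ^ n"
proof -
  let ?I = "bip_index n :: ('m \<times> nat) set" and ?m = "real CARD('m)"
  let ?R = "\<lambda>y a. Re (reduced_state n y $ a $ a)"
  define E where "E = {\<rho> :: complex ^ 'm ^ 'm. \<forall>a. Re (\<rho> $ a $ a) < d a + \<kappa> / 8}"
  \<comment> \<open>The homogeneous form of the event, with the tolerance widened from \<kappa>/8 to
    \<kappa> so that C contains the smeared event.\<close>
  define C where "C = {y \<in> space (cleb ?I). \<forall>a\<in>UNIV. ?R y a \<le> (d a + \<kappa>) * (cnorm ?I y)\<^sup>2}"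
  \<comment> \<open>On C each of the m blocks, divided by this square root, contributes at most a
    fraction 1/m of the squared norm of y. So the rescaled vector stays in the unit ball. \<kappa> >
    0 keeps the root positive if \<open>d a = 0\<close>.\<close>
  define t where "t a = 1 / sqrt (?m * (d a + \<kappa>))" for a
  have pos: "0 < ?m * (d a + \<kappa>)" for a using d(1)[of a] k by simp
  then have t: "t a > 0" "(t a)\<^sup>2 = 1 / (?m * (d a + \<kappa>))" for a
    by (auto simp: t_def power_divide less_imp_le)
  have "E = (\<Inter>a. {\<rho>. Re (\<rho> $ a $ a) < d a + \<kappa> / 8})" by (auto simp: E_def)
  also have "open \<dots>" by (intro open_INT finite ballI open_Collect_less continuous_intros)
  finally have E: "state_event n \<mu> E \<in> sets \<mu>" by (intro sets_state_event inv borel_open)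
  have C_sets: "C \<in> sets (cleb ?I)"
    unfolding C_def
  proof (intro sets.sets_Collect_finite_All finite)
    fix a
    have "(\<lambda>y. ?R y a) \<in> borel_measurable (cleb ?I)"
      using measurable_reduced_state_nth by (rule borel_measurable_Re[THEN measurable_compose_rev])
    then show "{y \<in> space (cleb ?I). ?R y a \<le> (d a + \<kappa>) * (cnorm ?I y)\<^sup>2} \<in> sets (cleb ?I)"
      by measurable
  qed
  have C: "cone ?I C"
    unfolding cone_def
  proof (intro conjI C_sets ballI allI impI)
    fix y s assume y: "y \<in> space (cleb ?I)" and s: "(s :: real) > 0"
    have "?R (\<lambda>k\<in>?I. s *\<^sub>R y k) a \<le> (d a + \<kappa>) * (cnorm ?I (\<lambda>k\<in>?I. s *\<^sub>R y k))\<^sup>2 \<longleftrightarrow>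
        ?R y a \<le> (d a + \<kappa>) * (cnorm ?I y)\<^sup>2" for a
    proof -
      have "?R (\<lambda>k\<in>?I. s *\<^sub>R y k) a = (s * s) * ?R y a"
        using reduced_state_scale[of n "\<lambda>_. s" y a a] by simp
      moreover have "(d a + \<kappa>) * (cnorm ?I (\<lambda>k\<in>?I. s *\<^sub>R y k))\<^sup>2 = (s * s) * ((d a + \<kappa>) * (cnorm ?I y)\<^sup>2)"
        using s by (simp add: cnorm_scale_restrict power2_eq_square)
      moreover have "0 < s * s" using s by simp
      ultimately show ?thesis by (simp only: mult_le_cancel_left_pos)
    qed
    then show "(\<lambda>k\<in>?I. s *\<^sub>R y k) \<in> C \<longleftrightarrow> y \<in> C" using y by (simp add: C_def space_cleb)
  qed
  have near: "y \<in> C" if x: "x \<in> state_event n \<mu> E" and y: "y \<in> space (cleb ?I)"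
    and xy: "cnorm ?I (\<lambda>k. x k - y k) < \<kappa> / 16" for x y
  proof -
    have cx: "cnorm ?I x = 1" using x space_invariant[OF inv] by (auto simp: state_event_def)
    note near = reduced_state_near_sphere[OF cx xy]
    have "?R y a \<le> (d a + \<kappa>) * (cnorm ?I y)\<^sup>2" for a
    proof -
      have "\<bar>?R x a - ?R y a\<bar> \<le> 3 * (\<kappa> / 16)"
        using near(1)[of a a] abs_Re_le_cmod[of "reduced_state n x $ a $ a - reduced_state n y $ a $ a"] k by simp
      moreover have "?R x a < d a + \<kappa> / 8" using x by (simp add: state_event_def E_def)
      \<comment> \<open>The error budget: \<kappa>/8 from the event, 3 \<kappa>/16 for moving from x
        to y, and twice 3 \<kappa>/16 for the norm of y, as \<open>d a + \<kappa>\<close> is at most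
        2. The total 11 \<kappa>/16 is below \<kappa>.\<close>
      ultimately have "?R y a \<le> d a + \<kappa> / 8 + 3 * (\<kappa> / 16)" by linarith
      also have "\<dots> \<le> d a + \<kappa> - 2 * (3 * (\<kappa> / 16))" using k by simp
      also have "\<dots> \<le> d a + \<kappa> - (d a + \<kappa>) * (3 * (\<kappa> / 16))"
        using d[of a] k by (intro diff_left_mono mult_right_mono) auto
      also have "\<dots> = (d a + \<kappa>) * (1 - 3 * (\<kappa> / 16))" by (simp add: algebra_simps)
      also have "\<dots> \<le> (d a + \<kappa>) * (cnorm ?I y)\<^sup>2"
      proof (intro mult_left_mono)
        have "\<bar>(cnorm ?I y)\<^sup>2 - 1\<bar> \<le> 3 * (\<kappa> / 16)" using near(2) k by simp
        then show "1 - 3 * (\<kappa> / 16) \<le> (cnorm ?I y)\<^sup>2" by linarith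
      qed (use k d[of a] in simp)
      finally show ?thesis .
    qed
    then show ?thesis using y by (simp add: C_def)
  qed
  define B where "B = measure (cleb ?I) (oball ?I 1)"
  have B: "B > 0" unfolding B_def by (intro measure_oball_pos) auto
  let ?T = "{y \<in> space (cleb ?I). (\<lambda>k\<in>?I. t (fst k) *\<^sub>R y k) \<in> oball ?I 1}"
  have T: "measure (cleb ?I) ?T * (\<Prod>a\<in>UNIV. (t a)\<^sup>2) ^ n = B"
    unfolding B_def by (intro measure_cleb_bip_scale t) auto
  have sub: "C \<inter> oball ?I 1 \<subseteq> ?T"
  proof
    fix y assume y: "y \<in> C \<inter> oball ?I 1"
    then have c: "cnorm ?I y < 1" and R: "\<And>a. ?R y a \<le> (d a + \<kappa>) * (cnorm ?I y)\<^sup>2" and sp: "y \<in> space (cleb ?I)"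
      by (auto simp: C_def oball_def)
    let ?ty = "\<lambda>k\<in>?I. t (fst k) *\<^sub>R y k"
    have "(cnorm ?I ?ty)\<^sup>2 = (\<Sum>a\<in>UNIV. (t a)\<^sup>2 * ?R y a)"
      unfolding cnorm_reduced_state reduced_state_scale by (simp add: power2_eq_square)
    also have "\<dots> \<le> (\<Sum>a\<in>(UNIV :: 'm set). (cnorm ?I y)\<^sup>2 / ?m)"
    proof (intro sum_mono)
      fix a
      have "0 < d a + \<kappa>" using d(1)[of a] k by simp
      then show "(t a)\<^sup>2 * ?R y a \<le> (cnorm ?I y)\<^sup>2 / ?m"
        using R[of a] divide_right_mono[of "?R y a / (d a + \<kappa>)" "(cnorm ?I y)\<^sup>2" ?m]
        by (simp add: t(2) pos_divide_le_eq mult.commute)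
    qed
    also have "\<dots> = (cnorm ?I y)\<^sup>2" by simp
    also have "\<dots> < 1" using c by (simp add: power_less_one_iff abs_square_less_1)
    finally have "cnorm ?I ?ty < 1" by (simp add: abs_square_less_1)
    then show "y \<in> ?T" using sp by (simp add: oball_def space_cleb)
  qed
  define P where "P = (\<Prod>a\<in>UNIV. ?m * (d a + \<kappa>))"
  have P: "(\<Prod>a\<in>UNIV. (t a)\<^sup>2) = 1 / P" by (simp only: t(2) prod_dividef P_def) simp
  have "0 < P" unfolding P_def using pos by (intro prod_pos) auto
  have "measure (cleb ?I) (C \<inter> oball ?I 1) \<le> measure (cleb ?I) ?T"
    using C_sets by (intro measure_mono_fmeasurable[OF sub] fmeasurable_bip_scale fmeasurable_oball t) auto
  also have "\<dots> = B * P ^ n"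
    using T \<open>0 < P\<close> by (simp add: P power_one_over field_simps)
  finally have "measure (cleb ?I) (C \<inter> oball ?I 1) \<le> B * P ^ n" .
  moreover have "measure \<mu> (state_event n \<mu> E) * B \<le> measure (cleb ?I) (C \<inter> oball ?I 1)"
    unfolding B_def
  proof (rule invariant_measure_le_cone_real[OF inv n _ E C])
    show "0 < \<kappa> / 16" using k by simp
  qed (rule near)
  ultimately have "measure \<mu> (state_event n \<mu> E) * B \<le> B * P ^ n" by linarith
  then show ?thesis using B by (simp add: E_def P_def mult.commute[of B])
qed

lemma measure_state_event_unitary:
  fixes X :: "complex ^ 'm ^ 'm" and \<mu> :: "('m::finite \<times> nat \<Rightarrow> complex) measure"
  assumes inv: "unitarily_invariant_prob n \<mu>" and X: "unitary X" and A: "A \<in> sets borel"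
  shows "measure \<mu> (state_event n \<mu> {\<rho>. X ** \<rho> ** adj X \<in> A}) = measure \<mu> (state_event n \<mu> A)"
proof -
  obtain V where V: "bip_unitary n V"
    "\<And>y. reduced_state n (bip_apply n V y) = X ** reduced_state n y ** adj X"
    using reduced_state_local_unitary[OF X, of n] by metis
  have "{x \<in> space \<mu>. bip_apply n V x \<in> state_event n \<mu> A} = state_event n \<mu> {\<rho>. X ** \<rho> ** adj X \<in> A}"
    using measurable_space[OF measurable_bip_apply[OF inv V(1)]] by (auto simp: state_event_def V(2))
  then show ?thesis
    using emeasure_bip_apply[OF inv V(1) sets_state_event[OF inv A]] by (simp add: measure_def)
qed

lemma unitary_conj_cancel:
  assumes "unitary U"
  shows "adj U ** (U ** A ** adj U) ** U = A"
proof -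
  have "adj U ** (U ** A ** adj U) ** U = (adj U ** U) ** A ** (adj U ** U)"
    by (simp add: matrix_mul_assoc)
  then show ?thesis using assms by (simp add: unitary_def)
qed

lemma norm_unitary_conj_diff:
  assumes "unitary U"
  shows "norm (\<rho> - U ** A ** adj U) = norm (adj U ** \<rho> ** U - A)"
proof -
  have "adj U ** (\<rho> - U ** A ** adj U) ** U = adj U ** \<rho> ** U - adj U ** (U ** A ** adj U) ** U"
    by (simp add: vec_eq_iff matrix_matrix_mult_def algebra_simps sum_subtractf sum_distrib_left sum_distrib_right)
  then show ?thesis
    using norm_unitary_conj[OF unitary_adj[OF assms], of "\<rho> - U ** A ** adj U"]
    by (simp add: unitary_conj_cancel[OF assms])
qed

lemma cmod_nth_le_norm: "cmod (A $ a $ b) \<le> norm A" for A :: "complex ^ 'm ^ 'm"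
  by (rule order.trans[OF Finite_Cartesian_Product.norm_nth_le Finite_Cartesian_Product.norm_nth_le])

lemma norm_less_if_nth_less:
  fixes A :: "complex ^ 'm ^ 'm"
  assumes "\<And>a b. cmod (A $ a $ b) < s / (real CARD('m))\<^sup>2"
  shows "norm A < s"
proof -
  have "norm A \<le> (\<Sum>a\<in>UNIV. \<Sum>b\<in>UNIV. cmod (A $ a $ b))"
    unfolding norm_vec_def[of A]
    by (intro order.trans[OF L2_set_le_sum] sum_mono) (auto simp: norm_vec_def intro: L2_set_le_sum)
  also have "\<dots> < (\<Sum>a\<in>(UNIV :: 'm set). \<Sum>b\<in>(UNIV :: 'm set). s / (real CARD('m))\<^sup>2)"
    using assms by (intro sum_strict_mono) auto
  also have "\<dots> = s" by (simp add: power2_eq_square)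
  finally show ?thesis .
qed

text \<open>Continuity of the product in the eigenvalues leaves room for a shift k > 0 that keeps it
  below b. The radius k/8 is the tolerance of the diagonal estimate and depends on \<rho> and b
  alone, not on n.\<close>

lemma state_event_ball_upper:
  fixes \<rho> :: "complex ^ 'm ^ 'm"
  assumes \<rho>: "\<rho> \<in> density_ops" and b: "Re (det \<rho>) < b"
  shows "\<exists>s>0. \<forall>n\<ge>1. \<forall>\<mu>. unitarily_invariant_prob n \<mu> \<longrightarrow>
    measure \<mu> (state_event n \<mu> (ball \<rho> s)) \<le> (real CARD('m) ^ CARD('m) * b) ^ n"
proof -
  let ?m = "real CARD('m)"
  obtain U d where U: "unitary U" and \<rho>_eq: "\<rho> = U ** diag_real d ** adj U"
    and d: "\<forall>i. 0 \<le> d i" "(\<Sum>i\<in>UNIV. d i) = 1"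
    using density_ops_diagonalization[OF \<rho>] .
  have d1: "d i \<le> 1" for i using member_le_sum[of i UNIV d] d by simp
  have "((\<lambda>k. \<Prod>i\<in>UNIV. d i + k) \<longlongrightarrow> (\<Prod>i\<in>UNIV. d i + 0)) (at_right 0)"
    by (intro tendsto_intros)
  moreover have "(\<Prod>i\<in>UNIV. d i + 0) < b"
    using b by (simp add: \<rho>_eq det_unitary_diag[OF U] del: of_real_prod)
  ultimately have "\<forall>\<^sub>F k in at_right 0. (\<Prod>i\<in>UNIV. d i + k) < b"
    by (rule order_tendstoD(2))
  moreover have "\<forall>\<^sub>F k in at_right 0. k < (1 :: real)"
    by (rule eventually_at_rightI[of 0 1]) auto
  moreover have "\<forall>\<^sub>F k in at_right 0. (0 :: real) < k" by (rule eventually_at_right_less)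
  ultimately have "\<forall>\<^sub>F k in at_right (0 :: real). (\<Prod>i\<in>UNIV. d i + k) < b \<and> k < 1 \<and> 0 < k"
    by (intro eventually_conj)
  then obtain k where k: "(\<Prod>i\<in>UNIV. d i + k) < b" "k < 1" "0 < k"
    using eventually_happens'[of "at_right (0 :: real)"] by auto
  have bound: "measure \<mu> (state_event n \<mu> (ball \<rho> (k / 8))) \<le> (real CARD('m) ^ CARD('m) * b) ^ n"
    if n: "n \<ge> 1" and inv: "unitarily_invariant_prob n \<mu>" for n \<mu>
  proof -
    interpret prob_space \<mu> using inv by (simp add: unitarily_invariant_prob_def)
    define E where "E = {\<sigma> :: complex ^ 'm ^ 'm. \<forall>a. Re (\<sigma> $ a $ a) < d a + k / 8}"
    have "E = (\<Inter>a. {\<sigma>. Re (\<sigma> $ a $ a) < d a + k / 8})" by (auto simp: E_def)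
    also have "open \<dots>" by (intro open_INT finite ballI open_Collect_less continuous_intros)
    finally have E: "E \<in> sets borel" by (rule borel_open)
    have sub: "ball \<rho> (k / 8) \<subseteq> {\<sigma>. adj U ** \<sigma> ** adj (adj U) \<in> E}"
    proof
      fix \<sigma> assume "\<sigma> \<in> ball \<rho> (k / 8)"
      then have lt: "norm (adj U ** \<sigma> ** U - diag_real d) < k / 8"
        using norm_unitary_conj_diff[OF U, of \<sigma> "diag_real d"]
        by (simp add: \<rho>_eq dist_norm norm_minus_commute)
      have "Re ((adj U ** \<sigma> ** U) $ a $ a) < d a + k / 8" for a
      proof -
        have "Re ((adj U ** \<sigma> ** U - diag_real d) $ a $ a) < k / 8"
          using lt cmod_nth_le_norm[of "adj U ** \<sigma> ** U - diag_real d" a a]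
            complex_Re_le_cmod[of "(adj U ** \<sigma> ** U - diag_real d) $ a $ a"] by linarith
        then show ?thesis by (simp add: diag_real_def)
      qed
      then show "\<sigma> \<in> {\<sigma>. adj U ** \<sigma> ** adj (adj U) \<in> E}" by (simp add: E_def)
    qed
    have "measure \<mu> (state_event n \<mu> (ball \<rho> (k / 8))) \<le>
        measure \<mu> (state_event n \<mu> {\<sigma>. adj U ** \<sigma> ** adj (adj U) \<in> E})"
    proof (rule finite_measure_mono)
      show "state_event n \<mu> (ball \<rho> (k / 8)) \<subseteq> state_event n \<mu> {\<sigma>. adj U ** \<sigma> ** adj (adj U) \<in> E}"
        using sub by (auto simp: state_event_def)
      have "continuous_on UNIV (\<lambda>\<sigma> :: complex ^ 'm ^ 'm. adj U ** \<sigma> ** adj (adj U))"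
        unfolding matrix_matrix_mult_def by (intro continuous_on_vec_lambda continuous_intros)
      then have "(\<lambda>\<sigma> :: complex ^ 'm ^ 'm. adj U ** \<sigma> ** adj (adj U)) \<in> borel_measurable borel"
        by (rule borel_measurable_continuous_onI)
      from measurable_sets[OF this E]
      show "state_event n \<mu> {\<sigma>. adj U ** \<sigma> ** adj (adj U) \<in> E} \<in> events"
        by (intro sets_state_event inv) (simp add: vimage_def)
    qed
    also have "\<dots> = measure \<mu> (state_event n \<mu> E)"
      by (rule measure_state_event_unitary[OF inv unitary_adj[OF U] E])
    also have "\<dots> \<le> (\<Prod>a\<in>UNIV. ?m * (d a + k)) ^ n"
      unfolding E_def using d(1) d1 k by (intro state_event_diag_upper inv n) auto
    also have "\<dots> \<le> (?m ^ CARD('m) * b) ^ n"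
      using k d(1) by (intro power_mono) (auto simp: prod.distrib intro!: mult_nonneg_nonneg prod_nonneg)
    finally show ?thesis by simp
  qed
  show ?thesis
    by (intro exI[of _ "k / 8"] conjI allI impI bound) (simp_all add: k)
qed

text \<open>c is the number of balls in a finite subcover of K, which does not depend on n.\<close>

lemma state_event_compact_upper:
  fixes K :: "(complex ^ 'm ^ 'm) set"
  assumes K: "compact K" "K \<subseteq> density_ops" and b: "\<And>\<rho>. \<rho> \<in> K \<Longrightarrow> Re (det \<rho>) < b"
  shows "\<exists>c::nat. \<forall>n\<ge>1. \<forall>\<mu>. unitarily_invariant_prob n \<mu> \<longrightarrow>
    measure \<mu> (state_event n \<mu> K) \<le> c * (real CARD('m) ^ CARD('m) * b) ^ n"
proof -
  have "\<forall>\<rho>\<in>K. \<exists>s>0. \<forall>n\<ge>1. \<forall>\<mu>. unitarily_invariant_prob n \<mu> \<longrightarrow>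
      measure \<mu> (state_event n \<mu> (ball \<rho> s)) \<le> (real CARD('m) ^ CARD('m) * b) ^ n"
    by (rule ballI, rule state_event_ball_upper[OF subsetD[OF K(2)] b])
  from bchoice[OF this] obtain s where *: "\<forall>\<rho>\<in>K. s \<rho> > 0 \<and> (\<forall>n\<ge>1. \<forall>\<mu>. unitarily_invariant_prob n \<mu> \<longrightarrow>
      measure \<mu> (state_event n \<mu> (ball \<rho> (s \<rho>))) \<le> (real CARD('m) ^ CARD('m) * b) ^ n)" ..
  have s: "s \<rho> > 0" if "\<rho> \<in> K" for \<rho>
    using bspec[OF * that] by (rule conjunct1)
  have le: "measure \<mu> (state_event n \<mu> (ball \<rho> (s \<rho>))) \<le> (real CARD('m) ^ CARD('m) * b) ^ n"
    if "\<rho> \<in> K" "n \<ge> 1" "unitarily_invariant_prob n \<mu>" for \<rho> n \<mu>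
    using bspec[OF * that(1), THEN conjunct2] that(2,3) by simp
  have "K \<subseteq> (\<Union>\<rho>\<in>K. ball \<rho> (s \<rho>))" using s by force
  then obtain F where F: "F \<subseteq> K" "finite F" "K \<subseteq> (\<Union>\<rho>\<in>F. ball \<rho> (s \<rho>))"
    by (rule compactE_image[OF K(1), rotated]) auto
  have "measure \<mu> (state_event n \<mu> K) \<le> card F * (real CARD('m) ^ CARD('m) * b) ^ n"
    if n: "n \<ge> 1" and inv: "unitarily_invariant_prob n \<mu>" for n \<mu>
  proof -
    interpret prob_space \<mu> using inv by (simp add: unitarily_invariant_prob_def)
    have ev: "state_event n \<mu> (ball \<rho> (s \<rho>)) \<in> events" for \<rho> by (intro sets_state_event inv) simp
    have "measure \<mu> (state_event n \<mu> K) \<le> measure \<mu> (\<Union>\<rho>\<in>F. state_event n \<mu> (ball \<rho> (s \<rho>)))"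
      using F(3) by (intro finite_measure_mono sets.finite_UN F(2) ev) (unfold state_event_def, blast)
    also have "\<dots> \<le> (\<Sum>\<rho>\<in>F. measure \<mu> (state_event n \<mu> (ball \<rho> (s \<rho>))))"
      using ev by (intro finite_measure_subadditive_finite F(2)) auto
    also have "\<dots> \<le> (\<Sum>\<rho>\<in>F. (real CARD('m) ^ CARD('m) * b) ^ n)"
      using F(1) by (intro sum_mono le n inv) auto
    finally show ?thesis by simp
  qed
  then show ?thesis by blast
qed

text \<open>Compactness turns the strict determinant inequality away from \<pi> into one ratio q < 1
  for the whole complement, so the probability of the complement is at most c q^n and tends to 0.
  Any fixed positive share would serve as well as 1/2, since it only contributes a constant
  factor.\<close>

lemma concentration_near_max_mixed:
  assumes "0 < s"
  shows "\<exists>N. \<forall>n\<ge>N. \<forall>\<mu> :: ('m::finite \<times> nat \<Rightarrow> complex) measure. unitarily_invariant_prob n \<mu> \<longrightarrow>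
    1 / 2 \<le> measure \<mu> (state_event n \<mu> {\<rho>. \<forall>a b. cmod (\<rho> $ a $ b - diag_real (\<lambda>_. 1 / CARD('m)) $ a $ b) < s})"
proof -
  let ?m = "real CARD('m)"
  define \<pi> :: "complex ^ 'm ^ 'm" where "\<pi> = diag_real (\<lambda>_. 1 / ?m)"
  have \<pi>: "\<pi> = max_mixed" by (simp add: \<pi>_def max_mixed_def diag_real_def mat_def vec_eq_iff)
  define G where "G = {\<rho> :: complex ^ 'm ^ 'm. \<forall>a b. cmod (\<rho> $ a $ b - \<pi> $ a $ b) < s}"
  define K where "K = density_ops - G"
  have "G = (\<Inter>a. \<Inter>b. {\<rho>. cmod (\<rho> $ a $ b - \<pi> $ a $ b) < s})" by (auto simp: G_def)
  moreover have "open \<dots>" by (intro open_INT finite ballI open_Collect_less continuous_intros)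
  ultimately have G: "open G" by simp
  then have K: "compact K" unfolding K_def by (intro compact_diff compact_density_ops)
  have lt: "Re (det \<rho>) < (1 / ?m) ^ CARD('m)" if "\<rho> \<in> K" for \<rho>
    using that assms by (intro Re_det_density_less) (auto simp: K_def G_def \<pi>)
  have "0 < (1 / ?m) ^ CARD('m)" by simp
  then obtain b where b: "0 < b" "b < (1 / ?m) ^ CARD('m)" "\<forall>\<rho>\<in>K. Re (det \<rho>) < b"
    using compact_strict_bound[OF K continuous_on_det lt] by blast
  have "K \<subseteq> density_ops" by (auto simp: K_def)
  from state_event_compact_upper[OF K this bspec[OF b(3)]]
  obtain c :: nat where c: "\<forall>n\<ge>1. \<forall>\<mu>. unitarily_invariant_prob n \<mu> \<longrightarrow>
      measure \<mu> (state_event n \<mu> K) \<le> c * (?m ^ CARD('m) * b) ^ n"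
    by blast
  define q where "q = ?m ^ CARD('m) * b"
  have q: "0 \<le> q" "q < 1" using b by (auto simp: q_def power_one_over field_simps)
  have "(\<lambda>n. c * q ^ n) \<longlonglongrightarrow> real c * 0"
    using q by (intro tendsto_mult tendsto_const LIMSEQ_power_zero) simp
  then have "\<forall>\<^sub>F n in sequentially. c * q ^ n < 1 / 2" by (intro order_tendstoD(2)) auto
  then obtain N where N: "\<And>n. n \<ge> N \<Longrightarrow> c * q ^ n < 1 / 2" by (auto simp: eventually_sequentially)
  have "1 / 2 \<le> measure \<mu> (state_event n \<mu> G)"
    if n: "n \<ge> max 1 N" and inv: "unitarily_invariant_prob n \<mu>" for n \<mu>
  proof -
    interpret prob_space \<mu> using inv by (simp add: unitarily_invariant_prob_def)
    have GE: "state_event n \<mu> G \<in> events" and KE: "state_event n \<mu> K \<in> events"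
      by (intro sets_state_event inv borel_open G, intro sets_state_event inv borel_closed compact_imp_closed K)
    have "space \<mu> - state_event n \<mu> G \<subseteq> state_event n \<mu> K"
      using reduced_state_density_ops space_invariant[OF inv] by (auto simp: state_event_def K_def)
    then have "measure \<mu> (space \<mu> - state_event n \<mu> G) \<le> measure \<mu> (state_event n \<mu> K)"
      by (intro finite_measure_mono KE)
    also have "\<dots> \<le> c * q ^ n" using c inv n by (simp add: q_def)
    also have "\<dots> < 1 / 2" using N[of n] n by simp
    finally show ?thesis by (simp add: prob_compl[OF GE])
  qed
  then show ?thesis unfolding G_def \<pi>_def by blast
qed

section \<open>Lower bounds for the probability of neighbourhoods of states\<close>

definition near_cone :: "nat \<Rightarrow> ('m::finite \<Rightarrow> real) \<Rightarrow> real \<Rightarrow> ('m \<times> nat \<Rightarrow> complex) set" where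
  "near_cone n d s = {y \<in> space (cleb (bip_index n)). \<forall>a b.
     cmod (reduced_state n y $ a $ b - of_real ((cnorm (bip_index n) y)\<^sup>2) * diag_real d $ a $ b) <
       s * (cnorm (bip_index n) y)\<^sup>2}"

text \<open>Both sides of the defining inequality are homogeneous of degree 2 in y. For a unit
  vector it says that the reduced state is entrywise within s of the diagonal matrix of d.\<close>

lemma cone_near_cone: "cone (bip_index n) (near_cone n d s)"
proof -
  let ?I = "bip_index n :: ('a \<times> nat) set"
  have sets: "near_cone n d s \<in> sets (cleb ?I)"
  proof -
    have "near_cone n d s = {y \<in> space (cleb ?I). \<forall>a\<in>UNIV. \<forall>b\<in>UNIV.
        cmod (reduced_state n y $ a $ b - of_real ((cnorm ?I y)\<^sup>2) * diag_real d $ a $ b) < s * (cnorm ?I y)\<^sup>2}"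
      by (auto simp: near_cone_def)
    also have "\<dots> \<in> sets (cleb ?I)"
    proof (intro sets.sets_Collect_finite_All finite)
      fix a b
      note measurable_reduced_state_nth[of n a b, measurable]
      show "{y \<in> space (cleb ?I). cmod (reduced_state n y $ a $ b - of_real ((cnorm ?I y)\<^sup>2) * diag_real d $ a $ b)
          < s * (cnorm ?I y)\<^sup>2} \<in> sets (cleb ?I)"
        by measurable
    qed
    finally show ?thesis .
  qed
  have "(\<lambda>k\<in>?I. t *\<^sub>R y k) \<in> near_cone n d s \<longleftrightarrow> y \<in> near_cone n d s"
    if y: "y \<in> space (cleb ?I)" and t: "t > 0" for y t
  proof -
    let ?ty = "\<lambda>k\<in>?I. t *\<^sub>R y k"
    have "cmod (reduced_state n ?ty $ a $ b - of_real ((cnorm ?I ?ty)\<^sup>2) * diag_real d $ a $ b) < s * (cnorm ?I ?ty)\<^sup>2 \<longleftrightarrow>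
        cmod (reduced_state n y $ a $ b - of_real ((cnorm ?I y)\<^sup>2) * diag_real d $ a $ b) < s * (cnorm ?I y)\<^sup>2" for a b
    proof -
      have c: "(cnorm ?I ?ty)\<^sup>2 = t\<^sup>2 * (cnorm ?I y)\<^sup>2"
        using t by (simp add: cnorm_scale_restrict power_mult_distrib)
      have "reduced_state n ?ty $ a $ b - of_real ((cnorm ?I ?ty)\<^sup>2) * diag_real d $ a $ b =
          of_real (t\<^sup>2) * (reduced_state n y $ a $ b - of_real ((cnorm ?I y)\<^sup>2) * diag_real d $ a $ b)"
        using reduced_state_scale[of n "\<lambda>_. t" y a b] unfolding c
        by (simp add: power2_eq_square algebra_simps)
      then have "cmod (reduced_state n ?ty $ a $ b - of_real ((cnorm ?I ?ty)\<^sup>2) * diag_real d $ a $ b) =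
          t\<^sup>2 * cmod (reduced_state n y $ a $ b - of_real ((cnorm ?I y)\<^sup>2) * diag_real d $ a $ b)"
        by (simp only: norm_mult norm_of_real abs_power2)
      moreover have "s * (cnorm ?I ?ty)\<^sup>2 = t\<^sup>2 * (s * (cnorm ?I y)\<^sup>2)" by (simp add: c)
      moreover have "0 < t\<^sup>2" using t by simp
      ultimately show ?thesis by (simp only: mult_less_cancel_left_pos)
    qed
    then show ?thesis using y by (simp add: near_cone_def space_cleb)
  qed
  then show ?thesis using sets by (simp add: cone_def)
qed

lemma norm_triangle_three: "norm (u + v + w) \<le> norm u + norm v + norm w"
  using norm_triangle_ineq[of "u + v" w] norm_triangle_ineq[of u v] by linarith

text \<open>Smearing by s/24 moves entries and squared norm by at most s/8. The first part sends a
  small event into a larger cone; the second, used in contrapositive form, sends the complement of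
  an event into the complement of a smaller cone. The error sums are s/2, against s times a squared
  norm of at least 7/8, and 3 s/4.\<close>

lemma near_cone_near_sphere:
  fixes d :: "'m::finite \<Rightarrow> real"
  assumes s: "0 < s" "s \<le> 1" and d: "\<And>a. 0 \<le> d a" "\<And>a. d a \<le> 1"
    and x: "cnorm (bip_index n) x = 1" and xy: "cnorm (bip_index n) (\<lambda>k. x k - y k) < s / 24"
  shows "y \<in> space (cleb (bip_index n)) \<Longrightarrow>
      \<forall>a b. cmod (reduced_state n x $ a $ b - diag_real d $ a $ b) < s / 4 \<Longrightarrow> y \<in> near_cone n d s"
    and "y \<in> near_cone n d (s / 4) \<Longrightarrow> cmod (reduced_state n x $ a $ b - diag_real d $ a $ b) < s"
proof -
  let ?c2 = "(cnorm (bip_index n) y)\<^sup>2"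
  have R: "cmod (reduced_state n x $ a $ b - reduced_state n y $ a $ b) \<le> s / 8" for a b
    using reduced_state_near_sphere(1)[OF x xy, of a b] s by simp
  have c2: "\<bar>?c2 - 1\<bar> \<le> s / 8" using reduced_state_near_sphere(2)[OF x xy] s by simp
  have D: "cmod (of_real ?c2 * diag_real d $ a $ b - diag_real d $ a $ b) \<le> s / 8" for a b
  proof -
    have "of_real ?c2 * diag_real d $ a $ b - diag_real d $ a $ b = of_real (?c2 - 1) * diag_real d $ a $ b"
      by (simp add: algebra_simps)
    then have "cmod (of_real ?c2 * diag_real d $ a $ b - diag_real d $ a $ b) = \<bar>?c2 - 1\<bar> * cmod (diag_real d $ a $ b)"
      by (simp only: norm_mult norm_of_real)
    also have "\<dots> \<le> s / 8 * 1"
      using c2 d[of a] s by (intro mult_mono) (auto simp: diag_real_def)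
    finally show ?thesis by simp
  qed
  show "y \<in> near_cone n d s" if y: "y \<in> space (cleb (bip_index n))"
    and lt: "\<forall>a b. cmod (reduced_state n x $ a $ b - diag_real d $ a $ b) < s / 4"
  proof -
    have "cmod (reduced_state n y $ a $ b - of_real ?c2 * diag_real d $ a $ b) < s * ?c2" for a b
    proof -
      have "reduced_state n y $ a $ b - of_real ?c2 * diag_real d $ a $ b =
          - (reduced_state n x $ a $ b - reduced_state n y $ a $ b) +
          (reduced_state n x $ a $ b - diag_real d $ a $ b) +
          - (of_real ?c2 * diag_real d $ a $ b - diag_real d $ a $ b)"
        by simp
      then have "cmod (reduced_state n y $ a $ b - of_real ?c2 * diag_real d $ a $ b) \<le>
          cmod (reduced_state n x $ a $ b - reduced_state n y $ a $ b) +
          cmod (reduced_state n x $ a $ b - diag_real d $ a $ b) +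
          cmod (of_real ?c2 * diag_real d $ a $ b - diag_real d $ a $ b)"
        using norm_triangle_three by (metis norm_minus_cancel)
      also have "\<dots> < s / 8 + s / 4 + s / 8"
        using R[of a b] lt[rule_format, of a b] D[of a b] by linarith
      also have "\<dots> = s * (1 / 2)" by simp
      also have "\<dots> \<le> s * ?c2" using c2 s by (intro mult_left_mono) linarith+
      finally show ?thesis .
    qed
    then show ?thesis using y by (simp add: near_cone_def)
  qed
  show "cmod (reduced_state n x $ a $ b - diag_real d $ a $ b) < s" if "y \<in> near_cone n d (s / 4)"
  proof -
    have lt: "cmod (reduced_state n y $ a $ b - of_real ?c2 * diag_real d $ a $ b) < s / 4 * ?c2"
      using that unfolding near_cone_def by blast
    have "reduced_state n x $ a $ b - diag_real d $ a $ b =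
        (reduced_state n x $ a $ b - reduced_state n y $ a $ b) +
        (reduced_state n y $ a $ b - of_real ?c2 * diag_real d $ a $ b) +
        (of_real ?c2 * diag_real d $ a $ b - diag_real d $ a $ b)"
      by simp
    then have "cmod (reduced_state n x $ a $ b - diag_real d $ a $ b) \<le>
        cmod (reduced_state n x $ a $ b - reduced_state n y $ a $ b) +
        cmod (reduced_state n y $ a $ b - of_real ?c2 * diag_real d $ a $ b) +
        cmod (of_real ?c2 * diag_real d $ a $ b - diag_real d $ a $ b)"
      using norm_triangle_three by metis
    also have "\<dots> < s / 8 + s / 4 * ?c2 + s / 8"
      using R[of a b] lt D[of a b] by linarith
    also have "\<dots> \<le> s / 8 + s / 4 * 2 + s / 8"
      using c2 s by (intro add_mono mult_left_mono order.refl) linarith+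
    also have "\<dots> \<le> s" using s by simp
    finally show ?thesis .
  qed
qed

text \<open>Here concentration passes from the sphere to the ball: the conclusion concerns Lebesgue
  measure alone, and \<mu> is the invariant measure it is transferred from.\<close>

lemma near_cone_max_mixed_lower:
  assumes s: "0 < s" "s \<le> 1"
  shows "\<exists>N. \<forall>n\<ge>N. \<forall>\<mu> :: ('m::finite \<times> nat \<Rightarrow> complex) measure. unitarily_invariant_prob n \<mu> \<longrightarrow>
    measure (cleb (bip_index n)) (oball (bip_index n :: ('m \<times> nat) set) 1) / 2 \<le>
    measure (cleb (bip_index n)) (near_cone n (\<lambda>_ :: 'm. 1 / CARD('m)) s \<inter> oball (bip_index n) 1)"
proof -
  let ?d = "\<lambda>_ :: 'm. 1 / real CARD('m)"
  define G where "G = {\<rho> :: complex ^ 'm ^ 'm. \<forall>a b. cmod (\<rho> $ a $ b - diag_real ?d $ a $ b) < s / 4}"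
  obtain N where N: "\<And>n \<mu>. n \<ge> N \<Longrightarrow> unitarily_invariant_prob n \<mu> \<Longrightarrow> 1 / 2 \<le> measure \<mu> (state_event n \<mu> G)"
    using concentration_near_max_mixed[of "s / 4", where 'm = 'm] s unfolding G_def by auto
  have "G = (\<Inter>a. \<Inter>b. {\<rho>. cmod (\<rho> $ a $ b - diag_real ?d $ a $ b) < s / 4})" by (auto simp: G_def)
  moreover have "open \<dots>" by (intro open_INT finite ballI open_Collect_less continuous_intros)
  ultimately have G: "G \<in> sets borel" by simp
  have "measure (cleb (bip_index n)) (oball (bip_index n :: ('m \<times> nat) set) 1) / 2 \<le>
      measure (cleb (bip_index n)) (near_cone n ?d s \<inter> oball (bip_index n) 1)"
    if n: "n \<ge> max 1 N" and inv: "unitarily_invariant_prob n \<mu>" for n and \<mu> :: "('m \<times> nat \<Rightarrow> complex) measure"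
  proof -
    let ?I = "bip_index n :: ('m \<times> nat) set"
    have n1: "n \<ge> 1" "n \<ge> N" using n by auto
    have "y \<in> near_cone n ?d s"
      if "x \<in> state_event n \<mu> G" "y \<in> space (cleb ?I)" "cnorm ?I (\<lambda>k. x k - y k) < s / 24" for x y
      using that space_invariant[OF inv] s
      by (intro near_cone_near_sphere(1)[OF s, of ?d n x y]) (auto simp: state_event_def G_def)
    then have "measure \<mu> (state_event n \<mu> G) * measure (cleb ?I) (oball ?I 1) \<le>
        measure (cleb ?I) (near_cone n ?d s \<inter> oball ?I 1)"
      using s by (intro invariant_measure_le_cone_real[OF inv n1(1), of "s / 24"]
          sets_state_event[OF inv G] cone_near_cone) auto
    moreover have "1 / 2 * measure (cleb ?I) (oball ?I 1) \<le> measure \<mu> (state_event n \<mu> G) * measure (cleb ?I) (oball ?I 1)"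
      using N[OF n1(2) inv] by (intro mult_right_mono) auto
    ultimately show ?thesis by linarith
  qed
  then show ?thesis by blast
qed

text \<open>The blockwise rescaling is applied to the cone around \<pi>, which fills at least half
  of the ball. Its image lies in the cone around the diagonal matrix of d, whose share of the ball
  is thereby bounded below; the comparison theorem for the complement then gives the bound for
  \<mu>.\<close>

lemma state_event_diag_lower:
  fixes d :: "'m::finite \<Rightarrow> real"
  assumes d: "\<And>a. 0 < d a" "(\<Sum>a\<in>UNIV. d a) = 1" and s: "0 < s" "s \<le> 1" and b: "0 \<le> b" "b < (\<Prod>a\<in>UNIV. d a)"
  shows "\<exists>N. \<forall>n\<ge>N. \<forall>\<mu>. unitarily_invariant_prob n \<mu> \<longrightarrow>
    (real CARD('m) ^ CARD('m) * b) ^ n / 2 \<le>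
    measure \<mu> (state_event n \<mu> {\<rho>. \<forall>a b. cmod (\<rho> $ a $ b - diag_real d $ a $ b) < s})"
proof -
  let ?m = "real CARD('m)"
  let ?p = "\<lambda>_ :: 'm. 1 / ?m"
  define G where "G = {\<rho> :: complex ^ 'm ^ 'm. \<forall>a b. cmod (\<rho> $ a $ b - diag_real d $ a $ b) < s}"
  have "G = (\<Inter>a. \<Inter>b. {\<rho>. cmod (\<rho> $ a $ b - diag_real d $ a $ b) < s})" by (auto simp: G_def)
  moreover have "open \<dots>" by (intro open_INT finite ballI open_Collect_less continuous_intros)
  ultimately have G: "G \<in> sets borel" by simp
  have d1: "d i \<le> 1" for i using member_le_sum[of i UNIV d] d by (simp add: less_imp_le)
  have "((\<lambda>k. (\<Prod>a\<in>UNIV. d a) / (1 + ?m * k) ^ CARD('m)) \<longlongrightarrow> (\<Prod>a\<in>UNIV. d a) / (1 + ?m * 0) ^ CARD('m)) (at_right 0)"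
    by (intro tendsto_intros) auto
  then have "\<forall>\<^sub>F k in at_right 0. b < (\<Prod>a\<in>UNIV. d a) / (1 + ?m * k) ^ CARD('m)"
    using b by (intro order_tendstoD(1)) auto
  moreover have "\<forall>\<^sub>F k in at_right 0. k < s / (16 * ?m)"
    using s by (intro eventually_at_rightI[of 0 "s / (16 * ?m)"]) auto
  moreover have "\<forall>\<^sub>F k in at_right 0. (0 :: real) < k" by (rule eventually_at_right_less)
  ultimately have "\<forall>\<^sub>F k in at_right (0 :: real). b < (\<Prod>a\<in>UNIV. d a) / (1 + ?m * k) ^ CARD('m) \<and> k < s / (16 * ?m) \<and> 0 < k"
    by (intro eventually_conj)
  \<comment> \<open>k is the width of the cone around \<pi>. The first condition keeps the loss in
    the determinant from pushing the rate below b, the second keeps the distortion below the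
    tolerance s.\<close>
  then obtain k where k: "b < (\<Prod>a\<in>UNIV. d a) / (1 + ?m * k) ^ CARD('m)" "k < s / (16 * ?m)" "0 < k"
    using eventually_happens'[of "at_right (0 :: real)"] by auto
  have mk: "?m * k < s / 16" using k(2) by (simp add: field_simps)
  have k1: "k \<le> 1"
  proof -
    have "k * 1 \<le> ?m * k" using k(3) by (simp add: Suc_leI)
    then show ?thesis using mk s by linarith
  qed
  \<comment> \<open>Rescaling by \<open>sqrt (m * d a)\<close> alone can enlarge the squared norm by
    a factor up to 1 + m k on the cone. The contraction \<tau> compensates for this, so that the
    image remains in the unit ball.\<close>
  define \<tau> where "\<tau> = 1 / (1 + ?m * k)"
  have \<tau>: "0 < \<tau>" "\<tau> \<le> 1" "\<tau> * (1 + ?m * k) = 1" 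
  proof -
    have "0 < ?m * k" using k(3) by simp
    then show "0 < \<tau>" "\<tau> \<le> 1" "\<tau> * (1 + ?m * k) = 1" by (simp_all add: \<tau>_def)
  qed
  define t where "t a = sqrt (\<tau> * (?m * d a))" for a
  have t: "t a > 0" and t2: "(t a)\<^sup>2 = \<tau> * (?m * d a)" for a
    using \<tau> d(1)[of a] by (auto simp: t_def)
  have T: "?m ^ CARD('m) * b \<le> (\<Prod>a\<in>UNIV. (t a)\<^sup>2)"
  proof -
    have eq: "(\<Prod>a\<in>UNIV. (t a)\<^sup>2) = ?m ^ CARD('m) * ((\<Prod>a\<in>UNIV. d a) / (1 + ?m * k) ^ CARD('m))"
      by (simp add: t2 prod.distrib prod_dividef \<tau>_def)
    show ?thesis unfolding eq using k(1) by (intro mult_left_mono) auto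
  qed
  obtain N where N: "\<And>n \<mu>. n \<ge> N \<Longrightarrow> unitarily_invariant_prob n (\<mu> :: ('m \<times> nat \<Rightarrow> complex) measure) \<Longrightarrow>
      measure (cleb (bip_index n)) (oball (bip_index n :: ('m \<times> nat) set) 1) / 2 \<le>
      measure (cleb (bip_index n)) (near_cone n ?p k \<inter> oball (bip_index n) 1)"
    using near_cone_max_mixed_lower[OF k(3) k1, where 'm = 'm] by auto
  have "(?m ^ CARD('m) * b) ^ n / 2 \<le> measure \<mu> (state_event n \<mu> G)"
    if n: "n \<ge> max 1 N" and inv: "unitarily_invariant_prob n \<mu>" for n \<mu>
  proof -
    interpret prob_space \<mu> using inv by (simp add: unitarily_invariant_prob_def)
    let ?I = "bip_index n :: ('m \<times> nat) set"
    have n1: "n \<ge> 1" "n \<ge> N" using n by auto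
    define B where "B = measure (cleb ?I) (oball ?I 1)"
    have B: "B > 0" unfolding B_def by (intro measure_oball_pos) auto
    define A where "A = near_cone n d (s / 4) \<inter> oball ?I 1"
    have nc: "near_cone n d' s' \<in> sets (cleb ?I)" for d' :: "'m \<Rightarrow> real" and s'
      using cone_near_cone[of n d' s'] by (simp add: cone_def)
    let ?T = "{y \<in> space (cleb ?I). (\<lambda>k\<in>?I. t (fst k) *\<^sub>R y k) \<in> A}"
    have A: "A \<in> sets (cleb ?I)" unfolding A_def using nc by auto
    have scale: "measure (cleb ?I) ?T * (\<Prod>a\<in>UNIV. (t a)\<^sup>2) ^ n = measure (cleb ?I) A"
      by (intro measure_cleb_bip_scale t A)
    have sub: "near_cone n ?p k \<inter> oball ?I 1 \<subseteq> ?T"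
    proof
      fix y assume y: "y \<in> near_cone n ?p k \<inter> oball ?I 1"
      let ?ty = "\<lambda>k\<in>?I. t (fst k) *\<^sub>R y k"
      let ?c = "(cnorm ?I y)\<^sup>2" and ?c' = "(cnorm ?I ?ty)\<^sup>2"
      have sp: "y \<in> space (cleb ?I)" and c: "cnorm ?I y < 1"
        and R: "\<And>a b. cmod (reduced_state n y $ a $ b - of_real ?c * diag_real ?p $ a $ b) < k * ?c"
        using y by (auto simp: near_cone_def oball_def)
      \<comment> \<open>The strict inequality in \<open>near_cone\<close> excludes the zero
        vector.\<close>
      have cpos: "0 < ?c" using order.strict_trans1[OF norm_ge_zero R] k(3) by (rule zero_less_mult_pos)
      have "?c' = (\<Sum>a\<in>UNIV. (t a)\<^sup>2 * Re (reduced_state n y $ a $ a))"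
        unfolding cnorm_reduced_state reduced_state_scale by (simp add: power2_eq_square)
      also have "\<dots> = (\<Sum>a\<in>UNIV. \<tau> * ?c * d a + \<tau> * ?m * d a * (Re (reduced_state n y $ a $ a) - ?c / ?m))"
        by (intro sum.cong refl) (simp add: t2 field_simps)
      \<comment> \<open>Since d sums to 1, a vector with reduced matrix exactly proportional to
        \<pi> would get squared norm \<tau> times the old one. The sum is the error made by the
        deviation from \<pi>.\<close>
      finally have c'_eq: "?c' - \<tau> * ?c = (\<Sum>a\<in>UNIV. \<tau> * ?m * d a * (Re (reduced_state n y $ a $ a) - ?c / ?m))"
        by (simp add: sum.distrib sum_distrib_left[symmetric] d(2))
      have "\<bar>?c' - \<tau> * ?c\<bar> \<le> (\<Sum>a\<in>UNIV. \<tau> * ?m * d a * (k * ?c))"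
        unfolding c'_eq
      proof (intro order.trans[OF sum_abs] sum_mono)
        fix a
        have "\<bar>Re (reduced_state n y $ a $ a) - ?c / ?m\<bar> \<le> k * ?c"
          using R[of a a] abs_Re_le_cmod[of "reduced_state n y $ a $ a - of_real ?c * diag_real ?p $ a $ a"]
          by (simp add: diag_real_def)
        then show "\<bar>\<tau> * ?m * d a * (Re (reduced_state n y $ a $ a) - ?c / ?m)\<bar> \<le> \<tau> * ?m * d a * (k * ?c)"
          using \<tau>(1) d(1)[of a] by (simp add: abs_mult mult_left_mono)
      qed
      also have "\<dots> = \<tau> * ?m * k * ?c"
        using d(2) by (simp add: sum_distrib_left[symmetric] sum_distrib_right[symmetric] mult_ac)
      finally have c': "\<bar>?c' - \<tau> * ?c\<bar> \<le> \<tau> * ?m * k * ?c" .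
      have "?c' \<le> \<tau> * ?c + \<tau> * ?m * k * ?c" using c' by linarith
      also have "\<dots> = (\<tau> * (1 + ?m * k)) * ?c" by (simp add: algebra_simps)
      also have "\<dots> < 1" using c \<tau>(3) by (simp add: abs_square_less_1)
      finally have "cnorm ?I ?ty < 1" by (simp add: abs_square_less_1)
      moreover have "cmod (reduced_state n ?ty $ a $ b - of_real ?c' * diag_real d $ a $ b) < s / 4 * ?c'" for a b
      proof -
        \<comment> \<open>The rescaling carries the centre \<pi> of the old cone to \<tau> times the
          centre of the new one.\<close>
        have tt: "of_real (t a * t b) * diag_real ?p $ a $ b = of_real \<tau> * diag_real d $ a $ b"
        proof -
          have "t a * t a * (1 / ?m) = \<tau> * d a" using t2[of a] by (simp add: power2_eq_square)
          then have "complex_of_real (t a * t a * (1 / ?m)) = complex_of_real (\<tau> * d a)" by (rule arg_cong)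
          then show ?thesis by (auto simp: diag_real_def)
        qed
        have "t a * t b \<le> \<tau> * ?m"
        proof -
          have "t a \<le> sqrt (\<tau> * ?m)" for a
            unfolding t_def using d1[of a] \<tau>(1) by (intro real_sqrt_le_mono mult_left_mono) auto
          then have "t a * t b \<le> sqrt (\<tau> * ?m) * sqrt (\<tau> * ?m)"
            using t \<tau>(1) by (intro mult_mono) (auto simp: less_imp_le)
          then show ?thesis using \<tau>(1) by simp
        qed
        have "reduced_state n ?ty $ a $ b - of_real ?c' * diag_real d $ a $ b =
            of_real (t a * t b) * (reduced_state n y $ a $ b - of_real ?c * diag_real ?p $ a $ b) -
            of_real (?c' - \<tau> * ?c) * diag_real d $ a $ b"
          unfolding reduced_state_scale using tt by (simp add: algebra_simps)
        then have "cmod (reduced_state n ?ty $ a $ b - of_real ?c' * diag_real d $ a $ b) \<le>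
            cmod (of_real (t a * t b) * (reduced_state n y $ a $ b - of_real ?c * diag_real ?p $ a $ b)) +
            cmod (of_real (?c' - \<tau> * ?c) * diag_real d $ a $ b)"
          by (simp only: norm_triangle_ineq4)
        also have "\<dots> = t a * t b * cmod (reduced_state n y $ a $ b - of_real ?c * diag_real ?p $ a $ b) +
            \<bar>?c' - \<tau> * ?c\<bar> * cmod (diag_real d $ a $ b)"
          using t[of a] t[of b] by (simp only: norm_mult norm_of_real abs_mult abs_of_pos)
        also have "\<dots> \<le> \<tau> * ?m * (k * ?c) + \<tau> * ?m * k * ?c * 1"
        proof (intro add_mono)
          show "t a * t b * cmod (reduced_state n y $ a $ b - of_real ?c * diag_real ?p $ a $ b) \<le> \<tau> * ?m * (k * ?c)"
            by (rule mult_mono[OF \<open>t a * t b \<le> \<tau> * ?m\<close> less_imp_le[OF R]]) (use \<tau>(1) in auto)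
          show "\<bar>?c' - \<tau> * ?c\<bar> * cmod (diag_real d $ a $ b) \<le> \<tau> * ?m * k * ?c * 1"
            by (rule mult_mono[OF c'])
              (use \<tau>(1) k(3) d(1)[of a] d1[of a] in \<open>auto simp: diag_real_def less_imp_le\<close>)
        qed
        also have "\<dots> = 2 * (?m * k) * (\<tau> * ?c)" by simp
        also have "\<dots> < s / 4 * ?c'"
        proof -
          have p: "0 < \<tau> * ?c" using \<tau>(1) cpos by simp
          \<comment> \<open>With m k < s/16 \<le> 1/16 the left factor is below s/8, and the right
            one is at least s/8.\<close>
          have "2 * (?m * k) * (\<tau> * ?c) < s / 4 * (1 - ?m * k) * (\<tau> * ?c)"
          proof (rule mult_strict_right_mono[OF _ p])
            have "s / 4 * (1 / 2) \<le> s / 4 * (1 - ?m * k)"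
              using mk s by (intro mult_left_mono) linarith+
            then show "2 * (?m * k) < s / 4 * (1 - ?m * k)" using mk s by linarith
          qed
          also have "\<dots> \<le> s / 4 * ?c'"
          proof -
            have "(1 - ?m * k) * (\<tau> * ?c) \<le> ?c'" using c' by (simp add: algebra_simps)
            then have "s / 4 * ((1 - ?m * k) * (\<tau> * ?c)) \<le> s / 4 * ?c'" using s by (intro mult_left_mono) auto
            then show ?thesis by (simp add: mult.assoc)
          qed
          finally show ?thesis .
        qed
        finally show ?thesis .
      qed
      ultimately show "y \<in> ?T" using sp by (simp add: A_def near_cone_def oball_def space_cleb)
    qed
    have low: "B / 2 * (?m ^ CARD('m) * b) ^ n \<le> measure (cleb ?I) A"
    proof -
      have "(?m ^ CARD('m) * b) ^ n \<le> (\<Prod>a\<in>UNIV. (t a)\<^sup>2) ^ n" using T b(1) by (intro power_mono) auto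
      moreover have "B / 2 \<le> measure (cleb ?I) ?T"
      proof -
        have "A \<in> fmeasurable (cleb ?I)"
          by (rule fmeasurableI2[OF fmeasurable_oball _ A]) (auto simp: A_def)
        then have "measure (cleb ?I) (near_cone n ?p k \<inter> oball ?I 1) \<le> measure (cleb ?I) ?T"
          using nc by (intro measure_mono_fmeasurable[OF sub] fmeasurable_bip_scale t) auto
        then show ?thesis using N[OF n1(2) inv] unfolding B_def by linarith
      qed
      ultimately have "B / 2 * (?m ^ CARD('m) * b) ^ n \<le> measure (cleb ?I) ?T * (\<Prod>a\<in>UNIV. (t a)\<^sup>2) ^ n"
        using B b(1) by (intro mult_mono) auto
      then show ?thesis using scale by simp
    qed
    \<comment> \<open>Lower bounds on \<mu> are only reachable through the complement: states
      outside G come from vectors whose neighbourhoods avoid the small cone.\<close>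
    define C where "C = space (cleb ?I) - near_cone n d (s / 4)"
    have GE: "state_event n \<mu> G \<in> events" by (rule sets_state_event[OF inv G])
    have "measure \<mu> (space \<mu> - state_event n \<mu> G) * B \<le> measure (cleb ?I) (C \<inter> oball ?I 1)"
      unfolding B_def
    proof (rule invariant_measure_le_cone_real[OF inv n1(1), of "s / 24"])
      show "cone ?I C" unfolding C_def by (intro cone_Diff cone_near_cone)
      fix x y assume x: "x \<in> space \<mu> - state_event n \<mu> G" and y: "y \<in> space (cleb ?I)"
        and xy: "cnorm ?I (\<lambda>k. x k - y k) < s / 24"
      have cx: "cnorm ?I x = 1" using x space_invariant[OF inv] by auto
      have "y \<notin> near_cone n d (s / 4)"
        using near_cone_near_sphere(2)[OF s less_imp_le[OF d(1)] d1 cx xy] x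
        by (auto simp: state_event_def G_def)
      then show "y \<in> C" using y by (simp add: C_def)
    qed (use s GE in auto)
    also have "C \<inter> oball ?I 1 = oball ?I 1 - A" by (auto simp: C_def A_def oball_def)
    also have "measure (cleb ?I) (oball ?I 1 - A) = B - measure (cleb ?I) A"
      unfolding B_def using A emeasure_oball_finite[of ?I 1] by (intro measure_Diff) (auto simp: A_def)
    also have "\<dots> \<le> B - B / 2 * (?m ^ CARD('m) * b) ^ n" using low by simp
    finally have "(1 - measure \<mu> (state_event n \<mu> G)) * B \<le> (1 - (?m ^ CARD('m) * b) ^ n / 2) * B"
      by (simp add: prob_compl[OF GE] algebra_simps)
    then show ?thesis using B by simp
  qed
  then show ?thesis unfolding G_def by blast
qed

text \<open>A positive determinant makes all eigenvalues positive, and conjugation by U reduces to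
  the diagonal case. Entries below \<open>s / m\<^sup>2\<close> force norm below s, as there are
  \<open>m\<^sup>2\<close> of them.\<close>

lemma state_event_ball_lower:
  fixes \<rho> :: "complex ^ 'm ^ 'm"
  assumes \<rho>: "\<rho> \<in> density_ops" and b: "0 \<le> b" "b < Re (det \<rho>)" and s: "0 < s"
  shows "\<exists>N. \<forall>n\<ge>N. \<forall>\<mu>. unitarily_invariant_prob n \<mu> \<longrightarrow>
    (real CARD('m) ^ CARD('m) * b) ^ n / 2 \<le> measure \<mu> (state_event n \<mu> (ball \<rho> s))"
proof -
  let ?m = "real CARD('m)"
  obtain U d where U: "unitary U" and \<rho>_eq: "\<rho> = U ** diag_real d ** adj U"
    and d: "\<forall>i. 0 \<le> d i" "(\<Sum>i\<in>UNIV. d i) = 1"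
    using density_ops_diagonalization[OF \<rho>] .
  have det: "Re (det \<rho>) = (\<Prod>i\<in>UNIV. d i)" by (simp add: \<rho>_eq det_unitary_diag[OF U] del: of_real_prod)
  then have "(\<Prod>i\<in>UNIV. d i) \<noteq> 0" using b by linarith
  then have dpos: "0 < d i" for i using d(1)[rule_format, of i] by (auto simp: less_le)
  define r where "r = min 1 (s / ?m\<^sup>2)"
  have r: "0 < r" "r \<le> 1" "r \<le> s / ?m\<^sup>2" using s by (auto simp: r_def)
  define G where "G = {\<sigma> :: complex ^ 'm ^ 'm. \<forall>a b. cmod (\<sigma> $ a $ b - diag_real d $ a $ b) < r}"
  have "G = (\<Inter>a. \<Inter>b. {\<rho>. cmod (\<rho> $ a $ b - diag_real d $ a $ b) < r})" by (auto simp: G_def)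
  moreover have "open \<dots>" by (intro open_INT finite ballI open_Collect_less continuous_intros)
  ultimately have G: "G \<in> sets borel" by simp
  obtain N where N: "\<And>n \<mu>. n \<ge> N \<Longrightarrow> unitarily_invariant_prob n \<mu> \<Longrightarrow>
      (?m ^ CARD('m) * b) ^ n / 2 \<le> measure \<mu> (state_event n \<mu> G)"
    using state_event_diag_lower[OF dpos d(2) r(1,2) b(1)] b(2) unfolding det G_def by auto
  have "{\<sigma>. adj U ** \<sigma> ** adj (adj U) \<in> G} \<subseteq> ball \<rho> s"
  proof
    fix \<sigma> assume "\<sigma> \<in> {\<sigma>. adj U ** \<sigma> ** adj (adj U) \<in> G}"
    then have "cmod ((adj U ** \<sigma> ** U - diag_real d) $ a $ b) < r" for a b
      by (simp add: G_def)
    then have "cmod ((adj U ** \<sigma> ** U - diag_real d) $ a $ b) < s / ?m\<^sup>2" for a b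
      using r(3) by (rule order.strict_trans2)
    then have "norm (adj U ** \<sigma> ** U - diag_real d) < s" by (rule norm_less_if_nth_less)
    then show "\<sigma> \<in> ball \<rho> s"
      using norm_unitary_conj_diff[OF U, of \<sigma> "diag_real d"]
      by (simp add: \<rho>_eq dist_norm norm_minus_commute)
  qed
  then have sub: "state_event n \<mu> {\<sigma>. adj U ** \<sigma> ** adj (adj U) \<in> G} \<subseteq> state_event n \<mu> (ball \<rho> s)" for n \<mu>
    by (auto simp: state_event_def)
  have "(?m ^ CARD('m) * b) ^ n / 2 \<le> measure \<mu> (state_event n \<mu> (ball \<rho> s))"
    if n: "n \<ge> N" and inv: "unitarily_invariant_prob n \<mu>" for n \<mu>
  proof -
    interpret prob_space \<mu> using inv by (simp add: unitarily_invariant_prob_def)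
    have "(?m ^ CARD('m) * b) ^ n / 2 \<le> measure \<mu> (state_event n \<mu> {\<sigma>. adj U ** \<sigma> ** adj (adj U) \<in> G})"
      unfolding measure_state_event_unitary[OF inv unitary_adj[OF U] G] by (rule N[OF n inv])
    also have "\<dots> \<le> measure \<mu> (state_event n \<mu> (ball \<rho> s))"
      by (intro finite_measure_mono sub sets_state_event inv) simp
    finally show ?thesis .
  qed
  then show ?thesis by blast
qed

section \<open>The large deviation estimate\<close>

lemma closure_of_state_topology:
  fixes \<Omega> :: "(complex ^ 'm ^ 'm) set"
  assumes "\<Omega> \<subseteq> density_ops"
  shows "state_topology closure_of \<Omega> = closure \<Omega>"
proof -
  have "closure \<Omega> \<subseteq> density_ops"
    using assms compact_imp_closed[OF compact_density_ops] by (intro closure_minimal)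
  then show ?thesis
    using assms by (simp add: state_topology_eq closure_of_subtopology Int_absorb1)
qed

text \<open>Through this inclusion, a state far from all minimizers is far from all maximizers of
  the determinant.\<close>

lemma maximizer_in_entropy_minimizers:
  fixes \<Omega> :: "(complex ^ 'm ^ 'm) set"
  assumes "\<Omega> \<subseteq> density_ops" "\<sigma> \<in> closure \<Omega>" "\<And>\<rho>. \<rho> \<in> closure \<Omega> \<Longrightarrow> Re (det \<rho>) \<le> Re (det \<sigma>)"
  shows "\<sigma> \<in> entropy_minimizers \<Omega>"
proof -
  have sub: "closure \<Omega> \<subseteq> density_ops"
    using assms(1) compact_imp_closed[OF compact_density_ops] by (intro closure_minimal)
  have "rel_entropy max_mixed \<sigma> = (INF \<rho>\<in>closure \<Omega>. rel_entropy max_mixed \<rho>)"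
  proof (rule antisym)
    show "rel_entropy max_mixed \<sigma> \<le> (INF \<rho>\<in>closure \<Omega>. rel_entropy max_mixed \<rho>)"
      using assms sub by (intro INF_greatest rel_entropy_max_mixed_antimono) auto
    show "(INF \<rho>\<in>closure \<Omega>. rel_entropy max_mixed \<rho>) \<le> rel_entropy max_mixed \<sigma>"
      using assms(2) by (intro INF_lower)
  qed
  then show ?thesis
    using assms(2) by (simp add: entropy_minimizers_def closure_of_state_topology[OF assms(1)])
qed

text \<open>Mixing with \<pi> by a small weight t makes every eigenvalue positive and moves the
  state by at most 2 t. Thus a nonempty open set of states contains one of positive
  determinant.\<close>

lemma full_rank_dense:
  fixes \<rho> :: "complex ^ 'm ^ 'm"
  assumes "\<rho> \<in> density_ops" "0 < e"
  shows "\<exists>\<sigma>\<in>density_ops. dist \<sigma> \<rho> < e \<and> 0 < Re (det \<sigma>)"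
proof -
  obtain U d where U: "unitary U" and \<rho>: "\<rho> = U ** diag_real d ** adj U"
    and d: "\<forall>i. 0 \<le> d i" "(\<Sum>i\<in>UNIV. d i) = 1"
    using density_ops_diagonalization[OF assms(1)] .
  define t where "t = min (1 / 2) (e / 4)"
  have t: "0 < t" "t < 1" "t < e / 2" using assms(2) by (auto simp: t_def min_def)
  define f where "f i = (1 - t) * d i + t * (1 / CARD('m))" for i
  define \<sigma> where "\<sigma> = U ** diag_real f ** adj U"
  have f_pos: "0 < f i" for i using t d(1) by (auto simp: f_def intro!: add_nonneg_pos)
  have "(\<Sum>i\<in>UNIV. f i) = 1" by (simp add: f_def sum.distrib sum_distrib_left[symmetric] d(2))
  then have \<sigma>_dens: "\<sigma> \<in> density_ops"
    unfolding \<sigma>_def using f_pos by (intro unitary_diag_in_density_ops U) (auto simp: less_imp_le)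
  have "dist \<sigma> \<rho> = norm (diag_real f - diag_real d)"
    by (simp only: dist_norm \<rho> \<sigma>_def norm_unitary_conj_diff[OF U] unitary_conj_cancel[OF U])
  also have "diag_real f - diag_real d = diag_real (\<lambda>i. f i - d i)"
    by (simp add: vec_eq_iff diag_real_def)
  also have "norm \<dots> \<le> (\<Sum>i\<in>UNIV. \<bar>f i - d i\<bar>)"
    unfolding norm_diag_real by (rule L2_set_le_sum_abs)
  also have "\<dots> \<le> (\<Sum>i\<in>UNIV. t * (d i + 1 / CARD('m)))"
  proof (rule sum_mono)
    fix i
    have "f i - d i = t * (1 / CARD('m) - d i)" by (simp add: f_def algebra_simps)
    then have "\<bar>f i - d i\<bar> = t * \<bar>1 / CARD('m) - d i\<bar>" using t by (simp add: abs_mult)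
    also have "\<dots> \<le> t * (d i + 1 / CARD('m))"
      using t d(1) by (intro mult_left_mono) (auto simp: abs_le_iff)
    finally show "\<bar>f i - d i\<bar> \<le> t * (d i + 1 / CARD('m))" .
  qed
  also have "\<dots> = t * 2" by (simp add: sum_distrib_left[symmetric] sum.distrib d(2))
  also have "\<dots> < e" using t by simp
  finally have "dist \<sigma> \<rho> < e" .
  moreover have "0 < Re (det \<sigma>)"
    using f_pos by (simp add: \<sigma>_def det_unitary_diag[OF U] prod_pos del: of_real_prod)
  ultimately show ?thesis using \<sigma>_dens by blast
qed

text \<open>A constant prefactor costs ln c / n, which r absorbs. If x = 0 the left side is
  -\<infinity>, and there is nothing to estimate.\<close>

lemma scaled_ereal_ln_le:
  assumes "1 \<le> n" "0 \<le> x" "x \<le> c * q ^ n" "0 < c" "0 < q" and c: "ln c \<le> real n * r"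
  shows "ereal (1 / real n) * ereal_ln x \<le> ereal (r + ln q)"
proof (cases "x = 0")
  case True
  then show ?thesis using assms(1) by (simp add: ereal_ln_def)
next
  case False
  then have "ln x \<le> ln (c * q ^ n)" using assms by (intro ln_mono) auto
  also have "\<dots> = ln c + real n * ln q" using assms by (simp add: ln_mult ln_realpow)
  also have "\<dots> \<le> real n * (r + ln q)" using c by (simp add: algebra_simps)
  finally have "1 / real n * ln x \<le> r + ln q"
    using assms(1) by (simp add: pos_divide_le_eq mult.commute)
  then show ?thesis using False by (simp add: ereal_ln_def)
qed

theorem theorem10:
  fixes \<mu> :: "nat \<Rightarrow> ('m::finite \<times> nat \<Rightarrow> complex) measure"
    and \<Omega> :: "(complex ^ 'm ^ 'm) set"
    and \<epsilon> :: real
  assumes "\<And>n. n \<ge> 1 \<Longrightarrow> unitarily_invariant_prob n (\<mu> n)"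
    and "\<Omega> \<subseteq> density_ops"
    and "\<Omega> \<noteq> {}"
    and "\<And>n. n \<ge> 1 \<Longrightarrow> state_event n (\<mu> n) \<Omega> \<in> sets (\<mu> n)"
    and "state_topology closure_of (state_topology interior_of \<Omega>) = state_topology closure_of \<Omega>"
    and "\<epsilon> > 0"
  shows "\<exists>\<delta>::real. \<delta> > 0 \<and>
    - limsup (\<lambda>n. ereal (1 / real n) *
        ereal_ln (measure (\<mu> n) (state_event n (\<mu> n) (\<Omega> - state_nbhd \<epsilon> (entropy_minimizers \<Omega>)))
                  / measure (\<mu> n) (state_event n (\<mu> n) \<Omega>)))
      \<ge> ereal \<delta>"
proof -
  note inv = assms(1) and \<Omega> = assms(2)
  let ?F = "\<lambda>\<rho> :: complex ^ 'm ^ 'm. Re (det \<rho>)"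
  let ?m = "real CARD('m)"
  define K where "K = closure \<Omega>"
  define J where "J = state_topology interior_of \<Omega>"
  have K_sub: "K \<subseteq> density_ops"
    unfolding K_def using \<Omega> compact_imp_closed[OF compact_density_ops] by (intro closure_minimal)
  have K: "compact K"
    using compact_Int_closed[OF compact_density_ops closed_closure[of \<Omega>]] K_sub
    by (simp add: K_def Int_absorb1)
  have J_sub: "J \<subseteq> \<Omega>" unfolding J_def by (rule interior_of_subset)
  have J_open: "openin (top_of_set density_ops) J"
    unfolding J_def state_topology_eq by (rule openin_interior_of)
  have clJ: "closure J = K"
    using assms(5) closure_of_state_topology[OF \<Omega>] closure_of_state_topology[of J] J_sub \<Omega>
    by (auto simp: J_def K_def)
  have J_ball: "\<exists>e>0. ball \<rho> e \<inter> density_ops \<subseteq> J" if "\<rho> \<in> J" for \<rho>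
    using J_open that unfolding openin_contains_ball by blast
  \<comment> \<open>The interior contains a state of full rank, so the largest determinant M is
    positive and the minimal relative entropy finite.\<close>
  have "J \<noteq> {}" using clJ assms(3) closure_subset[of \<Omega>] by (auto simp: K_def)
  then obtain \<rho>0 e0 where "\<rho>0 \<in> J" "e0 > 0" "ball \<rho>0 e0 \<inter> density_ops \<subseteq> J" using J_ball by blast
  moreover from this obtain \<sigma>0 where "\<sigma>0 \<in> density_ops" "dist \<sigma>0 \<rho>0 < e0" "0 < ?F \<sigma>0"
    using full_rank_dense[of \<rho>0 e0] J_sub \<Omega> by blast
  ultimately have \<sigma>0: "\<sigma>0 \<in> J" "0 < ?F \<sigma>0" by (auto simp: dist_commute)
  have "K \<noteq> {}" using assms(3) by (simp add: K_def)
  then obtain \<sigma> where \<sigma>: "\<sigma> \<in> K" "\<And>\<rho>. \<rho> \<in> K \<Longrightarrow> ?F \<rho> \<le> ?F \<sigma>"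
    using continuous_attains_sup[OF K _ continuous_on_det] by blast
  define M where "M = ?F \<sigma>"
  have "\<sigma>0 \<in> K" using \<sigma>0(1) J_sub closure_subset[of \<Omega>] by (auto simp: K_def)
  then have M: "0 < M" using \<sigma>(2) \<sigma>0(2) by (fastforce simp: M_def)
  define S where "S = {\<tau> \<in> K. ?F \<tau> = M}"
  have S_min: "\<tau> \<in> entropy_minimizers \<Omega>" if "\<tau> \<in> S" for \<tau>
    using that \<sigma> by (intro maximizer_in_entropy_minimizers \<Omega>) (auto simp: S_def K_def M_def)
  \<comment> \<open>A compact set that contains the far part of \<Omega>. Trace distance is at most
    m/2 times the norm, so trace distance above \<epsilon> forces norm at least 2 \<epsilon> /
    m.\<close>
  define K' where "K' = K \<inter> (\<Inter>\<tau>\<in>S. {\<rho>. 2 * \<epsilon> / ?m \<le> norm (\<rho> - \<tau>)})"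
  have "closed (\<Inter>\<tau>\<in>S. {\<rho>. 2 * \<epsilon> / ?m \<le> norm (\<rho> - \<tau>)})"
    by (intro closed_INT ballI closed_Collect_le continuous_intros)
  then have K': "compact K'" unfolding K'_def by (rule compact_Int_closed[OF K])
  have far: "\<Omega> - state_nbhd \<epsilon> (entropy_minimizers \<Omega>) \<subseteq> K'"
  proof
    fix \<rho> assume \<rho>: "\<rho> \<in> \<Omega> - state_nbhd \<epsilon> (entropy_minimizers \<Omega>)"
    have "2 * \<epsilon> / ?m \<le> norm (\<rho> - \<tau>)" if \<tau>: "\<tau> \<in> S" for \<tau>
    proof -
      have dens: "\<rho> \<in> density_ops" "\<tau> \<in> density_ops" using \<rho> \<tau> \<Omega> K_sub by (auto simp: S_def)
      have "\<not> (INF \<sigma>\<in>entropy_minimizers \<Omega>. ereal (trace_dist \<rho> \<sigma>)) \<le> ereal \<epsilon>"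
        using \<rho> dens by (simp add: state_nbhd_def)
      moreover have "(INF \<sigma>\<in>entropy_minimizers \<Omega>. ereal (trace_dist \<rho> \<sigma>)) \<le> ereal (trace_dist \<rho> \<tau>)"
        by (intro INF_lower S_min \<tau>)
      ultimately have "\<epsilon> < trace_dist \<rho> \<tau>" by (metis ereal_less_eq(3) not_le order.trans)
      moreover have "2 * trace_dist \<rho> \<tau> \<le> ?m * norm (\<rho> - \<tau>)"
        using trace_norm_le_norm[OF hermitian_diff[OF dens[THEN density_ops_hermitian]]]
        by (simp add: trace_dist_def)
      ultimately have "2 * \<epsilon> \<le> ?m * norm (\<rho> - \<tau>)" by linarith
      then show ?thesis by (simp add: pos_divide_le_eq mult.commute)
    qed
    then show "\<rho> \<in> K'" using \<rho> closure_subset[of \<Omega>] by (auto simp: K'_def K_def)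
  qed
  have "?F \<rho> < M" if "\<rho> \<in> K'" for \<rho>
  proof (rule ccontr)
    assume "\<not> ?F \<rho> < M"
    then have "\<rho> \<in> S" using that \<sigma>(2)[of \<rho>] by (auto simp: S_def K'_def M_def)
    then have "2 * \<epsilon> / ?m \<le> norm (\<rho> - \<rho>)" using that unfolding K'_def by blast
    then show False using assms(6) by (simp add: field_simps)
  qed
  then obtain b1 where b1: "0 < b1" "b1 < M" "\<forall>\<rho>\<in>K'. ?F \<rho> < b1"
    using compact_strict_bound[OF K' continuous_on_det _ M] by blast
  define b2 where "b2 = (b1 + M) / 2"
  have b2: "b1 < b2" "b2 < M" using b1 by (auto simp: b2_def)
  \<comment> \<open>The maximizer \<sigma> itself may lie outside J, but it is a limit of points of
    J, and the determinant is continuous.\<close>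
  obtain \<rho>1 where \<rho>1: "\<rho>1 \<in> J" "b2 < ?F \<rho>1"
  proof -
    have "open {\<rho>. b2 < ?F \<rho>}"
      by (intro open_Collect_less continuous_intros continuous_on_det)
    moreover have "\<sigma> \<in> closure J \<inter> {\<rho>. b2 < ?F \<rho>}" using \<sigma>(1) b2(2) clJ by (simp add: M_def)
    ultimately have "J \<inter> {\<rho>. b2 < ?F \<rho>} \<noteq> {}"
      using open_Int_closure_eq_empty[of "{\<rho>. b2 < ?F \<rho>}" J] by (auto simp: Int_commute)
    then show ?thesis using that by blast
  qed
  then obtain e1 where e1: "e1 > 0" "ball \<rho>1 e1 \<inter> density_ops \<subseteq> J" using J_ball by blast
  have K'_dens: "K' \<subseteq> density_ops" using K_sub by (auto simp: K'_def)
  obtain c :: nat where c: "\<forall>n\<ge>1. \<forall>\<mu>. unitarily_invariant_prob n \<mu> \<longrightarrow>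
      measure \<mu> (state_event n \<mu> K') \<le> c * (?m ^ CARD('m) * b1) ^ n"
    using state_event_compact_upper[OF K' K'_dens bspec[OF b1(3)]] by blast
  have "\<rho>1 \<in> density_ops" using \<rho>1(1) J_sub \<Omega> by blast
  then obtain N where N: "\<forall>n\<ge>N. \<forall>\<mu>. unitarily_invariant_prob n \<mu> \<longrightarrow>
      (?m ^ CARD('m) * b2) ^ n / 2 \<le> measure \<mu> (state_event n \<mu> (ball \<rho>1 e1))"
    using state_event_ball_lower[OF _ _ \<rho>1(2) e1(1)] b1(1) b2(1) by fastforce
  define q where "q = b1 / b2"
  \<comment> \<open>The factor 2 is the reciprocal of the 1/2 in the lower bound, and the added 1
    makes C positive even if c = 0.\<close>
  define C where "C = 2 * (real c + 1)"
  \<comment> \<open>The actual rate is -ln q = 2 \<delta>. One half absorbs the prefactor C for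
    large n, the other half remains.\<close>
  define \<delta> where "\<delta> = - ln q / 2"
  have q: "0 < q" "q < 1" using b1 b2 by (auto simp: q_def)
  then have \<delta>: "0 < \<delta>" by (simp add: \<delta>_def)
  obtain N' :: nat where N': "ln C / \<delta> \<le> real N'" using real_arch_simple by blast
  have "ereal (1 / real n) *
      ereal_ln (measure (\<mu> n) (state_event n (\<mu> n) (\<Omega> - state_nbhd \<epsilon> (entropy_minimizers \<Omega>)))
                / measure (\<mu> n) (state_event n (\<mu> n) \<Omega>)) \<le> ereal (- \<delta>)"
    if n: "n \<ge> max 1 (max N N')" for n
  proof -
    let ?num = "measure (\<mu> n) (state_event n (\<mu> n) (\<Omega> - state_nbhd \<epsilon> (entropy_minimizers \<Omega>)))"
    let ?den = "measure (\<mu> n) (state_event n (\<mu> n) \<Omega>)"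
    have n1: "n \<ge> 1" "n \<ge> N" "n \<ge> N'" using n by auto
    note inv_n = inv[OF n1(1)]
    interpret prob_space "\<mu> n" using inv_n by (simp add: unitarily_invariant_prob_def)
    define x where "x = ?m ^ CARD('m)"
    have x: "x > 0" by (simp add: x_def)
    \<comment> \<open>Monotonicity asks for measurability of the larger event only, and that one
      comes from a compact set.\<close>
    have "?num \<le> measure (\<mu> n) (state_event n (\<mu> n) K')"
      using far K' by (intro finite_measure_mono sets_state_event[OF inv_n])
        (auto simp: state_event_def intro: borel_closed compact_imp_closed)
    also have "\<dots> \<le> c * (x * b1) ^ n" using c n1(1) inv_n by (simp add: x_def)
    also have "\<dots> \<le> (real c + 1) * (x * b1) ^ n" using x b1(1) by (intro mult_right_mono) auto
    finally have num: "?num \<le> (real c + 1) * (x * b1) ^ n" .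
    have "(x * b2) ^ n / 2 \<le> measure (\<mu> n) (state_event n (\<mu> n) (ball \<rho>1 e1))"
      using N n1(2) inv_n by (simp add: x_def)
    also have "\<dots> \<le> ?den"
    \<comment> \<open>The ball reaches beyond the state space, but reduced states of unit vectors
      never do.\<close>
    proof (rule finite_measure_mono[OF _ assms(4)[OF n1(1)]])
      show "state_event n (\<mu> n) (ball \<rho>1 e1) \<subseteq> state_event n (\<mu> n) \<Omega>"
        using e1(2) J_sub reduced_state_density_ops space_invariant[OF inv_n]
        unfolding state_event_def by blast
    qed
    finally have den: "(x * b2) ^ n / 2 \<le> ?den" .
    have "0 < (x * b2) ^ n / 2" using x b1(1) b2(1) by simp
    then have "?num / ?den \<le> (real c + 1) * (x * b1) ^ n / ((x * b2) ^ n / 2)"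
      using num den x b1(1) by (intro frac_le) auto
    also have "\<dots> = C * q ^ n" using x b1(1) b2(1) by (simp add: C_def q_def power_mult_distrib power_divide field_simps)
    finally have "?num / ?den \<le> C * q ^ n" .
    moreover have "ln C \<le> real n * \<delta>"
    proof -
      have "ln C / \<delta> \<le> real n" using N' n1(3) by linarith
      then show ?thesis using \<delta> by (simp add: pos_divide_le_eq)
    qed
    ultimately have "ereal (1 / real n) * ereal_ln (?num / ?den) \<le> ereal (\<delta> + ln q)"
      using q n1(1) by (intro scaled_ereal_ln_le[of n _ C]) (auto simp: C_def)
    then show ?thesis by (simp add: \<delta>_def)
  qed
  then have "\<forall>\<^sub>F n in sequentially. ereal (1 / real n) *
      ereal_ln (measure (\<mu> n) (state_event n (\<mu> n) (\<Omega> - state_nbhd \<epsilon> (entropy_minimizers \<Omega>)))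
                / measure (\<mu> n) (state_event n (\<mu> n) \<Omega>)) \<le> ereal (- \<delta>)"
    unfolding eventually_sequentially by blast
  from Limsup_bounded[OF this, THEN ereal_minus_le_minus[THEN iffD2]] show ?thesis
    using \<delta> by (intro exI[of _ \<delta>] conjI) simp_all
qed

end
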